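(* Every expanding soliton and every translating soliton for Lagrangian mean curvature flow in $\mathbb{C}^{m}$ is $f$-stable. That is: (a) if $F:L\looparrowright\mathbb{C}^{m}$ is a Lagrangian submanifold with $H-\frac12F^{\perp}=0$, then $L$ is $f$-stable with $f(z)=-\frac{|z|^{2}}{2}$; (b) if $T\in\mathbb{C}^{m}$ is a fixed vector and $F:L\looparrowright\mathbb{C}^{m}$ is a Lagrangian submanifold with $H+T^{\perp}=0$, then $L$ is $f$-stable with $f(z)=2\langle z,T\rangle$.
   Context: $\mathbb{C}^{m}$ carries its standard complex structure, Euclidean metric $\langle\cdot,\cdot\rangle$ (real inner product) and standard Kähler form. Submanifolds $F:L\looparrowright\mathbb{C}^m$ are immersed, oriented, connected; $L$ of real dimension $m$ is Lagrangian if the Kähler form pulls back to $0$. $H$ is the mean curvature vector, $\perp$ the projection to the normal bundle $NL$, $g$ the induced metric. The $f$-volume is $V_{f}(F(L))=\int_{L}e^{-\frac12F^{*}f}dV_{g}$; a Lagrangian is $f$-minimal if $H+\frac12(\overline{\nabla}f)^{\perp}=0$ (in both cases above this is exactly the given soliton equation). For a compactly supported normal variation $\{F_t\}$ with $F_0=F$ and $\frac{d}{dt}|_{t=0}F_t=\xi\in\Gamma_c(NL)$, $(\delta^{2}V_f)_{F(L)}(\xi)=\frac{d^2}{dt^2}|_{t=0}V_f(F_t(L))$. An $f$-minimal Lagrangian is $f$-stable if $(\delta^{2}V_{f})_{F(L)}(\xi)\ge0$ for all $\xi\in\Gamma_{c}(NL)$. *)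

theory Defs
  imports "HOL-Analysis.Analysis"
begin

text \<open>Smoothness on an open set of a Euclidean space: all iterated directional derivatives exist
  and are continuous.\<close>

primrec Ck_on :: "nat \<Rightarrow> ('a::euclidean_space \<Rightarrow> 'b::real_normed_vector) \<Rightarrow> 'a set \<Rightarrow> bool" where
  "Ck_on 0 f S \<longleftrightarrow> continuous_on S f"
| "Ck_on (Suc k) f S \<longleftrightarrow> (\<forall>x\<in>S. f differentiable (at x)) \<and>
     (\<forall>v. Ck_on k (\<lambda>x. frechet_derivative f (at x) v) S)"

definition smooth_on :: "('a::euclidean_space) set \<Rightarrow> ('a \<Rightarrow> 'b::real_normed_vector) \<Rightarrow> bool" where
  "smooth_on S f \<longleftrightarrow> (\<forall>k. Ck_on k f S)"

definition gradient :: "('a::real_inner \<Rightarrow> real) \<Rightarrow> 'a \<Rightarrow> 'a" where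
  "gradient f z = (THE D. GDERIV f z :> D)"


section \<open>Oriented connected manifolds\<close>

text \<open>A chart is a pair of a domain and a coordinate map; a manifold is given by an atlas, and its
  underlying space is the union of the chart domains, an open subset of an ambient Hausdorff
  second countable space. The ambient type is arbitrary and plays no geometric role. The orientation
  is the one for which all charts of the atlas are positive.\<close>

type_synonym ('l, 'm) chart = "'l set \<times> ('l \<Rightarrow> real ^ 'm)"

definition points :: "('l, 'm) chart set \<Rightarrow> 'l set" where
  "points A = (\<Union>c\<in>A. fst c)"

definition local_rep :: "('l, 'm) chart \<Rightarrow> ('l \<Rightarrow> 'b) \<Rightarrow> real ^ 'm \<Rightarrow> 'b" where
  "local_rep c F = F \<circ> inv_into (fst c) (snd c)"

definition oriented_connected_manifold ::
    "('l::{t2_space, second_countable_topology}, 'm::finite) chart set \<Rightarrow> bool" where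
  "oriented_connected_manifold A \<longleftrightarrow>
     connected (points A) \<and>
     (\<forall>(U, \<phi>)\<in>A. open U \<and> open (\<phi> ` U) \<and> homeomorphism U (\<phi> ` U) \<phi> (inv_into U \<phi>)) \<and>
     (\<forall>(U, \<phi>)\<in>A. \<forall>(V, \<psi>)\<in>A.
        smooth_on (\<phi> ` (U \<inter> V)) (\<psi> \<circ> inv_into U \<phi>) \<and>
        (\<forall>x\<in>\<phi> ` (U \<inter> V). 0 < det (matrix (frechet_derivative (\<psi> \<circ> inv_into U \<phi>) (at x)))))"

definition smooth_map :: "('l, 'm::finite) chart set \<Rightarrow> ('l \<Rightarrow> 'b::real_normed_vector) \<Rightarrow> bool" where
  "smooth_map A F \<longleftrightarrow> (\<forall>c\<in>A. smooth_on (snd c ` fst c) (local_rep c F))"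


section \<open>Immersed submanifolds of complex Euclidean space\<close>

text \<open>The library inner product on \<^typ>\<open>complex ^ 'n\<close> is the real Euclidean one, i.e. the real part of
  the standard Hermitian product. The quantities below that take a chart \<open>c\<close> and a point are
  computed in the coordinates of \<open>c\<close>; except for \<open>gram\<close> and \<open>partial\<close> they do not depend on the
  choice of the chart around that point.\<close>

definition immersion :: "('l, 'm::finite) chart set \<Rightarrow> ('l \<Rightarrow> complex ^ 'n) \<Rightarrow> bool" where
  "immersion A F \<longleftrightarrow> smooth_map A F \<and>
     (\<forall>c\<in>A. \<forall>x\<in>snd c ` fst c. inj (frechet_derivative (local_rep c F) (at x)))"

definition tangent_space :: "('l, 'm::finite) chart \<Rightarrow> ('l \<Rightarrow> complex ^ 'n) \<Rightarrow> 'l \<Rightarrow> (complex ^ 'n) set" where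
  "tangent_space c F p = range (frechet_derivative (local_rep c F) (at (snd c p)))"

definition normal_space :: "('l, 'm::finite) chart \<Rightarrow> ('l \<Rightarrow> complex ^ 'n) \<Rightarrow> 'l \<Rightarrow> (complex ^ 'n) set" where
  "normal_space c F p = orthogonal_comp (tangent_space c F p)"

definition normal_part ::
    "('l, 'm::finite) chart \<Rightarrow> ('l \<Rightarrow> complex ^ 'n) \<Rightarrow> 'l \<Rightarrow> complex ^ 'n \<Rightarrow> complex ^ 'n" where
  "normal_part c F p v = (THE w. w \<in> normal_space c F p \<and> v - w \<in> tangent_space c F p)"

definition kaehler_form :: "complex ^ 'n \<Rightarrow> complex ^ 'n \<Rightarrow> real" where
  "kaehler_form v w = (\<i> *s v) \<bullet> w"

definition lagrangian ::
    "('l::{t2_space, second_countable_topology}, 'm::finite) chart set \<Rightarrow> ('l \<Rightarrow> complex ^ 'm) \<Rightarrow> bool" where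
  "lagrangian A F \<longleftrightarrow> oriented_connected_manifold A \<and> immersion A F \<and>
     (\<forall>c\<in>A. \<forall>p\<in>fst c. \<forall>v\<in>tangent_space c F p. \<forall>w\<in>tangent_space c F p. kaehler_form v w = 0)"

definition partial :: "'m::finite \<Rightarrow> (real ^ 'm \<Rightarrow> 'b::real_normed_vector) \<Rightarrow> real ^ 'm \<Rightarrow> 'b" where
  "partial i f x = frechet_derivative f (at x) (axis i 1)"

definition gram :: "('l, 'm::finite) chart \<Rightarrow> ('l \<Rightarrow> complex ^ 'n) \<Rightarrow> real ^ 'm \<Rightarrow> real ^ 'm ^ 'm" where
  "gram c F x = (\<chi> i j. partial i (local_rep c F) x \<bullet> partial j (local_rep c F) x)"

text \<open>The mean curvature vector is the (unnormalised) trace of the second fundamental form, which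
  in a flat ambient space sends a pair of coordinate fields to the normal part of the second partial
  derivative of the immersion.\<close>

definition mean_curvature :: "('l, 'm::finite) chart \<Rightarrow> ('l \<Rightarrow> complex ^ 'n) \<Rightarrow> 'l \<Rightarrow> complex ^ 'n" where
  "mean_curvature c F p =
     (\<Sum>i\<in>UNIV. \<Sum>j\<in>UNIV. matrix_inv (gram c F (snd c p)) $ i $ j *\<^sub>R
        normal_part c F p (partial i (partial j (local_rep c F)) (snd c p)))"


section \<open>Weighted volume, variations and stability\<close>

text \<open>The Riemannian measure of the induced metric: the Borel measure with density
  \<open>sqrt (det g)\<close> in every chart.\<close>

definition volume_measure ::
    "('l::{t2_space, second_countable_topology}, 'm::finite) chart set \<Rightarrow> ('l \<Rightarrow> complex ^ 'n) \<Rightarrow> 'l measure" where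
  "volume_measure A F = (THE \<mu>. sets \<mu> = sets (restrict_space borel (points A)) \<and>
     (\<forall>c\<in>A. \<forall>B\<in>sets borel. B \<subseteq> fst c \<longrightarrow>
        emeasure \<mu> B = (\<integral>\<^sup>+x\<in>snd c ` B. ennreal (sqrt (det (gram c F x))) \<partial>lborel)))"

definition f_volume ::
    "('l::{t2_space, second_countable_topology}, 'm::finite) chart set \<Rightarrow> (complex ^ 'n \<Rightarrow> real) \<Rightarrow>
     ('l \<Rightarrow> complex ^ 'n) \<Rightarrow> 'l set \<Rightarrow> real" where
  "f_volume A f F K = (LINT p:K|volume_measure A F. exp (- (1 / 2) * f (F p)))"

definition normal_sections ::
    "('l::topological_space, 'm::finite) chart set \<Rightarrow> ('l \<Rightarrow> complex ^ 'n) \<Rightarrow> ('l \<Rightarrow> complex ^ 'n) set" where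
  "normal_sections A F = {\<xi>. smooth_map A \<xi> \<and> (\<forall>c\<in>A. \<forall>p\<in>fst c. \<xi> p \<in> normal_space c F p) \<and>
     (\<exists>K. compact K \<and> K \<subseteq> points A \<and> (\<forall>p\<in>points A - K. \<xi> p = 0))}"

text \<open>A smooth family of immersions with initial velocity \<open>\<xi>\<close> that is stationary outside
  the compact set \<open>K\<close>.\<close>

definition compact_variation ::
    "('l::topological_space, 'm::finite) chart set \<Rightarrow> ('l \<Rightarrow> complex ^ 'n) \<Rightarrow> ('l \<Rightarrow> complex ^ 'n) \<Rightarrow>
     'l set \<Rightarrow> (real \<Rightarrow> 'l \<Rightarrow> complex ^ 'n) \<Rightarrow> bool" where
  "compact_variation A F \<xi> K \<Phi> \<longleftrightarrow> compact K \<and> K \<subseteq> points A \<and>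
     (\<exists>\<epsilon>>0.
        (\<forall>c\<in>A. smooth_on ({-\<epsilon><..<\<epsilon>} \<times> (snd c ` fst c)) (\<lambda>(t, x). local_rep c (\<Phi> t) x)) \<and>
        (\<forall>t\<in>{-\<epsilon><..<\<epsilon>}. immersion A (\<Phi> t)) \<and>
        (\<forall>t\<in>{-\<epsilon><..<\<epsilon>}. \<forall>p\<in>points A - K. \<Phi> t p = F p)) \<and>
     (\<forall>p\<in>points A. \<Phi> 0 p = F p) \<and>
     (\<forall>p\<in>points A. ((\<lambda>t. \<Phi> t p) has_vector_derivative \<xi> p) (at 0))"

text \<open>The total weighted volume may be infinite. As usual it is therefore restricted to a compact
  set outside of which the variation is stationary; the contribution of the complement does not
  depend on time, so the derivatives do not depend on the compact set.\<close>

definition second_variation ::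
    "('l::{t2_space, second_countable_topology}, 'm::finite) chart set \<Rightarrow> (complex ^ 'n \<Rightarrow> real) \<Rightarrow>
     'l set \<Rightarrow> (real \<Rightarrow> 'l \<Rightarrow> complex ^ 'n) \<Rightarrow> real" where
  "second_variation A f K \<Phi> = deriv (deriv (\<lambda>t. f_volume A f (\<Phi> t) K)) 0"

definition f_minimal_lagrangian ::
    "('l::{t2_space, second_countable_topology}, 'm::finite) chart set \<Rightarrow> (complex ^ 'm \<Rightarrow> real) \<Rightarrow>
     ('l \<Rightarrow> complex ^ 'm) \<Rightarrow> bool" where
  "f_minimal_lagrangian A f F \<longleftrightarrow> lagrangian A F \<and>
     (\<forall>c\<in>A. \<forall>p\<in>fst c.
        mean_curvature c F p + (1 / 2) *\<^sub>R normal_part c F p (gradient f (F p)) = 0)"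

definition f_stable ::
    "('l::{t2_space, second_countable_topology}, 'm::finite) chart set \<Rightarrow> (complex ^ 'm \<Rightarrow> real) \<Rightarrow>
     ('l \<Rightarrow> complex ^ 'm) \<Rightarrow> bool" where
  "f_stable A f F \<longleftrightarrow> f_minimal_lagrangian A f F \<and>
     (\<forall>\<xi>\<in>normal_sections A F. \<forall>K \<Phi>.
        compact_variation A F \<xi> K \<Phi> \<longrightarrow> 0 \<le> second_variation A f K \<Phi>)"

end

theory Submission
  imports Defs
begin

text \<open>The second variation is never expanded into curvature terms; the solitons are compared with a
  calibrating integrand instead. Both cases are treated together: let \<open>- f z / 2\<close> be
  \<open>\<rho> z = \<kappa> / 4 * |z|^2 - <z, T>\<close> with \<open>\<kappa> \<ge> 0\<close>, so that \<open>\<kappa> = 1, T = 0\<close> is the expanding and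
  \<open>\<kappa> = 0\<close> the translating case. The soliton equation says that the mean curvature vector is the
  normal part of \<open>N = \<kappa> / 2 * F - T\<close>, which is minus half the gradient of \<open>f\<close> along \<open>F\<close>.

  An \<open>m\<close>-frame in \<open>\<complex>\<^sup>m\<close> with matrix \<open>M\<close> spans an \<open>m\<close>-dimensional volume of at least \<open>|det M|\<close>, the
  complex determinant (\<open>norm_det_le_sqrt_gram\<close>), with equality for Lagrangian frames
  (\<open>norm_det_eq_sqrt_gram\<close>). For a variation \<open>\<Phi> t\<close> of \<open>F\<close> with coordinate frames \<open>M t\<close> put
  \<open>b t = exp (\<rho> F + herm (\<Phi> t - F) N) * det (M t) / det (M 0)\<close>, where \<open>herm\<close> is the Hermitian product.
  The function \<open>\<rho> (\<Phi> t)\<close> exceeds the real part of the exponent by \<open>\<kappa> / 4 * |\<Phi> t - F|^2 \<ge> 0\<close>.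
  Hence \<open>Re (b t)\<close> is at most the weighted area element of \<open>\<Phi> t\<close> relative to that of \<open>F\<close>, with equality
  at \<open>t = 0\<close> (\<open>Re_calibration_le\<close>, \<open>calibration_initial\<close>), and the second derivative of the weighted
  volume at \<open>0\<close> is at least that of the integral of \<open>Re (b t)\<close>.

  The integral of \<open>b t\<close> is easy to differentiate because \<open>b t\<close> is holomorphic in \<open>\<Phi> t\<close>. On a Lagrangian
  submanifold the derivative of the phase of \<open>det (M 0)\<close> is the mean curvature paired with \<open>\<i>\<close> times the
  tangent vector (\<open>log_derivative_det_frame\<close>), so that the soliton equation identifies it with the
  imaginary part of \<open>herm (\<partial>\<^sub>i F) N\<close>. It follows that the time derivative of \<open>b t\<close> is
  a divergence plus a remainder \<open>r t\<close> (\<open>divergence_identity\<close>), where \<open>r t\<close> is \<open>- \<kappa> / 2\<close> times the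
  contraction of \<open>herm (\<Phi> t - F) (\<partial>\<^sub>i F)\<close> with the velocity. The remainder vanishes at \<open>t = 0\<close>, and the
  real part of its derivative there is \<open>\<kappa> / 2 * exp (\<rho> F) * |\<xi>|^2 \<ge> 0\<close>
  (\<open>Re_defect_derivative_nonneg\<close>); for translating solitons it vanishes identically, and these are
  calibrated submanifolds. Integrating, the second derivative of the integral of \<open>Re (b t)\<close> at \<open>0\<close> is the
  integral of a nonnegative function.

  The remaining work makes this rigorous on a manifold given by an atlas: the chart formula determines
  exactly one measure (\<open>is_volume_unique\<close>, \<open>is_volume_exists\<close>), integrals over compact sets may be
  differentiated in time (\<open>has_vector_derivative_set_integral\<close>), and the integral of the divergence
  vanishes by a partition of unity with continuously differentiable functions
  (\<open>balance_partition_zero\<close>).\<close>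

section \<open>Determinants with a replaced row\<close>

definition replace_row :: "'n \<Rightarrow> 'a ^ 'k \<Rightarrow> 'a ^ 'k ^ 'n \<Rightarrow> 'a ^ 'k ^ 'n" where
  "replace_row i w M = (\<chi> k. if k = i then w else M $ k)"

lemma replace_row_nth: "replace_row i w M $ k = (if k = i then w else M $ k)"
  by (simp add: replace_row_def)

lemma det_replace_row_scale:
  fixes M :: "'a::comm_ring_1 ^ 'n ^ 'n"
  shows "det (replace_row i (c *s w) M) = c * det (replace_row i w M)"
  unfolding replace_row_def using det_row_mul[of i c "\<lambda>_. w" "\<lambda>k. M $ k"] by simp

lemma det_replace_row_scaleR:
  fixes M :: "complex ^ 'n ^ 'n"
  shows "det (replace_row i (c *\<^sub>R w) M) = of_real c * det (replace_row i w M)"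
proof -
  have "c *\<^sub>R w = (of_real c :: complex) *s w"
    by (simp add: vec_eq_iff scaleR_conv_of_real[where x="_ :: complex"])
  then show ?thesis by (simp add: det_replace_row_scale)
qed

lemma det_replace_row_swap:
  fixes M :: "'a::comm_ring_1 ^ 'n ^ 'n"
  assumes "i \<noteq> j"
  shows "det (replace_row i v (replace_row j w M)) = - det (replace_row i w (replace_row j v M))"
proof -
  let ?p = "Transposition.transpose i j"
  let ?A = "replace_row i w (replace_row j v M)"
  have "det (\<chi> k. ?A $ ?p k :: 'a ^ 'n ^ 'n) = of_int (sign ?p) * det ?A"
    by (rule det_permute_rows) (simp add: permutes_swap_id)
  moreover have "(\<chi> k. ?A $ ?p k) = replace_row i v (replace_row j w M)"
    using assms by (auto simp: vec_eq_iff replace_row_def Transposition.transpose_def)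
  ultimately show ?thesis using assms by (simp add: sign_swap_id)
qed

lemma det_replace_row_combination:
  fixes M :: "'a::field ^ 'n ^ 'n"
  assumes "w = (\<Sum>k\<in>UNIV. c k *s (M $ k))"
  shows "det (replace_row i w M) = c i * det M"
proof -
  have "replace_row i w M =
      (\<chi> k. if k = i then sum (\<lambda>i. (\<chi> k. c k) $ i *s row i M) (UNIV::'n set) else row k M)"
    using assms by (simp add: replace_row_def vec_eq_iff row_def)
  then show ?thesis by (simp add: cramer_lemma_transpose)
qed

lemma has_vector_derivative_det:
  fixes M :: "real \<Rightarrow> ('a::real_normed_field) ^ 'n ^ 'n"
  assumes "\<And>i. ((\<lambda>s. M s $ i) has_vector_derivative M' i) (at s within S)"
  shows "((\<lambda>s. det (M s)) has_vector_derivative (\<Sum>i\<in>UNIV. det (replace_row i (M' i) (M s)))) (at s within S)"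
proof -
  have comp: "((\<lambda>s. M s $ i $ j) has_derivative (\<lambda>h. h *\<^sub>R M' i $ j)) (at s within S)" for i j
    using bounded_linear.has_derivative[OF bounded_linear_vec_nth assms[of i, unfolded has_vector_derivative_def], of j]
    by simp
  have rr: "of_int (sign p) * (\<Prod>k\<in>UNIV. replace_row i (M' i) (M s) $ k $ p k)
      = of_int (sign p) * (M' i $ p i * (\<Prod>k\<in>UNIV - {i}. M s $ k $ p k))" for p i
    by (subst prod.remove[of UNIV i]) (auto simp: replace_row_nth intro!: prod.cong)
  have "((\<lambda>s. \<Sum>p | p permutes UNIV. of_int (sign p) * (\<Prod>i\<in>UNIV. M s $ i $ p i)) has_derivative
     (\<lambda>h. \<Sum>p | p permutes UNIV. of_int (sign p) *
         (\<Sum>i\<in>UNIV. (h *\<^sub>R M' i $ p i) * (\<Prod>j\<in>UNIV - {i}. M s $ j $ p j)))) (at s within S)"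
    by (intro has_derivative_sum has_derivative_mult_right has_derivative_prod comp)
  also have "(\<lambda>h. \<Sum>p | p permutes UNIV. of_int (sign p) *
         (\<Sum>i\<in>UNIV. (h *\<^sub>R M' i $ p i) * (\<Prod>j\<in>UNIV - {i}. M s $ j $ p j)))
     = (\<lambda>h. h *\<^sub>R (\<Sum>i\<in>UNIV. det (replace_row i (M' i) (M s))))"
    unfolding det_def rr
    by (subst sum.swap) (simp add: scaleR_sum_right sum_distrib_left)
  finally show ?thesis
    unfolding det_def[abs_def] has_vector_derivative_def by (simp add: det_def)
qed

lemma det_mat_row:
  fixes w :: "'a::field ^ 'n"
  shows "det (replace_row i w (mat 1)) = w $ i"
proof -
  have "w = (\<Sum>k\<in>UNIV. w $ k *s (mat 1 $ k))"
    by (simp add: vec_eq_iff mat_def sum.delta' if_distrib cong: if_cong)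
  from det_replace_row_combination[of w "\<lambda>k. w $ k" "mat 1", OF this] show ?thesis by simp
qed

text \<open>Cramer's rule in a form that also holds for singular \<open>M\<close>. Replacing \<open>M\<close> by
  \<open>M ** (mat 1 + s c \<otimes> w)\<close> adds \<open>s (M c)\<^sub>i w\<close> to the \<open>i\<close>-th row; both sides are the derivative of
  the determinant of this product at \<open>s = 0\<close>.\<close>

lemma cramer_contraction:
  fixes M :: "('a::real_normed_field) ^ 'n ^ 'n"
  shows "(\<Sum>i\<in>UNIV. (\<Sum>k\<in>UNIV. M $ i $ k * c $ k) * det (replace_row i w M)) = (\<Sum>k\<in>UNIV. w $ k * c $ k) * det M"
proof -
  define B :: "real \<Rightarrow> 'a ^ 'n ^ 'n" where "B s = (\<chi> i. mat 1 $ i + s *\<^sub>R (c $ i *s w))" for s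
  define u where "u i = (\<Sum>k\<in>UNIV. M $ i $ k * c $ k)" for i
  have MB: "M ** B s = (\<chi> i. M $ i + s *\<^sub>R (u i *s w))" for s
  proof -
    have "(\<Sum>k\<in>UNIV. M $ i $ k * (mat 1 $ k $ j + s *\<^sub>R (c $ k * w $ j))) = M $ i $ j + s *\<^sub>R (u i * w $ j)" for i j
    proof -
      have "(\<Sum>k\<in>UNIV. M $ i $ k * mat 1 $ k $ j) = M $ i $ j"
        by (simp add: mat_def if_distrib sum.delta' cong: if_cong)
      moreover have "(\<Sum>k\<in>UNIV. M $ i $ k * (s *\<^sub>R (c $ k * w $ j))) = s *\<^sub>R (u i * w $ j)"
        by (simp add: u_def sum_distrib_right scaleR_sum_right mult.assoc)
      ultimately show ?thesis by (simp add: distrib_left sum.distrib)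
    qed
    then show ?thesis by (simp add: vec_eq_iff B_def matrix_matrix_mult_def)
  qed
  have dB: "((\<lambda>s. det (B s)) has_vector_derivative (\<Sum>i\<in>UNIV. det (replace_row i (c $ i *s w) (B 0)))) (at 0)"
    by (rule has_vector_derivative_det) (auto simp: B_def intro!: derivative_eq_intros)
  have dM: "((\<lambda>s. det (M ** B s)) has_vector_derivative (\<Sum>i\<in>UNIV. det (replace_row i (u i *s w) (M ** B 0)))) (at 0)"
    by (rule has_vector_derivative_det) (auto simp: MB intro!: derivative_eq_intros)
  have B0: "B 0 = mat 1" by (simp add: B_def vec_eq_iff)
  have "((\<lambda>s. det M * det (B s)) has_vector_derivative det M * (\<Sum>i\<in>UNIV. det (replace_row i (c $ i *s w) (B 0)))) (at 0)"
    by (rule has_vector_derivative_mult_right[OF dB])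
  from vector_derivative_unique_at[OF dM this[folded det_mul]]
  show ?thesis
    by (simp add: B0 det_replace_row_scale det_mat_row u_def mult.commute)
qed

lemma det_of_real: "det (\<chi> i j. of_real (A $ i $ j) :: 'a::{comm_ring_1,real_algebra_1} ^ 'n ^ 'n) = of_real (det A)"
  by (simp add: det_def)

text \<open>Rows transform with a real matrix because frames are real derivatives of maps into a complex space.\<close>

lemma det_change_of_frame:
  fixes M M' :: "complex ^ 'n ^ 'n"
  assumes "\<And>i. M $ i = (\<Sum>j\<in>UNIV. J $ i $ j *\<^sub>R M' $ j)"
  shows "det M = of_real (det J) * det M'"
proof -
  have "M = (\<chi> i j. of_real (J $ i $ j)) ** M'"
    using assms by (simp add: vec_eq_iff matrix_matrix_mult_def scaleR_conv_of_real[where x="_ :: complex"])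
  then show ?thesis by (simp add: det_mul det_of_real)
qed

text \<open>Both sides are the derivative at \<open>s = 0\<close> of the determinant of the frame perturbed by
  \<open>s u \<otimes> w\<close>, so no division by \<open>det M\<close> is involved. With \<open>J\<close> the Jacobian of a coordinate change
  this says that contracting a covector field with a vector field gives a density.\<close>

lemma contraction_change_of_frame:
  fixes M M' :: "complex ^ 'n ^ 'n"
  assumes M: "\<And>i. M $ i = (\<Sum>j\<in>UNIV. J $ i $ j *\<^sub>R M' $ j)"
    and u: "\<And>i. u i = (\<Sum>j\<in>UNIV. J $ i $ j *\<^sub>R u' j)"
  shows "(\<Sum>i\<in>UNIV. u i * det (replace_row i w M)) = of_real (det J) * (\<Sum>i\<in>UNIV. u' i * det (replace_row i w M'))"
proof -
  define A where "A s = (\<chi> i. M $ i + s *\<^sub>R (u i *s w))" for s :: real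
  define A' where "A' s = (\<chi> i. M' $ i + s *\<^sub>R (u' i *s w))" for s :: real
  have eq: "det (A s) = of_real (det J) * det (A' s)" for s
    by (rule det_change_of_frame)
       (simp add: A_def A'_def M u vec_eq_iff algebra_simps sum.distrib sum_distrib_left sum_distrib_right
          scaleR_sum_right)
  have d: "((\<lambda>s. det (A s)) has_vector_derivative (\<Sum>i\<in>UNIV. det (replace_row i (u i *s w) (A 0)))) (at 0)"
    by (rule has_vector_derivative_det) (auto simp: A_def intro!: derivative_eq_intros)
  have d': "((\<lambda>s. det (A' s)) has_vector_derivative (\<Sum>i\<in>UNIV. det (replace_row i (u' i *s w) (A' 0)))) (at 0)"
    by (rule has_vector_derivative_det) (auto simp: A'_def intro!: derivative_eq_intros)
  have 0: "A 0 = M" "A' 0 = M'" by (simp_all add: A_def A'_def vec_eq_iff)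
  from vector_derivative_unique_at[OF d has_vector_derivative_mult_right[OF d', of "of_real (det J)", folded eq]]
  show ?thesis by (simp add: 0 det_replace_row_scale)
qed

section \<open>The Hermitian product\<close>

text \<open>Linear in the first argument. The varying maps are put there, so that expressions in them are
  holomorphic.\<close>

definition herm :: "complex ^ 'n \<Rightarrow> complex ^ 'n \<Rightarrow> complex" where
  "herm u v = (\<Sum>k\<in>UNIV. u $ k * cnj (v $ k))"

lemma Re_herm: "Re (herm u v) = u \<bullet> v"
  by (simp add: herm_def inner_vec_def inner_complex_def)

lemma cnj_herm: "cnj (herm u v) = herm v u"
  by (simp add: herm_def mult.commute)

lemma Im_herm_swap: "Im (herm u v) = - Im (herm v u)"
  by (subst cnj_herm[of v u, symmetric]) simp

lemma herm_simps:
  "herm (u + u') v = herm u v + herm u' v" "herm u (v + v') = herm u v + herm u v'"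
  "herm (u - u') v = herm u v - herm u' v" "herm u (v - v') = herm u v - herm u v'"
  "herm (c *s u) v = c * herm u v" "herm u (c *s v) = cnj c * herm u v"
  "herm (r *\<^sub>R u) v = of_real r * herm u v" "herm u (r *\<^sub>R v) = of_real r * herm u v"
  "herm 0 v = 0" "herm u 0 = 0"
  by (simp_all add: herm_def algebra_simps sum.distrib sum_subtractf sum_distrib_left scaleR_conv_of_real[where x="_ :: complex"])

lemma herm_sum_left: "herm (sum f S) v = (\<Sum>i\<in>S. herm (f i) v)"
  by (simp add: herm_def sum_distrib_right) (rule sum.swap)

lemma herm_sum_right: "herm v (sum f S) = (\<Sum>i\<in>S. herm v (f i))"
  by (simp add: herm_def sum_distrib_left) (rule sum.swap)

lemma Im_herm_kaehler: "Im (herm u v) = - kaehler_form u v"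
  by (simp add: herm_def kaehler_form_def inner_vec_def inner_complex_def sum_negf[symmetric] algebra_simps)

lemma Im_herm_inner: "Im (herm u v) = u \<bullet> (\<i> *s v)"
  by (simp add: herm_def inner_vec_def inner_complex_def algebra_simps)

lemma herm_self: "herm u u = of_real ((norm u)\<^sup>2)"
  by (rule complex_eqI) (simp_all add: Re_herm dot_square_norm Im_herm_inner inner_vec_def inner_complex_def algebra_simps)

lemma bounded_bilinear_herm: "bounded_bilinear herm"
proof
  show "\<exists>K. \<forall>a b. norm (herm a b) \<le> norm a * norm b * K"
  proof (intro exI allI)
    fix a b :: "complex ^ 'n"
    have "norm (herm a b) \<le> (\<Sum>k\<in>UNIV. norm (a $ k * cnj (b $ k)))"
      unfolding herm_def by (rule norm_sum)
    also have "\<dots> \<le> (\<Sum>k\<in>(UNIV :: 'n set). norm a * norm b)"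
      by (intro sum_mono) (auto simp: norm_mult intro!: mult_mono Finite_Cartesian_Product.norm_nth_le)
    finally show "norm (herm a b) \<le> norm a * norm b * real CARD('n)"
      by (simp add: mult.commute)
  qed
qed (auto simp: herm_simps scaleR_conv_of_real[where x="_ :: complex"])

lemmas herm_derivative = bounded_bilinear.has_vector_derivative[OF bounded_bilinear_herm]

section \<open>Complex determinants and Gram determinants\<close>

text \<open>Hadamard's inequality. A maximiser of \<open>|det|\<close> over matrices with rows in the unit ball has
  Hermitian-orthogonal rows: otherwise one row could be replaced by its component orthogonal to
  another one, which leaves the determinant unchanged and leaves room to rescale that row.\<close>

lemma norm_det_le_one:
  fixes E :: "complex ^ 'n ^ 'n"
  assumes "\<And>i. norm (E $ i) \<le> 1"
  shows "norm (det E) \<le> 1"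
proof -
  define S where "S = {E :: complex ^ 'n ^ 'n. \<forall>i. norm (E $ i) \<le> 1}"
  have "compact S"
    unfolding compact_eq_bounded_closed
  proof
    show "bounded S"
    proof (rule boundedI)
      fix E assume "E \<in> S"
      have "norm E \<le> (\<Sum>i\<in>UNIV. norm (E $ i))"
        unfolding norm_vec_def by (rule L2_set_le_sum) simp
      also have "\<dots> \<le> (\<Sum>i\<in>(UNIV :: 'n set). 1)"
        using \<open>E \<in> S\<close> by (intro sum_mono) (auto simp: S_def)
      finally show "norm E \<le> real CARD('n)" by simp
    qed
    show "closed S" unfolding S_def
      by (intro closed_Collect_all closed_Collect_le continuous_intros)
  qed
  moreover have "(mat 1 :: complex ^ 'n ^ 'n) \<in> S"
  proof -
    have "(mat 1 :: complex ^ 'n ^ 'n) $ i = axis i 1" for i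
      by (simp add: mat_def axis_def vec_eq_iff)
    then show ?thesis by (simp add: S_def)
  qed
  moreover have "continuous_on S (\<lambda>E. norm (det E))"
    unfolding det_def by (intro continuous_intros)
  ultimately obtain E0 where E0: "E0 \<in> S" and max: "\<And>E. E \<in> S \<Longrightarrow> norm (det E) \<le> norm (det E0)"
    using continuous_attains_sup[of S "\<lambda>E. norm (det E)"] by blast
  have ge1: "norm (det E0) \<ge> 1" using max[OF \<open>mat 1 \<in> S\<close>] by simp
  have orth: "herm (E0 $ i) (E0 $ j) = 0" if "i \<noteq> j" for i j
  proof (rule ccontr)
    assume c: "herm (E0 $ i) (E0 $ j) \<noteq> 0"
    define e where "e = E0 $ j"
    have "e \<noteq> 0" using c by (auto simp: e_def herm_simps)
    define c where "c = - herm (E0 $ i) e / of_real ((norm e)\<^sup>2)"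
    define w where "w = E0 $ i + c *s e"
    have "c \<noteq> 0" using \<open>e \<noteq> 0\<close> c by (simp add: c_def e_def)
    have we: "herm w e = 0"
      using \<open>e \<noteq> 0\<close> by (simp add: w_def herm_simps herm_self c_def)
    have "(norm (E0 $ i))\<^sup>2 = (norm w)\<^sup>2 + (norm c * norm e)\<^sup>2"
    proof -
      have ew: "herm e w = 0" using we cnj_herm[of w e] by simp
      have Ei: "E0 $ i = w - c *s e" by (simp add: w_def)
      have "herm (E0 $ i) (E0 $ i) = herm w w + c * cnj c * herm e e"
        unfolding Ei using we ew by (simp add: herm_simps)
      then have "of_real ((norm (E0 $ i))\<^sup>2) = (of_real ((norm w)\<^sup>2 + (norm c * norm e)\<^sup>2) :: complex)"
        unfolding herm_self complex_norm_square[symmetric] by (simp add: power_mult_distrib)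
      then show ?thesis by (simp only: of_real_eq_iff)
    qed
    moreover have "0 < (norm c * norm e)\<^sup>2" using \<open>c \<noteq> 0\<close> \<open>e \<noteq> 0\<close> by simp
    moreover have "(norm (E0 $ i))\<^sup>2 \<le> 1" using E0 by (simp add: S_def power_le_one)
    ultimately have "(norm w)\<^sup>2 < 1" by linarith
    then have w1: "norm w < 1" by (simp add: power_less_one_iff abs_square_less_1)
    have dw: "det (replace_row i w E0) = det E0"
    proof -
      have "row k E0 = E0 $ k" for k by (simp add: row_def vec_eq_iff)
      then show ?thesis
        using det_row_operation[OF that, of E0 c] by (simp add: replace_row_def w_def e_def cong: if_cong)
    qed
    have "w \<noteq> 0"
    proof
      assume "w = 0"
      then have "det (replace_row i w E0) = 0"
        using det_replace_row_scale[of i 0 w E0] by simp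
      then show False using dw ge1 by simp
    qed
    define E1 where "E1 = replace_row i ((1 / norm w) *\<^sub>R w) E0"
    have "E1 \<in> S" using E0 \<open>w \<noteq> 0\<close> by (auto simp: S_def E1_def replace_row_nth)
    moreover have "norm (det E1) = norm (det E0) / norm w"
      by (simp only: E1_def det_replace_row_scaleR dw norm_mult norm_of_real) simp
    moreover have "norm (det E0) / norm w > norm (det E0)"
      using w1 \<open>w \<noteq> 0\<close> ge1 by (auto simp: less_divide_eq mult_less_cancel_left2)
    ultimately show False using max[of E1] by simp
  qed
  define H where "H = (\<chi> i j. cnj (E0 $ j $ i))"
  have EH: "(E0 ** H) $ i $ j = herm (E0 $ i) (E0 $ j)" for i j
    by (simp add: matrix_matrix_mult_def H_def herm_def)
  have "det H = cnj (det E0)"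
  proof -
    have "det H = det (\<chi> i j. cnj (E0 $ i $ j))"
      by (subst det_transpose[symmetric]) (simp add: H_def transpose_def)
    also have "\<dots> = cnj (det E0)" by (simp add: det_def)
    finally show ?thesis .
  qed
  moreover have "det (E0 ** H) = (\<Prod>i\<in>UNIV. of_real ((norm (E0 $ i))\<^sup>2))"
    by (subst det_diagonal) (auto simp: EH orth herm_self)
  ultimately have "of_real ((norm (det E0))\<^sup>2) = (of_real (\<Prod>i\<in>UNIV. (norm (E0 $ i))\<^sup>2) :: complex)"
    by (simp add: det_mul complex_norm_square[symmetric])
  then have "(norm (det E0))\<^sup>2 = (\<Prod>i\<in>UNIV. (norm (E0 $ i))\<^sup>2)"
    by (simp only: of_real_eq_iff)
  also have "\<dots> \<le> 1"
    using E0 by (intro prod_le_1) (auto simp: S_def power_le_one)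
  finally have "norm (det E0) \<le> 1" by (simp add: power_le_one_iff abs_square_le_1)
  moreover have "E \<in> S" using assms by (simp add: S_def)
  ultimately show ?thesis using max order_trans by blast
qed

text \<open>The Gram matrix for the real inner product, also when the rows are complex vectors.\<close>

definition real_gram :: "('a::real_inner) ^ 'n \<Rightarrow> real ^ 'n ^ 'n" where
  "real_gram M = (\<chi> i j. M $ i \<bullet> M $ j)"

text \<open>The real analogue of a QR factorisation: \<open>E\<close> is an orthonormal basis of the real span of the rows
  of \<open>M\<close>.\<close>

lemma real_gram_orthonormal_factor:
  fixes M :: "('a::euclidean_space) ^ 'n"
  assumes indep: "\<And>x :: real ^ 'n. (\<Sum>i\<in>UNIV. x $ i *\<^sub>R M $ i) = 0 \<Longrightarrow> x = 0"
  obtains R E where "\<And>i. M $ i = (\<Sum>j\<in>UNIV. R $ i $ j *\<^sub>R E $ j)" "real_gram E = (mat 1 :: real ^ 'n ^ 'n)"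
    "det (real_gram M) = (det R)\<^sup>2"
proof -
  define T where "T x = (\<Sum>i\<in>UNIV. x $ i *\<^sub>R M $ i)" for x :: "real ^ 'n"
  have lin: "linear T"
    by (rule linearI) (simp_all add: T_def algebra_simps sum.distrib scaleR_sum_right)
  have "inj T" using indep by (simp add: linear_injective_0[OF lin] T_def)
  obtain B where B: "B \<subseteq> range T" "pairwise orthogonal B" "\<And>x. x \<in> B \<Longrightarrow> norm x = 1"
    "independent B" "card B = dim (range T)" "span B = range T"
    using orthonormal_basis_subspace[of "range T"] linear_subspace_image[OF lin subspace_UNIV] by metis
  have "dim (range T) = CARD('n)"
    using dim_image_eq[OF lin, of UNIV] \<open>inj T\<close> by (simp add: inj_on_subset)
  then have "card B = CARD('n)" using B by simp
  then obtain e where e: "bij_betw e (UNIV :: 'n set) B"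
    by (metis finite_same_card_bij finite finite_UNIV independent_imp_finite B(4))
  define E where "E = (\<chi> j. e j)"
  define R where "R = (\<chi> i j. M $ i \<bullet> e j)"
  have EE: "e i \<bullet> e j = (if i = j then 1 else 0)" for i j
  proof -
    have "e i \<in> B" "e j \<in> B" "i \<noteq> j \<Longrightarrow> e i \<noteq> e j"
      using e by (auto simp: bij_betw_def inj_on_def)
    then show ?thesis using B(2,3) by (auto simp: pairwise_def orthogonal_def dot_square_norm)
  qed
  have MR: "M $ i = (\<Sum>j\<in>UNIV. R $ i $ j *\<^sub>R E $ j)" for i
  proof -
    have "T (axis i 1) = M $ i"
      by (simp add: T_def axis_def if_distrib[where f="\<lambda>x. x *\<^sub>R _"] cong: if_cong)
    then have "M $ i \<in> span B" using B(6) by (metis rangeI)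
    have "M $ i = (\<Sum>b\<in>B. (M $ i \<bullet> b) *\<^sub>R b)"
      using orthonormal_basis_expand[OF B(2,3) \<open>M $ i \<in> span B\<close> independent_imp_finite[OF B(4)]] by simp
    also have "\<dots> = (\<Sum>j\<in>UNIV. (M $ i \<bullet> e j) *\<^sub>R e j)"
      by (rule sum.reindex_bij_betw[OF e, symmetric])
    finally show ?thesis by (simp add: R_def E_def)
  qed
  have "real_gram E = mat 1" by (simp add: real_gram_def E_def mat_def vec_eq_iff EE)
  have "real_gram M = R ** transpose R"
  proof -
    have "M $ i \<bullet> M $ j = (\<Sum>k\<in>UNIV. R $ i $ k * R $ j $ k)" for i j
      by (subst MR[of j]) (simp add: inner_sum_right E_def R_def mult.commute)
    then show ?thesis by (simp add: real_gram_def matrix_matrix_mult_def transpose_def vec_eq_iff)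
  qed
  then have "det (real_gram M) = (det R)\<^sup>2"
    by (simp add: det_mul power2_eq_square)
  then show ?thesis using that[OF MR \<open>real_gram E = mat 1\<close>] by blast
qed

lemma real_gram_change_of_frame:
  fixes M M' :: "('a::real_inner) ^ 'n"
  assumes "\<And>i. M $ i = (\<Sum>j\<in>UNIV. J $ i $ j *\<^sub>R M' $ j)"
  shows "det (real_gram M) = (det J)\<^sup>2 * det (real_gram M')"
proof -
  have "real_gram M = J ** real_gram M' ** Finite_Cartesian_Product.transpose J"
  proof -
    have "M $ i \<bullet> M $ j = (\<Sum>k\<in>UNIV. (\<Sum>l\<in>UNIV. J $ i $ l * (M' $ l \<bullet> M' $ k)) * J $ j $ k)" for i j
      unfolding assms by (simp add: inner_sum_right inner_sum_left sum_distrib_right mult_ac)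
    then show ?thesis
      by (simp add: real_gram_def matrix_matrix_mult_def Finite_Cartesian_Product.transpose_def vec_eq_iff)
  qed
  then show ?thesis by (simp add: det_mul power2_eq_square mult_ac)
qed

lemma det_real_gram_pos:
  fixes M :: "('a::euclidean_space) ^ 'n"
  assumes indep: "\<And>x :: real ^ 'n. (\<Sum>i\<in>UNIV. x $ i *\<^sub>R M $ i) = 0 \<Longrightarrow> x = 0"
  shows "det (real_gram M) > 0"
proof -
  have "inj ((*v) (real_gram M))"
  proof (subst linear_injective_0)
    show "\<forall>x. real_gram M *v x = 0 \<longrightarrow> x = 0"
    proof (intro allI impI)
      fix x assume "real_gram M *v x = 0"
      then have "x \<bullet> (real_gram M *v x) = 0" by simp
      also have "x \<bullet> (real_gram M *v x) = (\<Sum>i\<in>UNIV. x $ i *\<^sub>R M $ i) \<bullet> (\<Sum>i\<in>UNIV. x $ i *\<^sub>R M $ i)"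
        by (simp add: inner_vec_def matrix_vector_mult_def real_gram_def inner_sum_left inner_sum_right
            sum_distrib_left mult_ac inner_commute)
      finally show "x = 0" using indep by simp
    qed
  qed simp
  then have "det (real_gram M) \<noteq> 0" using det_nz_iff_inj[of "(*v) (real_gram M)"] by simp
  moreover obtain R where "det (real_gram M) = (det (R :: real ^ 'n ^ 'n))\<^sup>2"
    using real_gram_orthonormal_factor[OF indep] by metis
  ultimately show ?thesis by auto
qed

text \<open>Factoring out the real matrix \<open>R\<close> scales both sides by \<open>|det R|\<close> and reduces the claim to rows of
  norm \<open>1\<close>, where Hadamard's inequality applies.\<close>

lemma norm_det_le_sqrt_gram:
  fixes M :: "complex ^ 'n ^ 'n"
  assumes indep: "\<And>x :: real ^ 'n. (\<Sum>i\<in>UNIV. x $ i *\<^sub>R M $ i) = 0 \<Longrightarrow> x = 0"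
  shows "norm (det M) \<le> sqrt (det (real_gram M))"
proof -
  obtain R E where *: "\<And>i. M $ i = (\<Sum>j\<in>UNIV. R $ i $ j *\<^sub>R E $ j)"
    "real_gram E = (mat 1 :: real ^ 'n ^ 'n)" "det (real_gram M) = (det R)\<^sup>2"
    using real_gram_orthonormal_factor[OF indep] by blast
  have "E $ i \<bullet> E $ i = 1" for i
    using arg_cong[OF *(2), of "\<lambda>A. A $ i $ i"] by (simp add: real_gram_def mat_def)
  then have "norm (det E) \<le> 1" by (intro norm_det_le_one) (simp add: norm_eq_sqrt_inner)
  then show ?thesis
    by (simp add: det_change_of_frame[OF *(1)] *(3) norm_mult mult_left_le)
qed

text \<open>If the Hermitian products of the rows are real, then \<open>M\<close> times its adjoint is the real Gram matrix.\<close>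

lemma norm_det_eq_sqrt_gram:
  fixes M :: "complex ^ 'n ^ 'n"
  assumes "\<And>i j. Im (herm (M $ i) (M $ j)) = 0"
  shows "norm (det M) = sqrt (det (real_gram M))"
proof -
  define H where "H = (\<chi> i j. cnj (M $ j $ i))"
  have "M ** H = (\<chi> i j. of_real (real_gram M $ i $ j))"
  proof -
    have "(M ** H) $ i $ j = herm (M $ i) (M $ j)" for i j
      by (simp add: matrix_matrix_mult_def H_def herm_def)
    also have "herm (M $ i) (M $ j) = of_real (real_gram M $ i $ j)" for i j
      by (rule complex_eqI) (simp_all add: Re_herm assms real_gram_def)
    finally show ?thesis by (simp add: vec_eq_iff)
  qed
  then have "det M * det H = of_real (det (real_gram M))"
    by (simp add: det_mul[symmetric] det_of_real)
  moreover have "det H = cnj (det M)"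
  proof -
    have "det H = det (\<chi> i j. cnj (M $ i $ j))"
      by (subst det_transpose[symmetric]) (simp add: H_def transpose_def)
    also have "\<dots> = cnj (det M)" by (simp add: det_def)
    finally show ?thesis .
  qed
  ultimately have "(of_real ((norm (det M))\<^sup>2) :: complex) = of_real (det (real_gram M))"
    unfolding complex_norm_square by simp
  then have "(norm (det M))\<^sup>2 = det (real_gram M)" by (simp only: of_real_eq_iff)
  then show ?thesis by (metis norm_ge_zero real_sqrt_unique)
qed

lemma complex_frame_coordinates:
  fixes M :: "complex ^ 'n ^ 'n"
  assumes "det M \<noteq> 0"
  obtains c where "w = (\<Sum>k\<in>UNIV. c k *s (M $ k))"
proof -
  have "det (Finite_Cartesian_Product.transpose M) \<noteq> 0" using assms by simp
  then obtain B where "Finite_Cartesian_Product.transpose M ** B = mat 1"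
    by (metis invertible_det_nz invertible_def)
  then have "Finite_Cartesian_Product.transpose M *v (B *v w) = w"
    by (simp add: matrix_vector_mul_assoc)
  then have "w = (\<Sum>k\<in>UNIV. (B *v w) $ k *s (M $ k))"
    by (subst (asm) matrix_vector_mult_def)
       (simp add: vec_eq_iff Finite_Cartesian_Product.transpose_def mult.commute eq_commute)
  then show ?thesis by (rule that)
qed

lemma matrix_inv_left_right:
  fixes G :: "real ^ 'n ^ 'n"
  assumes "det G \<noteq> 0"
  shows "G ** matrix_inv G = mat 1" "matrix_inv G ** G = mat 1"
proof -
  have "\<exists>B. G ** B = mat 1 \<and> B ** G = mat 1"
    using assms by (metis invertible_det_nz invertible_def)
  then have "G ** matrix_inv G = mat 1 \<and> matrix_inv G ** G = mat 1"
    unfolding matrix_inv_def by (rule someI_ex)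
  then show "G ** matrix_inv G = mat 1" "matrix_inv G ** G = mat 1" by auto
qed

section \<open>Smooth functions and mixed derivatives\<close>

lemma smooth_on_deriv: "smooth_on S f \<Longrightarrow> smooth_on S (\<lambda>x. frechet_derivative f (at x) v)"
  unfolding smooth_on_def by (metis Ck_on.simps(2))

lemma smooth_on_differentiable: "smooth_on S f \<Longrightarrow> x \<in> S \<Longrightarrow> f differentiable (at x)"
  unfolding smooth_on_def by (metis Ck_on.simps(2))

lemma smooth_on_continuous: "smooth_on S f \<Longrightarrow> continuous_on S f"
  unfolding smooth_on_def by (metis Ck_on.simps(1))

lemma directional_derivative:
  assumes "f differentiable (at x)"
  shows "((\<lambda>s. f (x + s *\<^sub>R v)) has_vector_derivative frechet_derivative f (at x) v) (at 0)"
proof -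
  have "(f has_derivative frechet_derivative f (at x)) (at (x + 0 *\<^sub>R v))"
    using assms by (simp add: frechet_derivative_works)
  moreover have "((\<lambda>s. x + s *\<^sub>R v) has_vector_derivative v) (at 0)"
    by (auto intro!: derivative_eq_intros)
  ultimately show ?thesis
    using vector_derivative_diff_chain_within[of "\<lambda>s. x + s *\<^sub>R v" v 0 UNIV f] 
    by (simp add: o_def has_derivative_at_withinI)
qed

text \<open>In this form a derivative is visibly invariant under translations of the parameter.\<close>

lemma has_vector_derivative_quotient:
  "(f has_vector_derivative d) (at t) \<longleftrightarrow> ((\<lambda>h. (f (t + h) - f t) /\<^sub>R h) \<longlongrightarrow> d) (at 0)"
proof -
  have "(f has_vector_derivative d) (at t) \<longleftrightarrow> ((\<lambda>h. norm (f (t + h) - f t - h *\<^sub>R d) / norm h) \<longlongrightarrow> 0) (at 0)"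
    unfolding has_vector_derivative_def has_derivative_at by (simp add: bounded_linear_scaleR_left)
  also have "\<dots> \<longleftrightarrow> ((\<lambda>h. norm ((f (t + h) - f t) /\<^sub>R h - d)) \<longlongrightarrow> 0) (at 0)"
  proof (rule tendsto_cong, rule eventually_at_filter[THEN iffD2], rule always_eventually, intro allI impI)
    fix h :: real assume "h \<noteq> 0"
    then have "(f (t + h) - f t) /\<^sub>R h - d = (f (t + h) - f t - h *\<^sub>R d) /\<^sub>R h"
      by (simp add: scaleR_diff_right)
    then show "norm (f (t + h) - f t - h *\<^sub>R d) / norm h = norm ((f (t + h) - f t) /\<^sub>R h - d)"
      by (simp add: divide_inverse)
  qed
  also have "\<dots> \<longleftrightarrow> ((\<lambda>h. (f (t + h) - f t) /\<^sub>R h) \<longlongrightarrow> d) (at 0)"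
    by (simp add: tendsto_norm_zero_iff LIM_zero_iff)
  finally show ?thesis .
qed

lemma has_vector_derivative_shift:
  "((\<lambda>s. f (x + (a + s) *\<^sub>R v)) has_vector_derivative d) (at 0) \<longleftrightarrow> ((\<lambda>s. f (x + s *\<^sub>R v)) has_vector_derivative d) (at a)"
  unfolding has_vector_derivative_quotient by simp

text \<open>Schwarz's theorem. Applying the mean value theorem twice, in either order, to the second difference
  over a small parallelogram expresses it through \<open>fvw\<close> and through \<open>fwv\<close> at points near \<open>x\<close>.\<close>

lemma mixed_directional_derivatives_real:
  fixes f :: "'a::real_normed_vector \<Rightarrow> real"
  assumes S: "open S" "x \<in> S"
    and fv: "\<And>y. y \<in> S \<Longrightarrow> ((\<lambda>s. f (y + s *\<^sub>R v)) has_vector_derivative fv y) (at 0)"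
    and fw: "\<And>y. y \<in> S \<Longrightarrow> ((\<lambda>s. f (y + s *\<^sub>R w)) has_vector_derivative fw y) (at 0)"
    and fvw: "\<And>y. y \<in> S \<Longrightarrow> ((\<lambda>s. fv (y + s *\<^sub>R w)) has_vector_derivative fvw y) (at 0)"
    and fwv: "\<And>y. y \<in> S \<Longrightarrow> ((\<lambda>s. fw (y + s *\<^sub>R v)) has_vector_derivative fwv y) (at 0)"
    and cont: "continuous_on S fvw" "continuous_on S fwv"
  shows "fvw x = fwv x"
proof -
  have second_difference: "\<exists>a b. 0 < a \<and> a < h \<and> 0 < b \<and> b < h \<and>
      g (x + h *\<^sub>R p + h *\<^sub>R q) - g (x + h *\<^sub>R p) - g (x + h *\<^sub>R q) + g x = h\<^sup>2 * gpq (x + a *\<^sub>R p + b *\<^sub>R q)"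
    if gp: "\<And>y. y \<in> S \<Longrightarrow> ((\<lambda>s. g (y + s *\<^sub>R p)) has_vector_derivative gp y) (at 0)"
      and gpq: "\<And>y. y \<in> S \<Longrightarrow> ((\<lambda>s. gp (y + s *\<^sub>R q)) has_vector_derivative gpq y) (at 0)"
      and box: "\<And>a b. 0 \<le> a \<Longrightarrow> a \<le> h \<Longrightarrow> 0 \<le> b \<Longrightarrow> b \<le> h \<Longrightarrow> x + a *\<^sub>R p + b *\<^sub>R q \<in> S"
      and h: "0 < h"
    for g gp gpq :: "'a \<Rightarrow> real" and p q h
  proof -
    have d1: "((\<lambda>s. g (x + s *\<^sub>R p + b *\<^sub>R q)) has_real_derivative gp (x + a *\<^sub>R p + b *\<^sub>R q)) (at a)"
      if "0 \<le> a" "a \<le> h" "0 \<le> b" "b \<le> h" for a b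
      using gp[OF box[OF that]] has_vector_derivative_shift[of g "x + b *\<^sub>R q" a p]
      by (simp add: has_real_derivative_iff_has_vector_derivative algebra_simps)
    have d2: "((\<lambda>s. gp (x + a *\<^sub>R p + s *\<^sub>R q)) has_real_derivative gpq (x + a *\<^sub>R p + b *\<^sub>R q)) (at b)"
      if "0 \<le> a" "a \<le> h" "0 \<le> b" "b \<le> h" for a b
      using gpq[OF box[OF that]] has_vector_derivative_shift[of gp "x + a *\<^sub>R p" b q]
      by (simp add: has_real_derivative_iff_has_vector_derivative algebra_simps)
    obtain a where a: "0 < a" "a < h" and
      "(g (x + h *\<^sub>R p + h *\<^sub>R q) - g (x + h *\<^sub>R p)) - (g (x + 0 *\<^sub>R p + h *\<^sub>R q) - g (x + 0 *\<^sub>R p))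
        = (h - 0) * (gp (x + a *\<^sub>R p + h *\<^sub>R q) - gp (x + a *\<^sub>R p))"
      using MVT2[OF h, of "\<lambda>s. g (x + s *\<^sub>R p + h *\<^sub>R q) - g (x + s *\<^sub>R p)"
          "\<lambda>a. gp (x + a *\<^sub>R p + h *\<^sub>R q) - gp (x + a *\<^sub>R p)"]
        DERIV_diff[OF d1[of _ h] d1[of _ 0]] h by force
    moreover obtain b where b: "0 < b" "b < h" and
      "gp (x + a *\<^sub>R p + h *\<^sub>R q) - gp (x + a *\<^sub>R p + 0 *\<^sub>R q) = (h - 0) * gpq (x + a *\<^sub>R p + b *\<^sub>R q)"
      using MVT2[OF h, of "\<lambda>s. gp (x + a *\<^sub>R p + s *\<^sub>R q)" "\<lambda>b. gpq (x + a *\<^sub>R p + b *\<^sub>R q)"]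
        d2[of a] a by force
    ultimately show ?thesis using a b
      by (intro exI[of _ a] exI[of _ b]) (simp add: power2_eq_square)
  qed
  obtain e where e: "e > 0" "ball x e \<subseteq> S" using S open_contains_ball by blast
  define C where "C = norm v + norm w + 1"
  have C: "C > 0" by (simp add: C_def add_nonneg_pos)
  have near: "norm (a *\<^sub>R v + b *\<^sub>R w) < C * h" if "0 \<le> a" "a \<le> h" "0 \<le> b" "b \<le> h" "0 < h" for a b h
  proof -
    have "norm (a *\<^sub>R v + b *\<^sub>R w) \<le> a * norm v + b * norm w"
      using norm_triangle_ineq[of "a *\<^sub>R v" "b *\<^sub>R w"] that by simp
    also have "\<dots> \<le> h * norm v + h * norm w"
      using that by (intro add_mono mult_right_mono) auto
    also have "\<dots> < C * h" using that by (simp add: C_def algebra_simps)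
    finally show ?thesis .
  qed
  \<comment> \<open>The parallelogram with sides \<open>h v\<close> and \<open>h w\<close> lies within distance \<open>C h\<close> of \<open>x\<close>.\<close>
  have "\<bar>fvw x - fwv x\<bar> \<le> r" if "r > 0" for r
  proof -
    obtain d1 where d1: "d1 > 0" "\<And>y. y \<in> S \<Longrightarrow> dist y x < d1 \<Longrightarrow> dist (fvw y) (fvw x) < r / 2"
      using cont(1) S \<open>r > 0\<close> unfolding continuous_on_iff by (metis half_gt_zero)
    obtain d2 where d2: "d2 > 0" "\<And>y. y \<in> S \<Longrightarrow> dist y x < d2 \<Longrightarrow> dist (fwv y) (fwv x) < r / 2"
      using cont(2) S \<open>r > 0\<close> unfolding continuous_on_iff by (metis half_gt_zero)
    define h where "h = Min {e, d1, d2} / C"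
    have h: "0 < h" using e d1 d2 C by (simp add: h_def)
    have Ch: "C * h \<le> e" "C * h \<le> d1" "C * h \<le> d2" using C by (simp_all add: h_def)
    have inS: "x + a *\<^sub>R v + b *\<^sub>R w \<in> S" "dist (x + a *\<^sub>R v + b *\<^sub>R w) x < d1" "dist (x + a *\<^sub>R v + b *\<^sub>R w) x < d2"
      if "0 \<le> a" "a \<le> h" "0 \<le> b" "b \<le> h" for a b
    proof -
      have "dist (x + a *\<^sub>R v + b *\<^sub>R w) x < C * h"
        using near[OF that h] by (simp add: dist_norm add.assoc)
      then show "x + a *\<^sub>R v + b *\<^sub>R w \<in> S" "dist (x + a *\<^sub>R v + b *\<^sub>R w) x < d1" "dist (x + a *\<^sub>R v + b *\<^sub>R w) x < d2"
        using Ch e(2) by (auto simp: subset_eq dist_commute)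
    qed
    obtain a b where ab: "0 < a" "a < h" "0 < b" "b < h" and
      1: "f (x + h *\<^sub>R v + h *\<^sub>R w) - f (x + h *\<^sub>R v) - f (x + h *\<^sub>R w) + f x = h\<^sup>2 * fvw (x + a *\<^sub>R v + b *\<^sub>R w)"
      using second_difference[OF fv fvw inS(1) h] by blast
    have inS': "x + a *\<^sub>R w + b *\<^sub>R v \<in> S" if "0 \<le> a" "a \<le> h" "0 \<le> b" "b \<le> h" for a b
      using inS(1)[of b a] that by (simp add: algebra_simps)
    obtain a' b' where ab': "0 < a'" "a' < h" "0 < b'" "b' < h" and
      2: "f (x + h *\<^sub>R w + h *\<^sub>R v) - f (x + h *\<^sub>R w) - f (x + h *\<^sub>R v) + f x = h\<^sup>2 * fwv (x + a' *\<^sub>R w + b' *\<^sub>R v)"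
      using second_difference[OF fw fwv inS' h] by blast
    have "h\<^sup>2 * fvw (x + a *\<^sub>R v + b *\<^sub>R w) = h\<^sup>2 * fwv (x + b' *\<^sub>R v + a' *\<^sub>R w)"
      using 1 2 by (simp add: algebra_simps)
    then have "fvw (x + a *\<^sub>R v + b *\<^sub>R w) = fwv (x + b' *\<^sub>R v + a' *\<^sub>R w)" using h by simp
    moreover have "dist (fvw (x + a *\<^sub>R v + b *\<^sub>R w)) (fvw x) < r / 2"
      using inS[of a b] ab by (intro d1) auto
    moreover have "dist (fwv (x + b' *\<^sub>R v + a' *\<^sub>R w)) (fwv x) < r / 2"
      using inS[of b' a'] ab' by (intro d2) auto
    ultimately show ?thesis unfolding dist_real_def abs_real_def by (auto split: if_splits)
  qed
  then show ?thesis by (metis abs_le_zero_iff eq_iff_diff_eq_0 field_le_epsilon add_0)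
qed

lemma smooth_on_mixed_derivatives:
  fixes f :: "'a::euclidean_space \<Rightarrow> 'b::real_inner"
  assumes f: "smooth_on S f" and S: "open S" "x \<in> S"
  shows "frechet_derivative (\<lambda>y. frechet_derivative f (at y) v) (at x) w
       = frechet_derivative (\<lambda>y. frechet_derivative f (at y) w) (at x) v"
proof -
  have "frechet_derivative (\<lambda>y. frechet_derivative f (at y) v) (at x) w \<bullet> b
       = frechet_derivative (\<lambda>y. frechet_derivative f (at y) w) (at x) v \<bullet> b" for b
  proof (rule mixed_directional_derivatives_real[OF S, of "\<lambda>y. f y \<bullet> b"])
    have *: "((\<lambda>s. g (y + s *\<^sub>R u) \<bullet> b) has_vector_derivative frechet_derivative g (at y) u \<bullet> b) (at 0)"
      if "smooth_on S g" "y \<in> S" for g y u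
      using bounded_linear.has_vector_derivative[OF bounded_linear_inner_left
          directional_derivative[OF smooth_on_differentiable[OF that]]] .
    show "((\<lambda>s. f (y + s *\<^sub>R v) \<bullet> b) has_vector_derivative frechet_derivative f (at y) v \<bullet> b) (at 0)" if "y \<in> S" for y
      using *[OF f that] .
    show "((\<lambda>s. f (y + s *\<^sub>R w) \<bullet> b) has_vector_derivative frechet_derivative f (at y) w \<bullet> b) (at 0)" if "y \<in> S" for y
      using *[OF f that] .
    show "((\<lambda>s. frechet_derivative f (at (y + s *\<^sub>R w)) v \<bullet> b) has_vector_derivative
        frechet_derivative (\<lambda>y. frechet_derivative f (at y) v) (at y) w \<bullet> b) (at 0)" if "y \<in> S" for y
      using *[OF smooth_on_deriv[OF f] that] .
    show "((\<lambda>s. frechet_derivative f (at (y + s *\<^sub>R v)) w \<bullet> b) has_vector_derivative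
        frechet_derivative (\<lambda>y. frechet_derivative f (at y) w) (at y) v \<bullet> b) (at 0)" if "y \<in> S" for y
      using *[OF smooth_on_deriv[OF f] that] .
  qed (intro continuous_intros smooth_on_continuous smooth_on_deriv f)+
  then show ?thesis by (metis vector_eq_rdot)
qed

section \<open>Differentiability in time\<close>

text \<open>Regularity in the time variable alone, with derivatives jointly continuous in time and space; the
  spatial variable may range over a manifold. This is all that differentiation under the integral
  sign needs, and it is preserved by the operations that occur in area elements.\<close>

primrec time_Ck :: "nat \<Rightarrow> real set \<Rightarrow> 'x::topological_space set \<Rightarrow> (real \<Rightarrow> 'x \<Rightarrow> 'b::real_normed_vector) \<Rightarrow> bool" where
  "time_Ck 0 I X f \<longleftrightarrow> continuous_on (I \<times> X) (\<lambda>(t, x). f t x)"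
| "time_Ck (Suc k) I X f \<longleftrightarrow> continuous_on (I \<times> X) (\<lambda>(t, x). f t x) \<and>
     (\<exists>f'. (\<forall>t\<in>I. \<forall>x\<in>X. ((\<lambda>s. f s x) has_vector_derivative f' t x) (at t)) \<and> time_Ck k I X f')"

lemma time_Ck_continuous: "time_Ck k I X f \<Longrightarrow> continuous_on (I \<times> X) (\<lambda>(t, x). f t x)"
  by (cases k) auto

lemma time_Ck_Suc_imp: "time_Ck (Suc k) I X f \<Longrightarrow> time_Ck k I X f"
  by (induction k arbitrary: f) auto

lemma time_Ck_cong:
  assumes "open I" "\<And>t x. t \<in> I \<Longrightarrow> x \<in> X \<Longrightarrow> f t x = g t x"
  shows "time_Ck k I X f \<longleftrightarrow> time_Ck k I X g"
proof -
  have "time_Ck k I X g" if f: "time_Ck k I X f" "\<And>t x. t \<in> I \<Longrightarrow> x \<in> X \<Longrightarrow> f t x = g t x" for f g :: "real \<Rightarrow> 'a \<Rightarrow> 'b"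
  proof -
    have c: "continuous_on (I \<times> X) (\<lambda>(t, x). g t x)"
      using time_Ck_continuous[OF that(1)] that(2) by (auto intro: continuous_on_eq)
    show ?thesis
    proof (cases k)
      case 0 then show ?thesis using c by simp
    next
      case (Suc j)
      then obtain f' where "\<forall>t\<in>I. \<forall>x\<in>X. ((\<lambda>s. f s x) has_vector_derivative f' t x) (at t)" and
        f'2: "time_Ck j I X f'"
        using f by auto
      then have f': "\<And>t x. t \<in> I \<Longrightarrow> x \<in> X \<Longrightarrow> ((\<lambda>s. f s x) has_vector_derivative f' t x) (at t)" by blast
      have "((\<lambda>s. g s x) has_vector_derivative f' t x) (at t)" if "t \<in> I" "x \<in> X" for t x
        using has_vector_derivative_transform_within_open[OF f'[OF that] assms(1) that(1)] \<open>x \<in> X\<close>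
          \<open>\<And>t x. t \<in> I \<Longrightarrow> x \<in> X \<Longrightarrow> f t x = g t x\<close> by auto
      then show ?thesis using c f'2 Suc by auto
    qed
  qed
  then show ?thesis using assms(2) by metis
qed

lemma time_Ck_const:
  fixes c :: "'x::topological_space \<Rightarrow> 'b::real_normed_vector"
  shows "continuous_on X c \<Longrightarrow> time_Ck k I X (\<lambda>t x. c x)"
proof (induction k arbitrary: c)
  case 0
  have "continuous_on (I \<times> X) (\<lambda>p. c (snd p))"
    by (rule continuous_on_compose2[OF 0]) (auto intro: continuous_intros)
  then show ?case by (simp add: case_prod_beta')
next
  case (Suc k)
  have "continuous_on (I \<times> X) (\<lambda>p. c (snd p))"
    by (rule continuous_on_compose2[OF Suc(2)]) (auto intro: continuous_intros)
  moreover have "time_Ck k I X (\<lambda>t x. 0 :: 'b)" using Suc.IH[of "\<lambda>x. 0"] by simp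
  ultimately show ?case by (auto simp: case_prod_beta' intro!: exI[of _ "\<lambda>t x. 0"])
qed

lemma time_Ck_add: "time_Ck k I X f \<Longrightarrow> time_Ck k I X g \<Longrightarrow> time_Ck k I X (\<lambda>t x. f t x + g t x)"
proof (induction k arbitrary: f g)
  case 0 then show ?case by (auto simp: case_prod_beta' intro: continuous_intros)
next
  case (Suc k)
  from Suc.prems obtain f' g' where
    "\<forall>t\<in>I. \<forall>x\<in>X. ((\<lambda>s. f s x) has_vector_derivative f' t x) (at t)" "time_Ck k I X f'"
    "\<forall>t\<in>I. \<forall>x\<in>X. ((\<lambda>s. g s x) has_vector_derivative g' t x) (at t)" "time_Ck k I X g'" by auto
  moreover have "continuous_on (I \<times> X) (\<lambda>(t, x). f t x + g t x)"
    using Suc.prems by (auto simp: case_prod_beta' intro: continuous_intros)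
  ultimately show ?case
    by (auto intro!: exI[of _ "\<lambda>t x. f' t x + g' t x"] Suc.IH has_vector_derivative_add)
qed

lemma time_Ck_bilinear:
  assumes "bounded_bilinear pr"
  shows "time_Ck k I X f \<Longrightarrow> time_Ck k I X g \<Longrightarrow> time_Ck k I X (\<lambda>t x. pr (f t x) (g t x))"
proof (induction k arbitrary: f g)
  case 0 then show ?case
    using bounded_bilinear.continuous_on[OF assms, of "I \<times> X" "\<lambda>p. f (fst p) (snd p)" "\<lambda>p. g (fst p) (snd p)"]
    by (auto simp: case_prod_beta')
next
  case (Suc k)
  from Suc.prems obtain f' g' where *:
    "\<forall>t\<in>I. \<forall>x\<in>X. ((\<lambda>s. f s x) has_vector_derivative f' t x) (at t)" "time_Ck k I X f'"
    "\<forall>t\<in>I. \<forall>x\<in>X. ((\<lambda>s. g s x) has_vector_derivative g' t x) (at t)" "time_Ck k I X g'" by auto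
  moreover have "continuous_on (I \<times> X) (\<lambda>(t, x). pr (f t x) (g t x))"
    using Suc.prems bounded_bilinear.continuous_on[OF assms, of "I \<times> X" "\<lambda>p. f (fst p) (snd p)" "\<lambda>p. g (fst p) (snd p)"]
    by (auto simp: case_prod_beta')
  moreover have "time_Ck k I X (\<lambda>t x. pr (f t x) (g' t x) + pr (f' t x) (g t x))"
    by (rule time_Ck_add; rule Suc.IH) (use * Suc.prems time_Ck_Suc_imp in blast)+
  ultimately show ?case
    by (auto intro!: exI[of _ "\<lambda>t x. pr (f t x) (g' t x) + pr (f' t x) (g t x)"]
        bounded_bilinear.has_vector_derivative[OF assms])
qed

lemmas time_Ck_mult = time_Ck_bilinear[OF bounded_bilinear_mult]
lemmas time_Ck_inner = time_Ck_bilinear[OF bounded_bilinear_inner]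

lemma time_Ck_minus: 
  assumes "time_Ck k I X f" shows "time_Ck k I X (\<lambda>t x. - f t x)"
  using time_Ck_bilinear[OF bounded_bilinear_scaleR time_Ck_const[of X "\<lambda>_. -1"] assms] by simp

lemma time_Ck_diff: 
  assumes "time_Ck k I X f" "time_Ck k I X g" shows "time_Ck k I X (\<lambda>t x. f t x - g t x)"
  using time_Ck_add[OF assms(1) time_Ck_minus[OF assms(2)]] by simp

lemma time_Ck_sum: "finite A \<Longrightarrow> (\<And>i. i \<in> A \<Longrightarrow> time_Ck k I X (f i)) \<Longrightarrow> time_Ck k I X (\<lambda>t x. \<Sum>i\<in>A. f i t x)"
  by (induction A rule: finite_induct) (auto intro: time_Ck_add time_Ck_const)

lemma time_Ck_prod:
  fixes f :: "'i \<Rightarrow> real \<Rightarrow> 'x::topological_space \<Rightarrow> 'b::real_normed_field"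
  shows "finite A \<Longrightarrow> (\<And>i. i \<in> A \<Longrightarrow> time_Ck k I X (f i)) \<Longrightarrow> time_Ck k I X (\<lambda>t x. \<Prod>i\<in>A. f i t x)"
  by (induction A rule: finite_induct) (auto intro: time_Ck_mult time_Ck_const)

lemma time_Ck_det:
  fixes M :: "real \<Rightarrow> 'x::topological_space \<Rightarrow> ('a::real_normed_field) ^ 'n ^ 'n"
  assumes "\<And>i j. time_Ck k I X (\<lambda>t x. M t x $ i $ j)"
  shows "time_Ck k I X (\<lambda>t x. det (M t x))"
  unfolding det_def
  by (rule time_Ck_sum, simp, rule time_Ck_mult, rule time_Ck_const, rule continuous_on_const,
      rule time_Ck_prod, simp, rule assms)

lemma time_Ck_linear:
  assumes "bounded_linear L" "time_Ck k I X f"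
  shows "time_Ck k I X (\<lambda>t x. L (f t x))"
proof -
  interpret bounded_linear L by fact
  show ?thesis using assms(2)
  proof (induction k arbitrary: f)
    case 0 then show ?case by (auto simp: case_prod_beta' intro: continuous_on)
  next
    case (Suc k)
    then obtain f' where "\<forall>t\<in>I. \<forall>x\<in>X. ((\<lambda>s. f s x) has_vector_derivative f' t x) (at t)" "time_Ck k I X f'" by auto
    moreover have "continuous_on (I \<times> X) (\<lambda>(t, x). L (f t x))"
      using Suc.prems by (auto simp: case_prod_beta' intro: continuous_on)
    ultimately show ?case using Suc.IH
      by (auto intro!: exI[of _ "\<lambda>t x. L (f' t x)"] has_vector_derivative)
  qed
qed

lemma time_Ck_exp:
  fixes f :: "real \<Rightarrow> 'x::topological_space \<Rightarrow> 'b::{real_normed_field,banach}"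
  shows "time_Ck k I X f \<Longrightarrow> time_Ck k I X (\<lambda>t x. exp (f t x))"
proof (induction k arbitrary: f)
  case 0 then show ?case by (auto simp: case_prod_beta' intro: continuous_intros)
next
  case (Suc k)
  then obtain f' where *: "\<forall>t\<in>I. \<forall>x\<in>X. ((\<lambda>s. f s x) has_vector_derivative f' t x) (at t)" "time_Ck k I X f'" by auto
  have "time_Ck k I X (\<lambda>t x. f' t x * exp (f t x))"
    by (rule time_Ck_mult[OF *(2) Suc.IH[OF time_Ck_Suc_imp[OF Suc.prems]]])
  moreover have "((\<lambda>s. exp (f s x)) has_vector_derivative f' t x * exp (f t x)) (at t)" if "t \<in> I" "x \<in> X" for t x
    using field_vector_diff_chain_at[of "\<lambda>s. f s x" "f' t x" t exp "exp (f t x)"] * that by (simp add: o_def DERIV_exp)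
  moreover have "continuous_on (I \<times> X) (\<lambda>(t, x). exp (f t x))"
    using Suc.prems by (auto simp: case_prod_beta' intro: continuous_intros)
  ultimately show ?case by (auto intro!: exI[of _ "\<lambda>t x. f' t x * exp (f t x)"])
qed

lemma time_Ck_inverse:
  fixes f :: "real \<Rightarrow> 'x::topological_space \<Rightarrow> 'b::real_normed_field"
  shows "time_Ck k I X f \<Longrightarrow> (\<And>t x. t \<in> I \<Longrightarrow> x \<in> X \<Longrightarrow> f t x \<noteq> 0) \<Longrightarrow> time_Ck k I X (\<lambda>t x. inverse (f t x))"
proof (induction k arbitrary: f)
  case 0 then show ?case by (auto simp: case_prod_beta' intro!: continuous_intros)
next
  case (Suc k)
  then obtain f' where *: "\<forall>t\<in>I. \<forall>x\<in>X. ((\<lambda>s. f s x) has_vector_derivative f' t x) (at t)" "time_Ck k I X f'" by auto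
  have "time_Ck k I X (\<lambda>t x. f' t x * - (inverse (f t x) * inverse (f t x)))"
    using Suc.IH[OF time_Ck_Suc_imp[OF Suc.prems(1)] Suc.prems(2)]
    by (intro time_Ck_mult time_Ck_minus *(2))
  moreover have "((\<lambda>s. inverse (f s x)) has_vector_derivative f' t x * - (inverse (f t x) * inverse (f t x))) (at t)" if "t \<in> I" "x \<in> X" for t x
    using field_vector_diff_chain_at[of "\<lambda>s. f s x" "f' t x" t inverse "- (inverse (f t x) * inverse (f t x))"] * that
      DERIV_inverse[of "f t x"] Suc.prems(2)[OF that] by (simp add: o_def power2_eq_square numeral_2_eq_2)
  moreover have "continuous_on (I \<times> X) (\<lambda>(t, x). inverse (f t x))"
    using Suc.prems by (auto simp: case_prod_beta' intro!: continuous_intros)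
  ultimately show ?case by (auto intro!: exI[of _ "\<lambda>t x. f' t x * - (inverse (f t x) * inverse (f t x))"])
qed

lemma time_Ck_sqrt:
  shows "time_Ck k I X f \<Longrightarrow> (\<And>t x. t \<in> I \<Longrightarrow> x \<in> X \<Longrightarrow> f t x > 0) \<Longrightarrow> time_Ck k I X (\<lambda>t x. sqrt (f t x))"
proof (induction k arbitrary: f)
  case 0 then show ?case by (auto simp: case_prod_beta' intro!: continuous_intros)
next
  case (Suc k)
  then obtain f' where *: "\<forall>t\<in>I. \<forall>x\<in>X. ((\<lambda>s. f s x) has_vector_derivative f' t x) (at t)" "time_Ck k I X f'" by auto
  have "time_Ck k I X (\<lambda>t x. f' t x * (inverse (sqrt (f t x)) * (1/2)))"
  proof (intro time_Ck_mult time_Ck_inverse)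
    show "time_Ck k I X f'" by (rule *(2))
    show "time_Ck k I X (\<lambda>t x. sqrt (f t x))"
      by (rule Suc.IH[OF time_Ck_Suc_imp[OF Suc.prems(1)] Suc.prems(2)])
    show "sqrt (f t x) \<noteq> 0" if "t \<in> I" "x \<in> X" for t x
      using Suc.prems(2)[OF that] by simp
    show "time_Ck k I X (\<lambda>t x. 1 / 2 :: real)" by (rule time_Ck_const) (rule continuous_on_const)
  qed
  moreover have "((\<lambda>s. sqrt (f s x)) has_vector_derivative f' t x * (inverse (sqrt (f t x)) * (1/2))) (at t)" if "t \<in> I" "x \<in> X" for t x
    using field_vector_diff_chain_at[of "\<lambda>s. f s x" "f' t x" t sqrt "inverse (sqrt (f t x)) * (1/2)"] * that
      DERIV_real_sqrt[of "f t x"] Suc.prems(2)[OF that] by (simp add: o_def)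
  moreover have "continuous_on (I \<times> X) (\<lambda>(t, x). sqrt (f t x))"
    using Suc.prems by (auto simp: case_prod_beta' intro!: continuous_intros)
  ultimately show ?case by (auto intro!: exI[of _ "\<lambda>t x. f' t x * (inverse (sqrt (f t x)) * (1/2))"])
qed

lemma time_Ck_compose:
  assumes "continuous_on Y h" "h ` Y \<subseteq> X"
  shows "time_Ck k I X f \<Longrightarrow> time_Ck k I Y (\<lambda>t y. f t (h y))"
proof (induction k arbitrary: f)
  have c: "continuous_on (I \<times> Y) (\<lambda>(t, y). f t (h y))" if "continuous_on (I \<times> X) (\<lambda>(t, x). f t x)" for f :: "real \<Rightarrow> 'b \<Rightarrow> 'c"
  proof -
    have "continuous_on (I \<times> Y) (\<lambda>p. (\<lambda>(t, x). f t x) (fst p, h (snd p)))"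
      using assms by (intro continuous_on_compose2[OF that] continuous_on_Pair continuous_on_fst continuous_on_id
        continuous_on_compose2[OF assms(1)] continuous_on_snd) auto
    then show ?thesis by (simp add: case_prod_beta')
  qed
  { case 0 then show ?case using c by simp }
  { case (Suc k)
    then obtain f' where "\<forall>t\<in>I. \<forall>x\<in>X. ((\<lambda>s. f s x) has_vector_derivative f' t x) (at t)" "time_Ck k I X f'" by auto
    with Suc c[of f] assms(2) show ?case by (auto intro!: exI[of _ "\<lambda>t y. f' t (h y)"]) }
qed

lemma time_Ck_local:
  assumes "open I" "\<And>U. U \<in> \<U> \<Longrightarrow> open U"
  shows "(\<And>U. U \<in> \<U> \<Longrightarrow> time_Ck k I U f) \<Longrightarrow> time_Ck k I (\<Union>\<U>) f"
proof (induction k arbitrary: f)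
  have c: "continuous_on (I \<times> \<Union>\<U>) (\<lambda>(t, x). f t x)" if "\<And>U. U \<in> \<U> \<Longrightarrow> continuous_on (I \<times> U) (\<lambda>(t, x). f t x)" for f :: "real \<Rightarrow> 'a \<Rightarrow> 'b"
  proof -
    have "I \<times> \<Union>\<U> = (\<Union>U\<in>\<U>. I \<times> U)" by auto
    then show ?thesis using that assms by (auto intro!: continuous_on_open_UN open_Times)
  qed
  { case 0 then show ?case using c by simp }
  { case (Suc k)
    define f' where "f' t x = vector_derivative (\<lambda>s. f s x) (at t)" for t x
    have f': "((\<lambda>s. f s x) has_vector_derivative f' t x) (at t)" if "t \<in> I" "x \<in> \<Union>\<U>" for t x
    proof -
      obtain U where "U \<in> \<U>" "x \<in> U" using \<open>x \<in> \<Union>\<U>\<close> by auto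
      then have "time_Ck (Suc k) I U f" by (intro Suc(2))
      then obtain d where "((\<lambda>s. f s x) has_vector_derivative d) (at t)"
        using \<open>t \<in> I\<close> \<open>x \<in> U\<close> by auto
      then show ?thesis unfolding f'_def by (simp add: vector_derivative_at)
    qed
    have "time_Ck k I U f'" if U: "U \<in> \<U>" for U
    proof -
      obtain g where g: "\<forall>t\<in>I. \<forall>x\<in>U. ((\<lambda>s. f s x) has_vector_derivative g t x) (at t)" "time_Ck k I U g"
        using Suc(2)[OF U] by auto
      then show ?thesis
        using time_Ck_cong[OF assms(1), of U f' g] by (simp add: f'_def vector_derivative_at)
    qed
    then have "time_Ck k I (\<Union>\<U>) f'" by (rule Suc.IH)
    then show ?case using f' c[of f] Suc(2) time_Ck_continuous[OF Suc(2)] by auto }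
qed

lemma time_Ck_smooth:
  assumes "smooth_on (I \<times> X) f"
  shows "time_Ck k I X (\<lambda>t x. f (t, x))"
  using assms
proof (induction k arbitrary: f)
  case 0 then show ?case using smooth_on_continuous by (auto simp: case_prod_beta')
next
  case (Suc k)
  have "((\<lambda>s. f (s, x)) has_vector_derivative frechet_derivative f (at (t, x)) (1, 0)) (at t)" if "t \<in> I" "x \<in> X" for t x
  proof -
    have "((\<lambda>s. f (s, x)) has_vector_derivative frechet_derivative f (at (t, x)) (1, 0)) (at t)
      \<longleftrightarrow> ((\<lambda>s. f ((t, x) + s *\<^sub>R (1, 0))) has_vector_derivative frechet_derivative f (at (t, x)) (1, 0)) (at 0)"
      unfolding has_vector_derivative_quotient by simp
    then show ?thesis using directional_derivative[OF smooth_on_differentiable[OF Suc.prems], of "(t, x)" "(1, 0)"] that by simp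
  qed
  moreover have "time_Ck k I X (\<lambda>t x. frechet_derivative f (at (t, x)) (1, 0))"
    by (rule Suc.IH[OF smooth_on_deriv[OF Suc.prems]])
  ultimately show ?case
    using smooth_on_continuous[OF Suc.prems]
    by (auto simp: case_prod_beta' intro!: exI[of _ "\<lambda>t x. frechet_derivative f (at (t, x)) (1, 0)"])
qed

section \<open>Differentiation under the integral sign\<close>

lemma set_borel_measurable_continuous:
  fixes g :: "'x::topological_space \<Rightarrow> 'b::real_normed_vector"
  assumes "K \<in> sets M" "sets (restrict_space M K) = sets (restrict_space borel K)" "continuous_on K g"
  shows "set_borel_measurable M K g"
proof -
  have "g \<in> borel_measurable (restrict_space M K)"
    using borel_measurable_continuous_on_restrict[OF assms(3)] measurable_cong_sets[OF assms(2) refl] by blast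
  then show ?thesis unfolding set_borel_measurable_def
    using borel_measurable_restrict_space_iff[of K M g] assms(1) sets.Int_space_eq2[of K M] by auto
qed

lemma set_integrable_continuous:
  fixes g :: "'x::t2_space \<Rightarrow> 'b::{banach, second_countable_topology}"
  assumes K: "K \<in> sets M" "sets (restrict_space M K) = sets (restrict_space borel K)" "compact K" "emeasure M K < \<infinity>"
    and g: "continuous_on K g"
  shows "set_integrable M K g"
proof -
  obtain B where B: "\<And>x. x \<in> K \<Longrightarrow> norm (g x) \<le> B"
    using compact_imp_bounded[OF compact_continuous_image[OF g K(3)]] unfolding bounded_iff by auto
  have "integrable M (\<lambda>x. indicator K x *\<^sub>R (indicator K x *\<^sub>R g x))"
    using set_borel_measurable_continuous[OF K(1,2) g] K(1,4) B
    by (intro integrableI_bounded_set_indicator[where B=B]) (auto simp: set_borel_measurable_def)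
  then show ?thesis unfolding set_integrable_def
    by (rule Bochner_Integration.integrable_cong[THEN iffD1, rotated -1]) (auto simp: indicator_def)
qed

text \<open>The difference quotients are dominated by a bound of \<open>f'\<close> on a compact neighbourhood of \<open>{t} \<times> K\<close>.
  The measure need only agree with the Borel measurable structure on \<open>K\<close>.\<close>

lemma has_vector_derivative_set_integral:
  fixes f f' :: "real \<Rightarrow> 'x::t2_space \<Rightarrow> 'b::{banach, second_countable_topology}"
  assumes K: "K \<in> sets M" "sets (restrict_space M K) = sets (restrict_space borel K)" "compact K" "emeasure M K < \<infinity>"
    and I: "open I" "t \<in> I"
    and f: "\<And>s. s \<in> I \<Longrightarrow> continuous_on K (f s)"
    and f': "continuous_on (I \<times> K) (\<lambda>(s, x). f' s x)"
    and der: "\<And>s x. s \<in> I \<Longrightarrow> x \<in> K \<Longrightarrow> ((\<lambda>s. f s x) has_vector_derivative f' s x) (at s)"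
  shows "((\<lambda>s. LINT x:K|M. f s x) has_vector_derivative (LINT x:K|M. f' t x)) (at t)"
  unfolding has_vector_derivative_quotient
proof (subst tendsto_at_iff_sequentially, intro allI impI)
  obtain d where d: "d > 0" "cball t d \<subseteq> I" using I open_contains_cball by blast
  have "compact ((\<lambda>(s, x). f' s x) ` (cball t d \<times> K))"
    using d(2) K(3) by (intro compact_continuous_image compact_Times continuous_on_subset[OF f']) auto
  then obtain B where B: "\<And>s x. s \<in> cball t d \<Longrightarrow> x \<in> K \<Longrightarrow> norm (f' s x) \<le> B"
    using compact_imp_bounded[of "(\<lambda>(s, x). f' s x) ` (cball t d \<times> K)"] unfolding bounded_iff by force
  have int: "set_integrable M K (f s)" if "s \<in> I" for s
    by (rule set_integrable_continuous[OF K f[OF that]])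
  have f't: "continuous_on K (f' t)"
  proof -
    have "continuous_on K (\<lambda>x. (\<lambda>(s, x). f' s x) (t, x))"
      by (rule continuous_on_compose2[OF f']) (use I in \<open>auto intro!: continuous_intros\<close>)
    then show ?thesis by simp
  qed
  fix h assume h: "\<forall>n. h n \<in> UNIV - {0}" "h \<longlonglongrightarrow> (0::real)"
  have ev: "\<forall>\<^sub>F n in sequentially. \<bar>h n\<bar> < d"
    using h(2) d(1) unfolding tendsto_iff dist_real_def by auto
  \<comment> \<open>The sequence is shifted by \<open>N\<close> so that all times stay in the compact neighbourhood.\<close>
  then obtain N where N: "\<And>n. n \<ge> N \<Longrightarrow> \<bar>h n\<bar> < d" unfolding eventually_sequentially by auto
  have inI: "t + h (n + N) \<in> I" for n using N[of "n + N"] d(2) by (auto simp: subset_eq dist_real_def)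
  have eq: "((LINT x:K|M. f (t + h (n + N)) x) - (LINT x:K|M. f t x)) /\<^sub>R h (n + N)
      = (LINT x|M. indicator K x *\<^sub>R ((f (t + h (n + N)) x - f t x) /\<^sub>R h (n + N)))" for n
  proof -
    have "((LINT x:K|M. f (t + h (n + N)) x) - (LINT x:K|M. f t x)) = (LINT x:K|M. f (t + h (n + N)) x - f t x)"
      by (rule set_integral_diff(2)[symmetric]) (use int inI I in auto)
    then have "((LINT x:K|M. f (t + h (n + N)) x) - (LINT x:K|M. f t x)) /\<^sub>R h (n + N)
      = (LINT x|M. indicator K x *\<^sub>R (f (t + h (n + N)) x - f t x)) /\<^sub>R h (n + N)"
      by (simp add: set_lebesgue_integral_def)
    also have "\<dots> = (LINT x|M. inverse (h (n + N)) *\<^sub>R (indicator K x *\<^sub>R (f (t + h (n + N)) x - f t x)))"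
      by (rule integral_scaleR_right[symmetric])
    also have "(\<lambda>x. inverse (h (n + N)) *\<^sub>R (indicator K x *\<^sub>R (f (t + h (n + N)) x - f t x)))
        = (\<lambda>x. indicator K x *\<^sub>R ((f (t + h (n + N)) x - f t x) /\<^sub>R h (n + N)))"
      by (auto simp: mult.commute)
    finally show ?thesis .
  qed
  have "(\<lambda>n. LINT x|M. indicator K x *\<^sub>R ((f (t + h (n + N)) x - f t x) /\<^sub>R h (n + N))) \<longlonglongrightarrow> (LINT x|M. indicator K x *\<^sub>R f' t x)"
  proof (rule integral_dominated_convergence[where w="\<lambda>x. indicator K x *\<^sub>R B"])
    show "(\<lambda>x. indicator K x *\<^sub>R f' t x) \<in> borel_measurable M"
      using set_borel_measurable_continuous[OF K(1,2) f't] by (simp add: set_borel_measurable_def)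
    show "(\<lambda>x. indicator K x *\<^sub>R ((f (t + h (n + N)) x - f t x) /\<^sub>R h (n + N))) \<in> borel_measurable M" for n
      using set_borel_measurable_continuous[OF K(1,2), of "\<lambda>x. (f (t + h (n + N)) x - f t x) /\<^sub>R h (n + N)"]
        f[OF inI] f[OF I(2)] by (simp add: set_borel_measurable_def continuous_intros)
    show "integrable M (\<lambda>x. indicator K x *\<^sub>R B)"
      using set_integrable_continuous[OF K, of "\<lambda>_. B"] by (simp add: set_integrable_def)
    show "AE x in M. (\<lambda>n. indicator K x *\<^sub>R ((f (t + h (n + N)) x - f t x) /\<^sub>R h (n + N))) \<longlonglongrightarrow> indicator K x *\<^sub>R f' t x"
    proof (rule AE_I2)
      fix x
      show "(\<lambda>n. indicator K x *\<^sub>R ((f (t + h (n + N)) x - f t x) /\<^sub>R h (n + N))) \<longlonglongrightarrow> indicator K x *\<^sub>R f' t x"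
      proof (cases "x \<in> K")
        case True
        have "((\<lambda>h. (f (t + h) x - f t x) /\<^sub>R h) \<longlongrightarrow> f' t x) (at 0)"
          using der[OF I(2) True] unfolding has_vector_derivative_quotient .
        then have "(\<lambda>n. (f (t + h n) x - f t x) /\<^sub>R h n) \<longlonglongrightarrow> f' t x"
          using h unfolding tendsto_at_iff_sequentially o_def by auto
        then have "(\<lambda>n. (f (t + h (n + N)) x - f t x) /\<^sub>R h (n + N)) \<longlonglongrightarrow> f' t x"
          by (rule LIMSEQ_ignore_initial_segment)
        then show ?thesis using True by simp
      qed simp
    qed
    show "AE x in M. norm (indicator K x *\<^sub>R ((f (t + h (n + N)) x - f t x) /\<^sub>R h (n + N))) \<le> indicator K x *\<^sub>R B" for n
    proof (rule AE_I2)
      fix x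
      show "norm (indicator K x *\<^sub>R ((f (t + h (n + N)) x - f t x) /\<^sub>R h (n + N))) \<le> indicator K x *\<^sub>R B"
      proof (cases "x \<in> K")
        case True
        have "norm (f (t + h (n + N)) x - f t x) \<le> B * norm ((t + h (n + N)) - t)"
        proof (rule differentiable_bound[where f'="\<lambda>s u. u *\<^sub>R f' s x" and S="cball t d"])
          fix s assume s: "s \<in> cball t d"
          show "((\<lambda>s. f s x) has_derivative (\<lambda>u. u *\<^sub>R f' s x)) (at s within cball t d)"
            using der[OF subsetD[OF d(2) s] True] unfolding has_vector_derivative_def
            by (rule has_derivative_at_withinI)
          show "onorm (\<lambda>u. u *\<^sub>R f' s x) \<le> B"
            using B[OF s True] by (simp add: onorm_scaleR_left onorm_id)
        qed (use d(1) N[of "n + N"] in \<open>auto simp: dist_real_def\<close>)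
        then have "norm ((f (t + h (n + N)) x - f t x) /\<^sub>R h (n + N)) \<le> B"
          using h(1) by (simp add: divide_simps mult.commute)
        then show ?thesis using True by simp
      qed simp
    qed
  qed
  then have "(\<lambda>n. ((LINT x:K|M. f (t + h (n + N)) x) - (LINT x:K|M. f t x)) /\<^sub>R h (n + N)) \<longlonglongrightarrow> (LINT x:K|M. f' t x)"
    unfolding eq by (simp add: set_lebesgue_integral_def)
  then show "((\<lambda>h. ((LINT x:K|M. f (t + h) x) - (LINT x:K|M. f t x)) /\<^sub>R h) \<circ> h) \<longlonglongrightarrow> (LINT x:K|M. f' t x)"
    unfolding o_def by (rule LIMSEQ_offset[where k=N])
qed

text \<open>The integral of the translates \<open>x \<mapsto> h (x + s v)\<close> does not depend on \<open>s\<close>, and its derivative in \<open>s\<close>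
  is the integral of \<open>h'\<close>.\<close>

lemma integral_directional_derivative_zero:
  fixes h h' :: "'a::euclidean_space \<Rightarrow> 'b::{banach, second_countable_topology}"
  assumes der: "\<And>x. ((\<lambda>s. h (x + s *\<^sub>R v)) has_vector_derivative h' x) (at 0)"
    and cont: "continuous_on UNIV h" "continuous_on UNIV h'"
    and C: "compact C" "\<And>x. x \<notin> C \<Longrightarrow> h x = 0"
  shows "integral\<^sup>L lborel h' = 0"
proof -
  obtain R where R: "\<And>x. x \<in> C \<Longrightarrow> norm x \<le> R" using compact_imp_bounded[OF C(1)] unfolding bounded_iff by auto
  define K where "K = cball (0 :: 'a) (R + norm v)"
  have K: "K \<in> sets lborel" "sets (restrict_space lborel K) = sets (restrict_space borel K)" "compact K" "emeasure lborel K < \<infinity>"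
    using emeasure_bounded_finite[of K] by (simp_all add: K_def sets_restrict_space)
  have out: "x + s *\<^sub>R v \<notin> C" if "x \<notin> K" "s \<in> {-1<..<1}" for x s
  proof
    assume "x + s *\<^sub>R v \<in> C"
    then have "norm (x + s *\<^sub>R v) \<le> R" by (rule R)
    moreover have "norm x \<le> norm (x + s *\<^sub>R v) + norm (s *\<^sub>R v)"
      using norm_triangle_ineq4[of "x + s *\<^sub>R v" "s *\<^sub>R v"] by simp
    moreover have "norm (s *\<^sub>R v) \<le> norm v" using that(2) by (auto simp: mult_left_le_one_le)
    ultimately show False using that(1) by (simp add: K_def)
  qed
  have h'0: "h' x = 0" if "x \<notin> K" for x
  proof -
    have "((\<lambda>s. h (x + s *\<^sub>R v)) has_vector_derivative 0) (at 0)"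
      by (rule has_vector_derivative_transform_within_open[of "\<lambda>_. 0" 0 0 "{-1<..<1}"])
         (use out[OF that] C(2) in auto)
    then show ?thesis using vector_derivative_unique_at[OF der] by blast
  qed
  have der': "((\<lambda>s. h (x + s *\<^sub>R v)) has_vector_derivative h' (x + s *\<^sub>R v)) (at s)" for s x
    using der[of "x + s *\<^sub>R v"] has_vector_derivative_shift[of h x s v] by (simp add: algebra_simps)
  have "((\<lambda>s. LINT x:K|lborel. h (x + s *\<^sub>R v)) has_vector_derivative (LINT x:K|lborel. h' (x + 0 *\<^sub>R v))) (at 0)"
  proof (rule has_vector_derivative_set_integral[OF K, of "{-1<..<1}"])
    show "continuous_on K (\<lambda>x. h (x + s *\<^sub>R v))" for s
      by (rule continuous_on_compose2[OF cont(1)]) (auto intro!: continuous_intros)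
    have "continuous_on ({- 1<..<1} \<times> K) (\<lambda>p. h' (snd p + fst p *\<^sub>R v))"
      by (rule continuous_on_compose2[OF cont(2)]) (auto intro!: continuous_intros)
    then show "continuous_on ({- 1<..<1} \<times> K) (\<lambda>(s, x). h' (x + s *\<^sub>R v))" by (simp add: case_prod_beta')
  qed (use der' in auto)
  moreover have "((\<lambda>s. LINT x:K|lborel. h (x + s *\<^sub>R v)) has_vector_derivative 0) (at 0)"
  proof (rule has_vector_derivative_transform_within_open[of "\<lambda>_. integral\<^sup>L lborel h" 0 0 "{-1<..<1}"])
    fix s :: real assume s: "s \<in> {-1<..<1}"
    have "integral\<^sup>L lborel h = (LINT x|lborel. h (x + s *\<^sub>R v))"
          proof -
      have "integral\<^sup>L lborel h = integral\<^sup>L (distr lborel borel ((+) (s *\<^sub>R v))) h"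
        by (simp add: lborel_distr_plus)
      also have "\<dots> = (LINT x|lborel. h (s *\<^sub>R v + x))"
        by (rule integral_distr) (use borel_measurable_continuous_onI[OF cont(1)] in auto)
      finally show ?thesis by (simp add: add.commute)
    qed
    also have "\<dots> = (LINT x:K|lborel. h (x + s *\<^sub>R v))"
      unfolding set_lebesgue_integral_def
      by (rule Bochner_Integration.integral_cong) (use out[OF _ s] C(2) in \<open>auto simp: indicator_def\<close>)
    finally show "integral\<^sup>L lborel h = (LINT x:K|lborel. h (x + s *\<^sub>R v))" .
  qed auto
  ultimately have "(LINT x:K|lborel. h' x) = 0"
    using vector_derivative_unique_at by fastforce
  also have "(LINT x:K|lborel. h' x) = integral\<^sup>L lborel h'"
    unfolding set_lebesgue_integral_def
    by (rule Bochner_Integration.integral_cong) (use h'0 in \<open>auto simp: indicator_def\<close>)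
  finally show ?thesis by simp
qed

text \<open>If \<open>c\<close> were negative, the first derivative, which is zero at the minimum, would be negative shortly
  after it.\<close>

lemma second_derivative_nonneg_at_min:
  fixes g g' :: "real \<Rightarrow> real"
  assumes I: "open I" "t \<in> I"
    and g: "\<And>s. s \<in> I \<Longrightarrow> (g has_real_derivative g' s) (at s)" "(g' has_real_derivative c) (at t)"
    and min: "\<And>s. s \<in> I \<Longrightarrow> g t \<le> g s"
  shows "0 \<le> c"
proof (rule ccontr)
  assume "\<not> 0 \<le> c"
  obtain e where e: "e > 0" "ball t e \<subseteq> I" using I open_contains_ball by blast
  have "g' t = 0"
    by (rule DERIV_local_min[OF g(1)[OF I(2)] e(1)]) (use e(2) min in \<open>auto simp: subset_eq dist_real_def\<close>)
  obtain d where d: "d > 0" "\<And>h. h > 0 \<Longrightarrow> h < d \<Longrightarrow> g' (t + h) < g' t"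
    using DERIV_neg_dec_right[OF g(2)] \<open>\<not> 0 \<le> c\<close> by auto
  define h where "h = min d e / 2"
  have h: "h > 0" "h < d" "h < e" using d(1) e(1) by (auto simp: h_def)
  have "\<exists>z>t. z < t + h \<and> g (t + h) - g t = (t + h - t) * g' z"
  proof (rule MVT2)
    show "(g has_real_derivative g' x) (at x)" if "t \<le> x" "x \<le> t + h" for x
    proof (rule g(1))
      have "x \<in> ball t e" using that h by (auto simp: dist_real_def)
      then show "x \<in> I" using e(2) by blast
    qed
  qed (use h in simp)
  then obtain z where z: "z > t" "z < t + h" and gz: "g (t + h) - g t = h * g' z" by auto
  have "g' z < 0" using d(2)[of "z - t"] z h(2) \<open>g' t = 0\<close> by simp
  then have "h * g' z < 0" using h(1) by (simp add: mult_pos_neg)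
  then have "g (t + h) < g t" using gz by linarith
  moreover have "g t \<le> g (t + h)" 
  proof (rule min)
    have "t + h \<in> ball t e" using h by (simp add: dist_real_def)
    then show "t + h \<in> I" using e(2) by blast
  qed
  ultimately show False by simp
qed

section \<open>Change of variables for nonnegative functions\<close>

text \<open>A copy of an arbitrary finite index type with the order of an initial segment of the natural numbers. It
  is needed for \<open>has_absolute_integral_change_of_variables\<close>, where coordinates are indexed by a
  well-ordered type.\<close>

typedef ('n::finite) ordered_index = "{..<CARD('n)}" by (auto intro: exI[of _ 0])

instantiation ordered_index :: (finite) linorder
begin
definition "i \<le> j \<longleftrightarrow> Rep_ordered_index i \<le> Rep_ordered_index j"
definition "i < j \<longleftrightarrow> Rep_ordered_index i < Rep_ordered_index j"
instance
  by standard (auto simp: less_eq_ordered_index_def less_ordered_index_def Rep_ordered_index_inject)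
end

instance ordered_index :: (finite) finite
proof
  have "(UNIV :: 'a ordered_index set) = Abs_ordered_index ` {..<CARD('a)}"
    using type_definition.Abs_image[OF type_definition_ordered_index[where 'n='a]] by simp
  then show "finite (UNIV :: 'a ordered_index set)" by (metis finite_imageI finite_lessThan)
qed

instance ordered_index :: (finite) wellorder
proof
  fix P :: "'a ordered_index \<Rightarrow> bool" and i
  assume *: "\<And>i. (\<And>j. j < i \<Longrightarrow> P j) \<Longrightarrow> P i"
  show "P i"
    by (induction i rule: measure_induct_rule[of Rep_ordered_index]) (rule *, simp add: less_ordered_index_def)
qed

lemma card_ordered_index: "CARD('n::finite ordered_index) = CARD('n)"
  using type_definition.card[OF type_definition_ordered_index] by simp

text \<open>The permutations of the two index types correspond under conjugation by \<open>e\<close>, which preserves signs.\<close>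

lemma det_reindex:
  fixes A :: "'a::comm_ring_1 ^ 'n ^ 'n" and e :: "'k::finite \<Rightarrow> 'n"
  assumes e: "bij e"
  shows "det (\<chi> i j. A $ e i $ e j) = det A"
proof -
  have inj: "inj_on e UNIV" and bij: "bij_betw e UNIV UNIV" using e by (simp_all add: bij_is_inj)
  have "bij_betw (map_permutation UNIV e) {p. p permutes UNIV} {p. p permutes UNIV}"
  proof (rule bij_betwI[where g="map_permutation UNIV (inv e)"])
    have bij': "bij_betw (inv e) UNIV UNIV" using e by (simp add: bij_imp_bij_inv)
    show "map_permutation UNIV e \<in> {p. p permutes UNIV} \<rightarrow> {p. p permutes UNIV}"
      using map_permutation_permutes[OF bij] by auto
    show "map_permutation UNIV (inv e) \<in> {p. p permutes UNIV} \<rightarrow> {p. p permutes UNIV}"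
      using map_permutation_permutes[OF bij'] by auto
    have m: "map_permutation UNIV f p = f \<circ> p \<circ> inv f" if "surj f" for f :: "'c \<Rightarrow> 'd" and p
      using that by (auto simp: map_permutation_def restrict_id_def)
    show "map_permutation UNIV (inv e) (map_permutation UNIV e p) = p" for p
      using e by (simp add: m bij_is_surj bij_imp_bij_inv inv_inv_eq fun_eq_iff bij_is_inj)
    show "map_permutation UNIV e (map_permutation UNIV (inv e) p) = p" for p
      using e by (simp add: m bij_is_surj bij_imp_bij_inv inv_inv_eq fun_eq_iff bij_is_surj surj_f_inv_f)
  qed
  then have "det A = (\<Sum>p | p permutes (UNIV :: 'k set). of_int (sign (map_permutation UNIV e p)) * (\<Prod>j\<in>UNIV. A $ j $ map_permutation UNIV e p j))"
    unfolding det_def by (rule sum.reindex_bij_betw[symmetric])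
  also have "\<dots> = (\<Sum>p | p permutes (UNIV :: 'k set). of_int (sign p) * (\<Prod>i\<in>UNIV. A $ e i $ e (p i)))"
  proof (rule sum.cong[OF refl], clarify)
    fix p :: "'k \<Rightarrow> 'k" assume p: "p permutes UNIV"
    have "(\<Prod>j\<in>UNIV. A $ j $ map_permutation UNIV e p j) = (\<Prod>i\<in>UNIV. A $ e i $ map_permutation UNIV e p (e i))"
      by (rule prod.reindex_bij_betw[OF bij, symmetric])
    then show "of_int (sign (map_permutation UNIV e p)) * (\<Prod>j\<in>UNIV. A $ j $ map_permutation UNIV e p j)
        = of_int (sign p) * (\<Prod>i\<in>UNIV. A $ e i $ e (p i))"
      using sign_map_permutation[OF inj p] map_permutation_apply[OF inj] by simp
  qed
  also have "\<dots> = det (\<chi> i j. A $ e i $ e j)" by (simp add: det_def)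
  finally show ?thesis by simp
qed

lemma emeasure_box_cart:
  fixes a b :: "real ^ 'n"
  assumes "\<And>i. a $ i \<le> b $ i"
  shows "emeasure lborel (box a b) = ennreal (\<Prod>i\<in>UNIV. b $ i - a $ i)"
proof -
  have "emeasure lborel (box a b) = (\<Prod>u\<in>Basis. (b - a) \<bullet> u)"
    using assms by (intro emeasure_lborel_box) (auto simp: Basis_vec_def cart_eq_inner_axis)
  also have "(Basis :: (real ^ 'n) set) = (\<lambda>i. axis i 1) ` UNIV" by (auto simp: Basis_vec_def)
  also have "(\<Prod>u\<in>(\<lambda>i. axis i 1) ` UNIV. (b - a) \<bullet> u) = (\<Prod>i\<in>UNIV. b $ i - a $ i)"
    by (subst prod.reindex) (auto simp: inj_on_def axis_eq_axis cart_eq_inner_axis inner_diff_left)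
  finally show ?thesis .
qed

lemma distr_reindex_lborel:
  fixes e :: "'k::finite \<Rightarrow> 'n::finite"
  assumes e: "bij e"
  shows "distr lborel borel (\<lambda>x :: real ^ 'n. \<chi> i. x $ e i) = (lborel :: (real ^ 'k) measure)"
proof (rule lborel_eqI[symmetric])
  let ?r = "\<lambda>x :: real ^ 'n. (\<chi> i. x $ e i) :: real ^ 'k"
  have [measurable]: "?r \<in> borel_measurable borel"
    by (intro borel_measurable_continuous_onI continuous_intros)
  fix l u :: "real ^ 'k" assume lu: "\<And>b. b \<in> Basis \<Longrightarrow> l \<bullet> b \<le> u \<bullet> b"
  have lu': "l $ i \<le> u $ i" for i
    using lu[of "axis i 1"] by (simp add: cart_eq_inner_axis)
  define l' u' where "l' = (\<chi> j. l $ inv e j)" and "u' = (\<chi> j. u $ inv e j)"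
  have "?r -` box l u = box l' u'"
  proof -
    have "(\<forall>i. l $ i < x $ e i \<and> x $ e i < u $ i) \<longleftrightarrow> (\<forall>j. l $ inv e j < x $ j \<and> x $ j < u $ inv e j)" for x
      using e by (metis bij_inv_eq_iff)
    then show ?thesis by (auto simp: mem_box_cart l'_def u'_def)
  qed
  then have "emeasure (distr lborel borel ?r) (box l u) = emeasure lborel (box l' u')"
    by (subst emeasure_distr) auto
  also have "\<dots> = ennreal (\<Prod>j\<in>UNIV. u' $ j - l' $ j)"
    by (rule emeasure_box_cart) (simp add: l'_def u'_def lu')
  also have "(\<Prod>j\<in>UNIV. u' $ j - l' $ j) = (\<Prod>i\<in>UNIV. u $ i - l $ i)"
    using prod.reindex_bij_betw[OF bij_imp_bij_inv[OF e], of "\<lambda>i. u $ i - l $ i"] by (simp add: l'_def u'_def)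
  also have "ennreal \<dots> = emeasure lborel (box l u)" by (rule emeasure_box_cart[symmetric]) (rule lu')
  also have "\<dots> = (\<Prod>b\<in>Basis. (u - l) \<bullet> b)" by (rule emeasure_lborel_box) (use lu in auto)
  finally show "emeasure (distr lborel borel ?r) (box l u) = (\<Prod>b\<in>Basis. (u - l) \<bullet> b)" .
qed simp

text \<open>This makes the change of variables theorem for absolutely integrable functions, which covers
  integrability as an equivalence, applicable to nonnegative functions with infinite integral.\<close>

lemma nn_integral_eq_absolute_integral:
  fixes f :: "'a::euclidean_space \<Rightarrow> real"
  assumes S: "S \<in> sets borel" and f: "(\<lambda>x. indicator S x * f x) \<in> borel_measurable borel" "\<And>x. x \<in> S \<Longrightarrow> f x \<ge> 0"
  shows "(\<integral>\<^sup>+x\<in>S. ennreal (f x) \<partial>lborel)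
    = (if f absolutely_integrable_on S then ennreal (Henstock_Kurzweil_Integration.integral S f) else \<infinity>)"
proof -
  have nn: "(\<integral>\<^sup>+x\<in>S. ennreal (f x) \<partial>lborel) = (\<integral>\<^sup>+x. ennreal (indicator S x * f x) \<partial>lborel)"
    by (rule nn_integral_cong) (auto simp: indicator_def)
  have iff: "f absolutely_integrable_on S \<longleftrightarrow> integrable lborel (\<lambda>x. indicator S x * f x)"
    unfolding set_integrable_def using integrable_completion[of "\<lambda>x. indicator S x * f x" lborel] f(1) by simp
  have nonneg: "indicator S x * f x \<ge> 0" for x using f(2) by (auto simp: indicator_def)
  show ?thesis
  proof (cases "f absolutely_integrable_on S")
    case True
    then have "(\<integral>\<^sup>+x. ennreal (indicator S x * f x) \<partial>lborel) = ennreal (LINT x|lborel. indicator S x * f x)"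
      using iff nonneg by (intro nn_integral_eq_integral) auto
    also have "(LINT x|lborel. indicator S x * f x) = (LINT x:S|lebesgue. f x)"
      unfolding set_lebesgue_integral_def using integral_completion[of "\<lambda>x. indicator S x * f x" lborel] f(1) by simp
    also have "\<dots> = Henstock_Kurzweil_Integration.integral S f"
      by (rule set_lebesgue_integral_eq_integral(2)[OF True])
    finally show ?thesis using True nn by simp
  next
    case False
    then have "\<not> (\<integral>\<^sup>+x. ennreal (indicator S x * f x) \<partial>lborel) < \<infinity>"
      using iff integrableI_nonneg[of "\<lambda>x. indicator S x * f x" lborel] f(1) nonneg by auto
    then show ?thesis using False nn by (simp add: less_top[symmetric])
  qed
qed

lemma nn_integral_change_of_variables_wellorder:
  fixes g :: "real ^ 'm::{finite,wellorder} \<Rightarrow> real ^ 'm::_" and f :: "real ^ 'm::_ \<Rightarrow> real"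
  assumes S: "S \<in> sets borel" "g ` S \<in> sets borel" "inj_on g S"
    and der: "\<And>x. x \<in> S \<Longrightarrow> (g has_derivative g' x) (at x)"
    and f: "(\<lambda>y. indicator (g ` S) y * f y) \<in> borel_measurable borel"
      "(\<lambda>x. indicator S x * (\<bar>det (matrix (g' x))\<bar> * f (g x))) \<in> borel_measurable borel"
      "\<And>x. x \<in> S \<Longrightarrow> f (g x) \<ge> 0"
  shows "(\<integral>\<^sup>+y\<in>g ` S. ennreal (f y) \<partial>lborel) = (\<integral>\<^sup>+x\<in>S. ennreal (\<bar>det (matrix (g' x))\<bar> * f (g x)) \<partial>lborel)"
proof -
  let ?h = "\<lambda>x. \<bar>det (matrix (g' x))\<bar> * f (g x)"
  have cov: "(?h absolutely_integrable_on S \<and> Henstock_Kurzweil_Integration.integral S ?h = b) \<longleftrightarrow>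
    (f absolutely_integrable_on (g ` S) \<and> Henstock_Kurzweil_Integration.integral (g ` S) f = b)" for b
  proof -
    \<comment> \<open>Real functions enter as vectors with a single component.\<close>
    have "S \<in> sets lebesgue" using S(1) by (auto intro: sets_completionI_sets) 
    from has_absolute_integral_change_of_variables[OF this has_derivative_at_withinI[OF der] S(3),
        of "\<lambda>x. (vec (f x) :: real ^ 1)" "vec b"]
    show ?thesis
      by (simp add: absolutely_integrable_on_1_iff integral_on_1_eq vec_eq_iff)
  qed
  have "?h absolutely_integrable_on S \<longleftrightarrow> f absolutely_integrable_on (g ` S)"
    and "?h absolutely_integrable_on S \<Longrightarrow> Henstock_Kurzweil_Integration.integral S ?h = Henstock_Kurzweil_Integration.integral (g ` S) f"
    using cov by blast+
  moreover have "(\<integral>\<^sup>+y\<in>g ` S. ennreal (f y) \<partial>lborel)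
     = (if f absolutely_integrable_on (g ` S) then ennreal (Henstock_Kurzweil_Integration.integral (g ` S) f) else \<infinity>)"
    by (rule nn_integral_eq_absolute_integral) (use S f in auto)
  moreover have "(\<integral>\<^sup>+x\<in>S. ennreal (?h x) \<partial>lborel)
     = (if ?h absolutely_integrable_on S then ennreal (Henstock_Kurzweil_Integration.integral S ?h) else \<infinity>)"
    by (rule nn_integral_eq_absolute_integral) (use S f in auto)
  ultimately show ?thesis by simp
qed

text \<open>Relabelling the coordinates by a bijection of the index types is an isometry, preserves Lebesgue measure
  and does not change Jacobians, so the well-ordered case implies the general one.\<close>

lemma nn_integral_change_of_variables:
  fixes g :: "real ^ 'm \<Rightarrow> real ^ 'm" and f :: "real ^ 'm \<Rightarrow> real"
  assumes S: "S \<in> sets borel" "g ` S \<in> sets borel" "inj_on g S"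
    and der: "\<And>x. x \<in> S \<Longrightarrow> (g has_derivative g' x) (at x)"
    and f: "(\<lambda>y. indicator (g ` S) y * f y) \<in> borel_measurable borel"
      "(\<lambda>x. indicator S x * (\<bar>det (matrix (g' x))\<bar> * f (g x))) \<in> borel_measurable borel"
      "\<And>x. x \<in> S \<Longrightarrow> f (g x) \<ge> 0"
  shows "(\<integral>\<^sup>+y\<in>g ` S. ennreal (f y) \<partial>lborel) = (\<integral>\<^sup>+x\<in>S. ennreal (\<bar>det (matrix (g' x))\<bar> * f (g x)) \<partial>lborel)"
proof -
  obtain e :: "'m ordered_index \<Rightarrow> 'm" where e: "bij e"
    using finite_same_card_bij[of "UNIV :: 'm ordered_index set" "UNIV :: 'm set"] card_ordered_index[where 'n='m] by auto
  define r where "r x = (\<chi> i. x $ e i)" for x :: "real ^ 'm"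
  define q where "q y = (\<chi> j. y $ inv e j)" for y :: "real ^ 'm ordered_index"
  have qr [simp]: "q (r x) = x" "r (q y) = y" for x y
    using e by (simp_all add: q_def r_def vec_eq_iff bij_is_inj bij_is_surj surj_f_inv_f)
  have q_linear: "bounded_linear q" and r_linear: "bounded_linear r"
    unfolding linear_conv_bounded_linear[symmetric]
    by (auto intro!: linearI simp: q_def r_def vec_eq_iff)
  have q_meas [measurable]: "q \<in> borel_measurable borel" and r_meas [measurable]: "r \<in> borel_measurable borel"
    by (intro borel_measurable_continuous_onI linear_continuous_on q_linear r_linear)+
  have r_image: "r ` T = q -` T" for T by (force intro!: image_eqI[where x="q _"])
  have r_sets: "r ` T \<in> sets borel" if "T \<in> sets borel" for T
    unfolding r_image using measurable_sets[OF q_meas that] by simp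
  define k where "k = r \<circ> g \<circ> q"
  define k' where "k' y = r \<circ> g' (q y) \<circ> q" for y
  have kr: "k ` (r ` S) = r ` (g ` S)" by (auto simp: k_def image_image)
  have nn_r: "(\<integral>\<^sup>+x\<in>T. ennreal (h x) \<partial>lborel) = (\<integral>\<^sup>+y\<in>r ` T. ennreal (h (q y)) \<partial>lborel)"
    if h: "(\<lambda>x. indicator T x * h x) \<in> borel_measurable borel" for T and h :: "real ^ 'm \<Rightarrow> real"
  proof -
    have ind: "indicator (r ` T) y = (indicator T (q y) :: real)" for y by (auto simp: r_image indicator_def)
    have "(\<integral>\<^sup>+y. ennreal (indicator T (q y) * h (q y)) \<partial>lborel)
        = (\<integral>\<^sup>+y. ennreal (indicator T (q y) * h (q y)) \<partial>distr lborel borel r)"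
      using distr_reindex_lborel[OF e] by (simp add: r_def[abs_def])
    also have "\<dots> = (\<integral>\<^sup>+x. ennreal (indicator T (q (r x)) * h (q (r x))) \<partial>lborel)"
      using h by (intro nn_integral_distr) (auto intro!: measurable_compose[OF q_meas])
    finally have "(\<integral>\<^sup>+y. ennreal (indicator T (q y) * h (q y)) \<partial>lborel) = (\<integral>\<^sup>+x. ennreal (indicator T x * h x) \<partial>lborel)"
      by simp
    moreover have "(\<integral>\<^sup>+x\<in>T. ennreal (h x) \<partial>lborel) = (\<integral>\<^sup>+x. ennreal (indicator T x * h x) \<partial>lborel)"
      by (rule nn_integral_cong) (auto simp: indicator_def)
    moreover have "(\<integral>\<^sup>+y\<in>r ` T. ennreal (h (q y)) \<partial>lborel) = (\<integral>\<^sup>+y. ennreal (indicator T (q y) * h (q y)) \<partial>lborel)"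
      by (rule nn_integral_cong) (auto simp: indicator_def r_image)
    ultimately show ?thesis by simp
  qed
  have det: "det (matrix (k' y)) = det (matrix (g' (q y)))" for y
  proof -
    have qa: "q (axis j 1) = axis (e j) 1" for j
    proof -
      have "inv e i = j \<longleftrightarrow> i = e j" for i using e by (metis bij_inv_eq_iff)
      then show ?thesis by (auto simp: q_def vec_eq_iff axis_def)
    qed
    have "matrix (k' y) = (\<chi> i j. matrix (g' (q y)) $ e i $ e j)"
      by (simp add: matrix_def k'_def qa r_def vec_eq_iff)
    then show ?thesis using det_reindex[OF e] by metis
  qed
  have meas_q: "(\<lambda>y. indicator (r ` T) y * h (q y)) \<in> borel_measurable borel"
    if h: "(\<lambda>x. indicator T x * h x) \<in> borel_measurable borel" for T and h :: "real ^ 'm \<Rightarrow> real"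
  proof -
    have "indicator (r ` T) y = (indicator T (q y) :: real)" for y by (auto simp: r_image indicator_def)
    then show ?thesis using measurable_compose[OF q_meas h] by simp
  qed
  have "(\<integral>\<^sup>+y\<in>k ` (r ` S). ennreal (f (q y)) \<partial>lborel)
      = (\<integral>\<^sup>+y\<in>r ` S. ennreal (\<bar>det (matrix (k' y))\<bar> * f (q (k y))) \<partial>lborel)"
  proof (rule nn_integral_change_of_variables_wellorder)
    show "inj_on k (r ` S)"
      using S(3) by (auto simp: inj_on_def k_def) (metis qr(1))
    show "(k has_derivative k' y) (at y)" if "y \<in> r ` S" for y
    proof -
      have "q y \<in> S" using that by auto
      then show ?thesis unfolding k_def k'_def
        by (intro diff_chain_at bounded_linear_imp_has_derivative q_linear r_linear der)
    qed
    show "(\<lambda>y. indicator (k ` r ` S) y * f (q y)) \<in> borel_measurable borel"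
      unfolding kr by (rule meas_q[OF f(1)])
    show "(\<lambda>x. indicator (r ` S) x * (\<bar>det (matrix (k' x))\<bar> * f (q (k x)))) \<in> borel_measurable borel"
      using meas_q[OF f(2)] by (simp add: det k_def)
  qed (use S r_sets f(3) kr in \<open>auto simp: k_def\<close>)
  then show ?thesis
    using nn_r[OF f(1)] nn_r[OF f(2)] unfolding kr by (simp add: det k_def)
qed

section \<open>Charts and frames\<close>

abbreviation chart_image :: "('l, 'm) chart \<Rightarrow> (real ^ 'm) set" where
  "chart_image c \<equiv> snd c ` fst c"

abbreviation chart_inv :: "('l, 'm) chart \<Rightarrow> real ^ 'm \<Rightarrow> 'l" where
  "chart_inv c \<equiv> inv_into (fst c) (snd c)"

text \<open>The coordinate vector fields of a chart, mapped by the derivative of \<open>G\<close>, as the rows of a matrix.\<close>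

definition frame :: "('l, 'm::finite) chart \<Rightarrow> ('l \<Rightarrow> 'b::real_normed_vector) \<Rightarrow> real ^ 'm \<Rightarrow> 'b ^ 'm" where
  "frame c G x = (\<chi> i. partial i (local_rep c G) x)"

definition area_density :: "('l, 'm::finite) chart \<Rightarrow> ('l \<Rightarrow> complex ^ 'n) \<Rightarrow> real ^ 'm \<Rightarrow> real" where
  "area_density c G x = sqrt (det (gram c G x))"

text \<open>The rows are the partial derivatives of the transition map from \<open>c\<close> to \<open>d\<close>, so this is the transpose of
  its Jacobian matrix; with this convention frames transform by multiplication from the left.\<close>

definition transition_matrix :: "('l, 'm::finite) chart \<Rightarrow> ('l, 'm) chart \<Rightarrow> 'l \<Rightarrow> real ^ 'm ^ 'm" where
  "transition_matrix c d p = (\<chi> i j. partial i (snd d \<circ> chart_inv c) (snd c p) $ j)"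

lemma gram_eq_real_gram: "gram c G x = real_gram (frame c G x)"
  by (simp add: gram_def real_gram_def frame_def)

lemma frechet_derivative_expand:
  fixes f :: "real ^ 'm \<Rightarrow> 'b::real_normed_vector"
  assumes "f differentiable (at x)"
  shows "frechet_derivative f (at x) v = (\<Sum>i\<in>UNIV. v $ i *\<^sub>R partial i f x)"
proof -
  have lin: "linear (frechet_derivative f (at x))" by (rule linear_frechet_derivative[OF assms])
  have "v = (\<Sum>i\<in>UNIV. v $ i *\<^sub>R axis i 1)" by (simp add: vec_eq_iff axis_def if_distrib cong: if_cong)
  then have "frechet_derivative f (at x) v = frechet_derivative f (at x) (\<Sum>i\<in>UNIV. v $ i *\<^sub>R axis i 1)" by simp
  also have "\<dots> = (\<Sum>i\<in>UNIV. v $ i *\<^sub>R partial i f x)"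
    by (simp add: linear_sum[OF lin] linear_cmul[OF lin] partial_def)
  finally show ?thesis .
qed

locale oriented_manifold =
  fixes A :: "('l::{t2_space, second_countable_topology}, 'm::finite) chart set"
  assumes manifold: "oriented_connected_manifold A"
begin

lemma chart_open: "c \<in> A \<Longrightarrow> open (fst c)" "c \<in> A \<Longrightarrow> open (chart_image c)"
  and chart_homeomorphism: "c \<in> A \<Longrightarrow> homeomorphism (fst c) (chart_image c) (snd c) (chart_inv c)"
  using manifold unfolding oriented_connected_manifold_def by auto

lemma chart_inj: "c \<in> A \<Longrightarrow> inj_on (snd c) (fst c)"
  using chart_homeomorphism unfolding homeomorphism_def by (metis inj_on_inverseI)

lemma chart_inv_simps:
  "c \<in> A \<Longrightarrow> p \<in> fst c \<Longrightarrow> chart_inv c (snd c p) = p"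
  "x \<in> chart_image c \<Longrightarrow> snd c (chart_inv c x) = x"
  "x \<in> chart_image c \<Longrightarrow> chart_inv c x \<in> fst c"
  using chart_inj by (auto simp: inv_into_into f_inv_into_f)

lemma chart_continuous: "c \<in> A \<Longrightarrow> continuous_on (fst c) (snd c)"
    "c \<in> A \<Longrightarrow> continuous_on (chart_image c) (chart_inv c)"
  using chart_homeomorphism unfolding homeomorphism_def by auto

lemma points_open: "open (points A)"
  unfolding points_def using chart_open by auto

lemma chart_subset_points: "c \<in> A \<Longrightarrow> fst c \<subseteq> points A"
  by (auto simp: points_def)

lemma chart_image_eq_vimage:
  assumes "c \<in> A" shows "snd c ` (fst c \<inter> B) = chart_image c \<inter> chart_inv c -` B"
proof (intro equalityI subsetI)
  fix x assume "x \<in> snd c ` (fst c \<inter> B)"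
  then show "x \<in> chart_image c \<inter> chart_inv c -` B" using chart_inv_simps(1)[OF assms] by auto
next
  fix x assume "x \<in> chart_image c \<inter> chart_inv c -` B"
  then show "x \<in> snd c ` (fst c \<inter> B)"
    using chart_inv_simps(2,3)[of x c] by (intro image_eqI[of x "snd c" "chart_inv c x"]) auto
qed

lemma chart_image_inter_open:
  assumes "c \<in> A" "open V" shows "open (snd c ` (fst c \<inter> V))"
proof -
  show ?thesis unfolding chart_image_eq_vimage[OF assms(1)]
    using continuous_open_preimage[OF chart_continuous(2)[OF assms(1)] chart_open(2)[OF assms(1)] assms(2)] by simp
qed

lemma chart_image_borel:
  assumes "c \<in> A" "B \<in> sets borel" "B \<subseteq> fst c" shows "snd c ` B \<in> sets borel"
proof -
  have eq: "snd c ` B = chart_inv c -` B \<inter> chart_image c"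
    using chart_image_eq_vimage[OF assms(1), of B] assms(3) by (simp add: Int_absorb2 Int_commute)
  have "chart_inv c \<in> measurable (restrict_space borel (chart_image c)) borel"
    by (rule borel_measurable_continuous_on_restrict[OF chart_continuous(2)[OF assms(1)]])
  from measurable_sets[OF this assms(2)]
  have "snd c ` B \<in> sets (restrict_space borel (chart_image c))" by (simp add: eq space_restrict_space)
  then show ?thesis using chart_open(2)[OF assms(1)] by (simp add: sets_restrict_space_iff)
qed

lemma smooth_map_local: "smooth_map A G \<Longrightarrow> c \<in> A \<Longrightarrow> smooth_on (chart_image c) (local_rep c G)"
  by (simp add: smooth_map_def)

lemma transition_smooth:
  assumes "c \<in> A" "d \<in> A"
  shows "smooth_on (snd c ` (fst c \<inter> fst d)) (snd d \<circ> chart_inv c)"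
    and "p \<in> fst c \<inter> fst d \<Longrightarrow> det (transition_matrix c d p) > 0"
    and "p \<in> fst c \<inter> fst d \<Longrightarrow>
      det (matrix (frechet_derivative (snd d \<circ> chart_inv c) (at (snd c p)))) = det (transition_matrix c d p)"
proof -
  have m: "\<And>U \<phi> V \<psi>. (U, \<phi>) \<in> A \<Longrightarrow> (V, \<psi>) \<in> A \<Longrightarrow> smooth_on (\<phi> ` (U \<inter> V)) (\<psi> \<circ> inv_into U \<phi>) \<and>
        (\<forall>x\<in>\<phi> ` (U \<inter> V). 0 < det (matrix (frechet_derivative (\<psi> \<circ> inv_into U \<phi>) (at x))))"
    using manifold unfolding oriented_connected_manifold_def by fast
  show "smooth_on (snd c ` (fst c \<inter> fst d)) (snd d \<circ> chart_inv c)"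
    using m[of "fst c" "snd c" "fst d" "snd d"] assms by simp
  have "transition_matrix c d p = Finite_Cartesian_Product.transpose (matrix (frechet_derivative (snd d \<circ> chart_inv c) (at (snd c p))))"
    by (simp add: transition_matrix_def matrix_def Finite_Cartesian_Product.transpose_def partial_def)
  then show eq: "det (matrix (frechet_derivative (snd d \<circ> chart_inv c) (at (snd c p)))) = det (transition_matrix c d p)"
    by simp
  show "det (transition_matrix c d p) > 0" if "p \<in> fst c \<inter> fst d"
    using m[of "fst c" "snd c" "fst d" "snd d"] assms that unfolding eq[symmetric] by auto
qed

lemma local_rep_change:
  assumes "c \<in> A" "d \<in> A" "x \<in> snd c ` (fst c \<inter> fst d)"
  shows "local_rep c G x = local_rep d G ((snd d \<circ> chart_inv c) x)"
  using assms chart_inv_simps by (auto simp: local_rep_def)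

lemma partial_change:
  assumes cd: "c \<in> A" "d \<in> A" and p: "p \<in> fst c" "p \<in> fst d"
    and diff: "local_rep d G differentiable (at (snd d p))"
  shows "partial i (local_rep c G) (snd c p)
      = (\<Sum>j\<in>UNIV. transition_matrix c d p $ i $ j *\<^sub>R partial j (local_rep d G) (snd d p))"
proof -
  let ?\<tau> = "snd d \<circ> chart_inv c" and ?x = "snd c p"
  have x: "?x \<in> snd c ` (fst c \<inter> fst d)" using p by auto
  have \<tau>x: "?\<tau> ?x = snd d p" using chart_inv_simps(1)[OF cd(1) p(1)] by simp
  have d\<tau>: "?\<tau> differentiable (at ?x)"
    by (rule smooth_on_differentiable[OF transition_smooth(1)[OF cd] x])
  have dG: "local_rep d G differentiable (at (?\<tau> ?x))" using diff \<tau>x by simp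
  have "frechet_derivative (local_rep c G) (at ?x) = frechet_derivative (local_rep d G \<circ> ?\<tau>) (at ?x)"
  proof (rule frechet_derivative_transform_within_open[symmetric])
    show "(local_rep d G \<circ> ?\<tau>) differentiable (at ?x)"
      using differentiable_chain_at[OF d\<tau> dG] .
    show "open (snd c ` (fst c \<inter> fst d))" by (rule chart_image_inter_open[OF cd(1) chart_open(1)[OF cd(2)]])
    show "?x \<in> snd c ` (fst c \<inter> fst d)" by (rule x)
    show "(local_rep d G \<circ> ?\<tau>) y = local_rep c G y" if "y \<in> snd c ` (fst c \<inter> fst d)" for y
      using local_rep_change[OF cd that, of G] by simp
  qed
  also have "\<dots> = frechet_derivative (local_rep d G) (at (?\<tau> ?x)) \<circ> frechet_derivative ?\<tau> (at ?x)"
    by (rule frechet_derivative_compose[OF d\<tau> dG])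
  finally show ?thesis
    using frechet_derivative_expand[OF diff, of "frechet_derivative ?\<tau> (at ?x) (axis i 1)"] unfolding \<tau>x
    by (simp only: partial_def[of i] transition_matrix_def vec_lambda_beta o_apply)
qed

lemma frame_change:
  assumes "c \<in> A" "d \<in> A" "p \<in> fst c" "p \<in> fst d" "smooth_map A G"
  shows "frame c G (snd c p) $ i = (\<Sum>j\<in>UNIV. transition_matrix c d p $ i $ j *\<^sub>R frame d G (snd d p) $ j)"
  using partial_change[OF assms(1-4) smooth_on_differentiable[OF smooth_map_local[OF assms(5,2)]]] assms(4)
  by (simp add: frame_def)

lemma partial_continuous:
  assumes "smooth_map A G" "c \<in> A"
  shows "continuous_on (chart_image c) (partial i (local_rep c G))"
  unfolding partial_def[abs_def]
  by (intro smooth_on_continuous smooth_on_deriv smooth_map_local assms)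

lemma smooth_map_continuous:
  fixes G :: "'l \<Rightarrow> 'b::real_normed_vector"
  assumes "smooth_map A G" shows "continuous_on (points A) G"
proof -
  have "continuous_on (fst c) G" if c: "c \<in> A" for c
  proof -
    have "continuous_on (fst c) (local_rep c G \<circ> snd c)"
      using smooth_on_continuous[OF smooth_map_local[OF assms c]] chart_continuous(1)[OF c]
      by (intro continuous_on_compose)
    then show ?thesis
      by (rule continuous_on_eq) (simp add: local_rep_def chart_inv_simps(1)[OF c])
  qed
  then show ?thesis unfolding points_def by (intro continuous_on_open_UN) (auto simp: chart_open)
qed

lemma frame_independent:
  fixes G :: "'l \<Rightarrow> complex ^ 'n"
  assumes G: "immersion A G" "c \<in> A" "x \<in> chart_image c"
    and "(\<Sum>i\<in>UNIV. v $ i *\<^sub>R frame c G x $ i) = 0"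
  shows "v = 0"
proof -
  have sm: "smooth_map A G" and inj: "inj (frechet_derivative (local_rep c G) (at x))"
    using G unfolding immersion_def by auto
  have diff: "local_rep c G differentiable (at x)"
    by (rule smooth_on_differentiable[OF smooth_map_local[OF sm G(2)] G(3)])
  have "frechet_derivative (local_rep c G) (at x) v = 0"
    using assms(4) by (simp add: frechet_derivative_expand[OF diff] frame_def)
  then show "v = 0"
    using inj linear_frechet_derivative[OF diff] by (metis injD linear_0)
qed

lemma immersion_smooth_map: "immersion A G \<Longrightarrow> smooth_map A G"
  by (simp add: immersion_def)

lemma det_gram_pos:
  fixes G :: "'l \<Rightarrow> complex ^ 'n"
  assumes "immersion A G" "c \<in> A" "x \<in> chart_image c"
  shows "det (gram c G x) > 0" "area_density c G x > 0"
proof -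
  show "det (gram c G x) > 0"
    unfolding gram_eq_real_gram by (rule det_real_gram_pos) (rule frame_independent[OF assms])
  then show "area_density c G x > 0" by (simp add: area_density_def)
qed

lemma area_density_continuous:
  fixes G :: "'l \<Rightarrow> complex ^ 'n"
  assumes "smooth_map A G" "c \<in> A"
  shows "continuous_on (chart_image c) (area_density c G)"
  unfolding area_density_def[abs_def] det_def gram_def vec_lambda_beta
  by (intro continuous_intros partial_continuous assms)

text \<open>The determinant appears without absolute value because the charts are positively oriented.\<close>

lemma area_density_change:
  fixes G :: "'l \<Rightarrow> complex ^ 'n"
  assumes "c \<in> A" "d \<in> A" "p \<in> fst c" "p \<in> fst d" "smooth_map A G"
  shows "area_density c G (snd c p) = det (transition_matrix c d p) * area_density d G (snd d p)"
  unfolding area_density_def gram_eq_real_gram real_gram_change_of_frame[OF frame_change[OF assms]]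
  using transition_smooth(2)[OF assms(1,2), of p] assms(3,4) by (simp add: real_sqrt_mult)

section \<open>The volume measure of an immersion\<close>

abbreviation space_algebra :: "'l measure" where "space_algebra \<equiv> restrict_space borel (points A)"

lemma sets_space_algebra: "B \<in> sets space_algebra \<longleftrightarrow> B \<in> sets borel \<and> B \<subseteq> points A"
  using points_open by (auto simp: sets_restrict_space_iff)

text \<open>The property by which \<open>volume_measure\<close> is defined.\<close>

definition is_volume :: "'l measure \<Rightarrow> ('l \<Rightarrow> complex ^ 'n) \<Rightarrow> bool" where
  "is_volume \<mu> G \<longleftrightarrow> sets \<mu> = sets space_algebra \<and>
     (\<forall>c\<in>A. \<forall>B\<in>sets borel. B \<subseteq> fst c \<longrightarrow>
        emeasure \<mu> B = (\<integral>\<^sup>+x\<in>snd c ` B. ennreal (area_density c G x) \<partial>lborel))"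

definition chart_measure :: "('l, 'm) chart \<Rightarrow> ('l \<Rightarrow> complex ^ 'n) \<Rightarrow> 'l measure" where
  "chart_measure c G = distr (density (restrict_space lborel (chart_image c)) (\<lambda>x. ennreal (area_density c G x)))
     space_algebra (chart_inv c)"

lemma chart_inv_measurable: "c \<in> A \<Longrightarrow> chart_inv c \<in> measurable (restrict_space lborel (chart_image c)) space_algebra"
proof (rule measurable_restrict_space2)
  assume c: "c \<in> A"
  show "chart_inv c \<in> space (restrict_space lborel (chart_image c)) \<rightarrow> points A"
    using chart_inv_simps(3) chart_subset_points[OF c] by (auto simp: space_restrict_space)
  show "chart_inv c \<in> borel_measurable (restrict_space lborel (chart_image c))"
    using borel_measurable_continuous_on_restrict[OF chart_continuous(2)[OF c]]
    by (simp add: measurable_cong_sets[OF sets_restrict_space_cong[OF sets_lborel] refl])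
qed

lemma area_density_measurable:
  fixes G :: "'l \<Rightarrow> complex ^ 'n"
  assumes "smooth_map A G" "c \<in> A"
  shows "area_density c G \<in> borel_measurable (restrict_space lborel (chart_image c))"
  using borel_measurable_continuous_on_restrict[OF area_density_continuous[OF assms]]
  by (simp add: measurable_cong_sets[OF sets_restrict_space_cong[OF sets_lborel] refl])

lemma sets_chart_measure [simp]: "sets (chart_measure c G) = sets space_algebra"
  by (simp add: chart_measure_def)

lemma emeasure_chart_measure:
  fixes G :: "'l \<Rightarrow> complex ^ 'n"
  assumes G: "smooth_map A G" "c \<in> A" and B: "B \<in> sets space_algebra"
  shows "emeasure (chart_measure c G) B = (\<integral>\<^sup>+x\<in>snd c ` (B \<inter> fst c). ennreal (area_density c G x) \<partial>lborel)"
proof -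
  note [measurable] = chart_inv_measurable[OF G(2)] area_density_measurable[OF G]
  have im: "chart_image c \<inter> space lborel \<in> sets lborel" using chart_open(2)[OF G(2)] by simp
  have "emeasure (chart_measure c G) B = emeasure (density (restrict_space lborel (chart_image c)) (\<lambda>x. ennreal (area_density c G x)))
      (chart_inv c -` B \<inter> chart_image c)"
    unfolding chart_measure_def using B by (subst emeasure_distr) (auto simp: space_restrict_space)
  also have "\<dots> = (\<integral>\<^sup>+x. ennreal (area_density c G x) * indicator (chart_inv c -` B \<inter> chart_image c) x \<partial>restrict_space lborel (chart_image c))"
    by (rule emeasure_density) (use measurable_sets[OF chart_inv_measurable[OF G(2)] B] in \<open>auto simp: space_restrict_space\<close>)
  also have "\<dots> = (\<integral>\<^sup>+x. ennreal (area_density c G x) * indicator (chart_inv c -` B \<inter> chart_image c) x * indicator (chart_image c) x \<partial>lborel)"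
    by (rule nn_integral_restrict_space[OF im])
  also have "\<dots> = (\<integral>\<^sup>+x\<in>snd c ` (B \<inter> fst c). ennreal (area_density c G x) \<partial>lborel)"
  proof (rule nn_integral_cong)
    fix x
    have "x \<in> snd c ` (B \<inter> fst c) \<longleftrightarrow> x \<in> chart_image c \<and> chart_inv c x \<in> B"
      using chart_image_eq_vimage[OF G(2), of B] by (auto simp: Int_commute)
    then show "ennreal (area_density c G x) * indicator (chart_inv c -` B \<inter> chart_image c) x * indicator (chart_image c) x
        = ennreal (area_density c G x) * indicator (snd c ` (B \<inter> fst c)) x"
      by (auto simp: indicator_def)
  qed
  finally show ?thesis .
qed

lemma indicator_area_density_measurable:
  fixes G :: "'l \<Rightarrow> complex ^ 'n"
  assumes "smooth_map A G" "c \<in> A" "S \<in> sets borel" "S \<subseteq> chart_image c"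
  shows "(\<lambda>x. indicator S x * area_density c G x) \<in> borel_measurable borel"
  using borel_measurable_continuous_on_indicator[OF assms(3) continuous_on_subset[OF area_density_continuous[OF assms(1,2)] assms(4)]]
  by simp

text \<open>The densities of two charts differ by the Jacobian determinant of the transition map.\<close>

lemma chart_area_independent:
  fixes G :: "'l \<Rightarrow> complex ^ 'n"
  assumes imm: "immersion A G" and cd: "c \<in> A" "d \<in> A" and B: "B \<in> sets borel" "B \<subseteq> fst c" "B \<subseteq> fst d"
  shows "(\<integral>\<^sup>+x\<in>snd c ` B. ennreal (area_density c G x) \<partial>lborel) = (\<integral>\<^sup>+x\<in>snd d ` B. ennreal (area_density d G x) \<partial>lborel)"
proof -
  note G = immersion_smooth_map[OF imm]
  let ?\<tau> = "snd d \<circ> chart_inv c"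
  have \<tau>: "?\<tau> ` (snd c ` B) = snd d ` B"
    using chart_inv_simps(1)[OF cd(1)] B by (force simp: image_comp intro!: image_cong)
  have scB: "snd c ` B \<subseteq> snd c ` (fst c \<inter> fst d)" using B by auto
  have jac: "\<bar>det (matrix (frechet_derivative ?\<tau> (at x)))\<bar> * area_density d G (?\<tau> x) = area_density c G x"
    if x: "x \<in> snd c ` B" for x
  proof -
    obtain p where p: "x = snd c p" "p \<in> B" using x by auto
    then have pc: "p \<in> fst c" "p \<in> fst d" using B by auto
    show ?thesis
      using transition_smooth(2,3)[OF cd, of p] pc area_density_change[OF cd pc G] chart_inv_simps(1)[OF cd(1) pc(1)] p
      by simp
  qed
  have "(\<integral>\<^sup>+x\<in>?\<tau> ` (snd c ` B). ennreal (area_density d G x) \<partial>lborel)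
    = (\<integral>\<^sup>+x\<in>snd c ` B. ennreal (\<bar>det (matrix (frechet_derivative ?\<tau> (at x)))\<bar> * area_density d G (?\<tau> x)) \<partial>lborel)"
  proof (rule nn_integral_change_of_variables)
    show "snd c ` B \<in> sets borel" by (rule chart_image_borel[OF cd(1) B(1,2)])
    show "?\<tau> ` snd c ` B \<in> sets borel" unfolding \<tau> by (rule chart_image_borel[OF cd(2) B(1,3)])
    show "inj_on ?\<tau> (snd c ` B)"
    proof (rule inj_onI)
      fix x y assume xy: "x \<in> snd c ` B" "y \<in> snd c ` B" "?\<tau> x = ?\<tau> y"
      then obtain p q where "x = snd c p" "y = snd c q" "p \<in> B" "q \<in> B" by auto
      then show "x = y"
        using xy(3) B chart_inv_simps(1)[OF cd(1)] inj_onD[OF chart_inj[OF cd(2)], of p q] by (auto simp: subset_eq)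
    qed
    show "(?\<tau> has_derivative frechet_derivative ?\<tau> (at x)) (at x)" if "x \<in> snd c ` B" for x
      using smooth_on_differentiable[OF transition_smooth(1)[OF cd]] that scB
      by (auto simp: frechet_derivative_works[symmetric])
    show "(\<lambda>y. indicator (?\<tau> ` snd c ` B) y * area_density d G y) \<in> borel_measurable borel"
      unfolding \<tau> by (rule indicator_area_density_measurable[OF G cd(2) chart_image_borel[OF cd(2) B(1,3)]]) (use B in auto)
    have "(\<lambda>x. indicator (snd c ` B) x * area_density c G x) \<in> borel_measurable borel"
      by (rule indicator_area_density_measurable[OF G cd(1) chart_image_borel[OF cd(1) B(1,2)]]) (use B in auto)
    also have "(\<lambda>x. indicator (snd c ` B) x * area_density c G x)
      = (\<lambda>x. indicator (snd c ` B) x * (\<bar>det (matrix (frechet_derivative ?\<tau> (at x)))\<bar> * area_density d G (?\<tau> x)))"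
      using jac by (auto simp: indicator_def)
    finally show "(\<lambda>x. indicator (snd c ` B) x * (\<bar>det (matrix (frechet_derivative ?\<tau> (at x)))\<bar> * area_density d G (?\<tau> x)))
      \<in> borel_measurable borel" .
    show "area_density d G (?\<tau> x) \<ge> 0" if "x \<in> snd c ` B" for x
    proof -
      have "?\<tau> x \<in> chart_image d" using that \<tau> B by blast
      then show ?thesis using det_gram_pos(2)[OF imm cd(2)] less_imp_le by blast
    qed
  qed
  also have "\<dots> = (\<integral>\<^sup>+x\<in>snd c ` B. ennreal (area_density c G x) \<partial>lborel)"
    by (rule nn_integral_cong) (auto simp: indicator_def jac[simplified])
  finally show ?thesis unfolding \<tau> by simp
qed

lemma countable_chart_cover:
  assumes "A \<noteq> {}"
  obtains ch :: "nat \<Rightarrow> ('l, 'm) chart" where "range ch \<subseteq> A" "(\<Union>n. fst (ch n)) = points A"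
proof -
  obtain U' where U': "U' \<subseteq> fst ` A" "countable U'" "\<Union>U' = \<Union>(fst ` A)"
    using Lindelof[of "fst ` A"] chart_open(1) by (metis imageE)
  obtain C where C: "C \<subseteq> A" "countable C" "U' = fst ` C"
    using countable_subset_image[of U' fst A] U' by auto
  obtain a where a: "a \<in> A" using assms by auto
  have ne: "insert a C \<noteq> {}" and cn: "countable (insert a C)" using C by auto
  have "range (from_nat_into (insert a C)) = insert a C"
    by (rule range_from_nat_into[OF ne cn])
  moreover have "(\<Union>c\<in>insert a C. fst c) = points A"
  proof -
    have "(\<Union>c\<in>C. fst c) = points A" using U'(3) C(3) by (simp add: points_def)
    then show ?thesis using chart_subset_points[OF a] by auto
  qed
  ultimately show ?thesis
  proof (intro that[of "from_nat_into (insert a C)"])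
    assume *: "range (from_nat_into (insert a C)) = insert a C" "(\<Union>c\<in>insert a C. fst c) = points A"
    show "range (from_nat_into (insert a C)) \<subseteq> A" using * a C(1) by simp
    have "(\<Union>n. fst (from_nat_into (insert a C) n)) = (\<Union>c\<in>range (from_nat_into (insert a C)). fst c)" by simp
    then show "(\<Union>n. fst (from_nat_into (insert a C) n)) = points A" unfolding * .
  qed
qed

text \<open>By second countability the manifold is a countable disjoint union of Borel sets in chart domains.\<close>

lemma disjoint_chart_cover:
  assumes "A \<noteq> {}"
  obtains ch :: "nat \<Rightarrow> ('l, 'm) chart" and E where "range ch \<subseteq> A" "\<And>n. E n \<in> sets borel"
    "\<And>n. E n \<subseteq> fst (ch n)" "disjoint_family E" "(\<Union>n. E n) = points A"
proof -
  obtain ch :: "nat \<Rightarrow> ('l, 'm) chart" where ch: "range ch \<subseteq> A" "(\<Union>n. fst (ch n)) = points A"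
    using countable_chart_cover[OF assms] by blast
  let ?E = "disjointed (\<lambda>n. fst (ch n))"
  have "fst (ch n) \<in> sets borel" for n
    using chart_open(1)[of "ch n"] ch(1) by (simp add: range_subsetD)
  then have "range ?E \<subseteq> sets borel" by (intro sets.range_disjointed_sets) auto
  then show ?thesis
    using ch disjointed_subset[of "\<lambda>n. fst (ch n)"] disjoint_family_disjointed UN_disjointed_eq[of "\<lambda>n. fst (ch n)"]
    by (intro that[of ch ?E]) auto
qed

text \<open>The chart formula determines the measure on each piece of a countable disjoint cover.\<close>

lemma is_volume_unique:
  fixes G :: "'l \<Rightarrow> complex ^ 'n"
  assumes "A \<noteq> {}" "is_volume \<mu> G" "is_volume \<nu> G"
  shows "\<mu> = \<nu>"
proof (rule measure_eqI)
  show "sets \<mu> = sets \<nu>" using assms by (simp add: is_volume_def)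
  obtain ch :: "nat \<Rightarrow> ('l, 'm) chart" and E where ch: "range ch \<subseteq> A" and Eb: "\<And>n. E n \<in> sets borel"
    and Ec: "\<And>n. E n \<subseteq> fst (ch n)" and disj: "disjoint_family E" and UE: "(\<Union>n. E n) = points A"
    using disjoint_chart_cover[OF assms(1)] by blast
  fix B assume "B \<in> sets \<mu>"
  then have B: "B \<in> sets borel" "B \<subseteq> points A"
    using assms by (auto simp: is_volume_def sets_space_algebra)
  have "emeasure m B = (\<Sum>n. (\<integral>\<^sup>+x\<in>snd (ch n) ` (B \<inter> E n). ennreal (area_density (ch n) G x) \<partial>lborel))"
    if m: "is_volume m G" for m
  proof -
    have "B \<inter> E n \<in> sets space_algebra" for n
      unfolding sets_space_algebra using Eb B by auto
    then have "range (\<lambda>n. B \<inter> E n) \<subseteq> sets m" using m by (auto simp: is_volume_def)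
    then have "(\<Sum>n. emeasure m (B \<inter> E n)) = emeasure m (\<Union>n. B \<inter> E n)"
      by (rule suminf_emeasure) (use disj in \<open>auto simp: disjoint_family_on_def\<close>)
    moreover have "(\<Union>n. B \<inter> E n) = B" using UE B(2) by auto
    moreover have "emeasure m (B \<inter> E n) = (\<integral>\<^sup>+x\<in>snd (ch n) ` (B \<inter> E n). ennreal (area_density (ch n) G x) \<partial>lborel)" for n
    proof -
      have "ch n \<in> A" "B \<inter> E n \<in> sets borel" "B \<inter> E n \<subseteq> fst (ch n)" using ch B(1) Eb[of n] Ec[of n] by auto
      then show ?thesis using m unfolding is_volume_def by blast
    qed
    ultimately show ?thesis by simp
  qed
  then show "emeasure \<mu> B = emeasure \<nu> B" using assms(2,3) by simp
qed

text \<open>Adding up the chart measures of the pieces of a countable disjoint cover gives a measure; it has the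
  right values in every chart since these do not depend on the chart.\<close>

lemma is_volume_exists:
  fixes G :: "'l \<Rightarrow> complex ^ 'n"
  assumes "A \<noteq> {}" and imm: "immersion A G"
  shows "\<exists>\<mu>. is_volume \<mu> G"
proof -
  note G = immersion_smooth_map[OF imm]
  obtain ch :: "nat \<Rightarrow> ('l, 'm) chart" and E where ch: "range ch \<subseteq> A" and Eb: "\<And>n. E n \<in> sets borel"
    and Ec: "\<And>n. E n \<subseteq> fst (ch n)" and disj: "disjoint_family E" and UE: "(\<Union>n. E n) = points A"
    using disjoint_chart_cover[OF assms(1)] by blast
  have EB: "B \<inter> E n \<in> sets space_algebra" if "B \<in> sets borel" for B n
    unfolding sets_space_algebra using that Eb[of n] UE by auto
  define f where "f B = (\<Sum>n. emeasure (chart_measure (ch n) G) (B \<inter> E n))" for B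
  have ca: "countably_additive (sets space_algebra) f"
  proof (rule countably_additiveI)
    fix B :: "nat \<Rightarrow> 'l set"
    assume B: "range B \<subseteq> sets space_algebra" "disjoint_family B"
    have "(\<Sum>i. f (B i)) = (\<integral>\<^sup>+i. (\<Sum>n. emeasure (chart_measure (ch n) G) (B i \<inter> E n)) \<partial>count_space UNIV)"
      unfolding f_def nn_integral_count_space_nat ..
    also have "\<dots> = (\<Sum>n. \<integral>\<^sup>+i. emeasure (chart_measure (ch n) G) (B i \<inter> E n) \<partial>count_space UNIV)"
      by (rule nn_integral_suminf) simp
    also have "\<dots> = (\<Sum>n. \<Sum>i. emeasure (chart_measure (ch n) G) (B i \<inter> E n))"
      unfolding nn_integral_count_space_nat ..
    also have "\<dots> = (\<Sum>n. emeasure (chart_measure (ch n) G) (\<Union>i. B i \<inter> E n))"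
    proof (rule arg_cong[where f=suminf], rule ext, rule suminf_emeasure)
      fix n
      show "range (\<lambda>i. B i \<inter> E n) \<subseteq> sets (chart_measure (ch n) G)"
      proof -
        have "B i \<in> sets borel" for i using B(1) sets_space_algebra by auto
        then show ?thesis using EB by auto
      qed
      show "disjoint_family (\<lambda>i. B i \<inter> E n)" using B(2) by (auto simp: disjoint_family_on_def)
    qed
    also have "\<dots> = f (\<Union>i. B i)" unfolding f_def by (simp add: Int_commute)
    finally show "(\<Sum>i. f (B i)) = f (\<Union>i. B i)" .
  qed
  have pos: "positive (sets space_algebra) f" by (simp add: positive_def f_def)
  define \<mu> where "\<mu> = measure_of (points A) (sets space_algebra) f"
  have alg: "sets space_algebra \<subseteq> Pow (points A)" using sets_space_algebra by auto
  have sp: "space space_algebra = points A" by (simp add: space_restrict_space)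
  have s\<mu>: "sets \<mu> = sets space_algebra"
    unfolding \<mu>_def using sets.sets_measure_of_eq[of space_algebra] sp by simp
  have e\<mu>: "emeasure \<mu> B = f B" if "B \<in> sets space_algebra" for B
    unfolding \<mu>_def using sets.sigma_algebra_axioms[of space_algebra] sp that pos ca
    by (intro emeasure_measure_of_sigma) auto
  have "is_volume \<mu> G" unfolding is_volume_def
  proof (intro conjI ballI impI s\<mu>)
    fix c B assume c: "c \<in> A" and B: "B \<in> sets borel" "B \<subseteq> fst c"
    then have B': "B \<in> sets space_algebra" using chart_subset_points[OF c] by (auto simp: sets_space_algebra)
    have "emeasure (chart_measure (ch n) G) (B \<inter> E n) = emeasure (chart_measure c G) (B \<inter> E n)" for n
    proof -
      have chn: "ch n \<in> A" using ch by auto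
      have i: "B \<inter> E n \<inter> fst (ch n) = B \<inter> E n" "B \<inter> E n \<inter> fst c = B \<inter> E n" using Ec[of n] B by auto
      show ?thesis
        unfolding emeasure_chart_measure[OF G chn EB[OF B(1)]] emeasure_chart_measure[OF G c EB[OF B(1)]] i
        by (rule chart_area_independent[OF imm chn c]) (use B Eb[of n] Ec[of n] in auto)
    qed
    then have "emeasure \<mu> B = (\<Sum>n. emeasure (chart_measure c G) (B \<inter> E n))"
      by (simp add: e\<mu>[OF B'] f_def)
    also have "\<dots> = emeasure (chart_measure c G) (\<Union>n. B \<inter> E n)"
      by (rule suminf_emeasure) (use EB[OF B(1)] disj in \<open>auto simp: disjoint_family_on_def\<close>)
    also have "(\<Union>n. B \<inter> E n) = B" using UE B' by (auto simp: sets_space_algebra)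
    also have "emeasure (chart_measure c G) B = (\<integral>\<^sup>+x\<in>snd c ` B. ennreal (area_density c G x) \<partial>lborel)"
      using B by (simp add: emeasure_chart_measure[OF G c B'] Int_absorb2)
    finally show "emeasure \<mu> B = (\<integral>\<^sup>+x\<in>snd c ` B. ennreal (area_density c G x) \<partial>lborel)" .
  qed
  then show ?thesis by blast
qed

lemma volume_measure_eq:
  fixes G :: "'l \<Rightarrow> complex ^ 'n"
  assumes "A \<noteq> {}" "is_volume \<mu> G"
  shows "volume_measure A G = \<mu>"
  unfolding volume_measure_def
  by (rule the_equality)
     (use assms is_volume_unique[OF assms(1)] in \<open>auto simp: is_volume_def area_density_def\<close>)

lemma is_volume_volume_measure:
  fixes G :: "'l \<Rightarrow> complex ^ 'n"
  assumes "A \<noteq> {}" "immersion A G"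
  shows "is_volume (volume_measure A G) G"
  using is_volume_exists[OF assms] volume_measure_eq[OF assms(1)] by metis

lemma sets_volume_measure:
  fixes G :: "'l \<Rightarrow> complex ^ 'n"
  assumes "A \<noteq> {}" "immersion A G"
  shows "sets (volume_measure A G) = sets space_algebra" "space (volume_measure A G) = points A"
    "f \<in> measurable (volume_measure A G) N \<longleftrightarrow> f \<in> measurable space_algebra N"
proof -
  show s: "sets (volume_measure A G) = sets space_algebra"
    using is_volume_volume_measure[OF assms] by (simp add: is_volume_def)
  show "space (volume_measure A G) = points A" using sets_eq_imp_space_eq[OF s] by (simp add: space_restrict_space)
  show "f \<in> measurable (volume_measure A G) N \<longleftrightarrow> f \<in> measurable space_algebra N"
    by (simp add: measurable_cong_sets[OF s refl])
qed

text \<open>For functions that vanish outside a chart domain this reduces integrals over the manifold to Lebesgue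
  integrals.\<close>

lemma density_indicator_chart:
  fixes G :: "'l \<Rightarrow> complex ^ 'n"
  assumes ne: "A \<noteq> {}" and imm: "immersion A G" and c: "c \<in> A"
  shows "density (volume_measure A G) (indicator (fst c)) = chart_measure c G"
proof (rule measure_eqI)
  let ?\<mu> = "volume_measure A G"
  have vol: "is_volume ?\<mu> G" by (rule is_volume_volume_measure[OF ne imm])
  then have s: "sets ?\<mu> = sets space_algebra" by (simp add: is_volume_def)
  then show "sets (density ?\<mu> (indicator (fst c))) = sets (chart_measure c G)" by simp
  fix B assume "B \<in> sets (density ?\<mu> (indicator (fst c)))"
  then have B: "B \<in> sets space_algebra" using s by simp
  have U: "fst c \<in> sets space_algebra"
    using chart_open(1)[OF c] chart_subset_points[OF c] by (simp add: sets_space_algebra)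
  have "emeasure (density ?\<mu> (indicator (fst c))) B = emeasure ?\<mu> (fst c \<inter> B)"
    by (rule emeasure_restricted) (use s U B in auto)
  also have "\<dots> = (\<integral>\<^sup>+x\<in>snd c ` (fst c \<inter> B). ennreal (area_density c G x) \<partial>lborel)"
    using vol c B chart_open(1)[OF c] unfolding is_volume_def sets_space_algebra by auto
  also have "\<dots> = emeasure (chart_measure c G) B"
    using emeasure_chart_measure[OF immersion_smooth_map[OF imm] c B] by (simp add: Int_commute)
  finally show "emeasure (density ?\<mu> (indicator (fst c))) B = emeasure (chart_measure c G) B" .
qed

lemma nn_integral_chart:
  fixes G :: "'l \<Rightarrow> complex ^ 'n"
  assumes ne: "A \<noteq> {}" and imm: "immersion A G" and c: "c \<in> A"
    and h: "h \<in> borel_measurable space_algebra" "\<And>p. p \<in> points A - fst c \<Longrightarrow> h p = 0"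
  shows "(\<integral>\<^sup>+p. h p \<partial>volume_measure A G)
    = (\<integral>\<^sup>+x. ennreal (area_density c G x) * h (chart_inv c x) * indicator (chart_image c) x \<partial>lborel)"
proof -
  let ?\<mu> = "volume_measure A G"
  have [measurable]: "h \<in> borel_measurable ?\<mu>" using h(1) by (simp add: sets_volume_measure(3)[OF ne imm])
  have [measurable]: "fst c \<in> sets ?\<mu>"
    using chart_open(1)[OF c] chart_subset_points[OF c] by (simp add: sets_volume_measure(1)[OF ne imm] sets_space_algebra)
  note [measurable] = chart_inv_measurable[OF c] area_density_measurable[OF immersion_smooth_map[OF imm] c] h(1)
  have im: "chart_image c \<inter> space lborel \<in> sets lborel" using chart_open(2)[OF c] by simp
  have "(\<integral>\<^sup>+p. h p \<partial>?\<mu>) = (\<integral>\<^sup>+p. indicator (fst c) p * h p \<partial>?\<mu>)"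
    by (rule nn_integral_cong) (use h(2) in \<open>auto simp: indicator_def sets_volume_measure(2)[OF ne imm]\<close>)
  also have "\<dots> = (\<integral>\<^sup>+p. h p \<partial>density ?\<mu> (indicator (fst c)))"
    by (rule nn_integral_density[symmetric]) auto
  also have "\<dots> = (\<integral>\<^sup>+p. h p \<partial>chart_measure c G)"
    by (simp add: density_indicator_chart[OF ne imm c])
  also have "\<dots> = (\<integral>\<^sup>+x. h (chart_inv c x) \<partial>density (restrict_space lborel (chart_image c)) (\<lambda>x. ennreal (area_density c G x)))"
    unfolding chart_measure_def by (rule nn_integral_distr) auto
  also have "\<dots> = (\<integral>\<^sup>+x. ennreal (area_density c G x) * h (chart_inv c x) \<partial>restrict_space lborel (chart_image c))"
    by (rule nn_integral_density) auto
  also have "\<dots> = (\<integral>\<^sup>+x. ennreal (area_density c G x) * h (chart_inv c x) * indicator (chart_image c) x \<partial>lborel)"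
    by (rule nn_integral_restrict_space[OF im])
  finally show ?thesis .
qed

lemma integral_chart:
  fixes G :: "'l \<Rightarrow> complex ^ 'n" and h :: "'l \<Rightarrow> 'b::{banach, second_countable_topology}"
  assumes ne: "A \<noteq> {}" and imm: "immersion A G" and c: "c \<in> A"
    and h: "h \<in> borel_measurable space_algebra" "\<And>p. p \<in> points A - fst c \<Longrightarrow> h p = 0"
  shows "(LINT p|volume_measure A G. h p)
    = (LINT x|lborel. indicator (chart_image c) x *\<^sub>R (area_density c G x *\<^sub>R h (chart_inv c x)))"
proof -
  let ?\<mu> = "volume_measure A G"
  have [measurable]: "h \<in> borel_measurable ?\<mu>" using h(1) by (simp add: sets_volume_measure(3)[OF ne imm])
  have [measurable]: "fst c \<in> sets ?\<mu>"
    using chart_open(1)[OF c] chart_subset_points[OF c] by (simp add: sets_volume_measure(1)[OF ne imm] sets_space_algebra)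
  note [measurable] = chart_inv_measurable[OF c] area_density_measurable[OF immersion_smooth_map[OF imm] c] h(1)
  have im: "chart_image c \<inter> space lborel \<in> sets lborel" using chart_open(2)[OF c] by simp
  have "(LINT p|?\<mu>. h p) = (LINT p|?\<mu>. indicator (fst c) p *\<^sub>R h p)"
    by (rule Bochner_Integration.integral_cong) (use h(2) in \<open>auto simp: indicator_def sets_volume_measure(2)[OF ne imm]\<close>)
  also have "\<dots> = (LINT p|density ?\<mu> (\<lambda>p. ennreal (indicator (fst c) p)). h p)"
    by (rule integral_density[symmetric]) auto
  also have "\<dots> = (LINT p|chart_measure c G. h p)"
    by (simp add: density_indicator_chart[OF ne imm c] ennreal_indicator)
  also have "\<dots> = (LINT x|density (restrict_space lborel (chart_image c)) (\<lambda>x. ennreal (area_density c G x)). h (chart_inv c x))"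
    unfolding chart_measure_def by (rule integral_distr) auto
  also have "\<dots> = (LINT x|restrict_space lborel (chart_image c). area_density c G x *\<^sub>R h (chart_inv c x))"
  proof (rule integral_density)
    show "AE x in restrict_space lborel (chart_image c). 0 \<le> area_density c G x"
      using det_gram_pos(2)[OF imm c] by (intro AE_I2) (auto simp: space_restrict_space less_imp_le)
  qed auto
  also have "\<dots> = (LINT x|lborel. indicator (chart_image c) x *\<^sub>R (area_density c G x *\<^sub>R h (chart_inv c x)))"
    by (rule integral_restrict_space[OF im])
  finally show ?thesis .
qed

text \<open>Scalar quantities that do not depend on the chart are defined through this arbitrary choice; a lemma
  for each of them then allows any chart around the point.\<close>

definition chart_at :: "'l \<Rightarrow> ('l, 'm) chart" where
  "chart_at p = (SOME c. c \<in> A \<and> p \<in> fst c)"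

lemma chart_at: "p \<in> points A \<Longrightarrow> chart_at p \<in> A" "p \<in> points A \<Longrightarrow> p \<in> fst (chart_at p)"
proof -
  assume "p \<in> points A"
  then have "\<exists>c. c \<in> A \<and> p \<in> fst c" unfolding points_def by blast
  from someI_ex[OF this] show "chart_at p \<in> A" "p \<in> fst (chart_at p)" unfolding chart_at_def by blast+
qed

lemma continuous_on_points:
  "(\<And>c. c \<in> A \<Longrightarrow> continuous_on (fst c) f) \<Longrightarrow> continuous_on (points A) f"
  unfolding points_def by (intro continuous_on_open_UN) (auto simp: chart_open)

text \<open>The area elements of two immersions are densities; their ratio is a function on the manifold.\<close>

definition area_ratio :: "('l \<Rightarrow> complex ^ 'n) \<Rightarrow> ('l \<Rightarrow> complex ^ 'n) \<Rightarrow> 'l \<Rightarrow> real" where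
  "area_ratio G F p = area_density (chart_at p) G (snd (chart_at p) p) / area_density (chart_at p) F (snd (chart_at p) p)"

lemma area_ratio_eq:
  fixes F G :: "'l \<Rightarrow> complex ^ 'n"
  assumes "c \<in> A" "p \<in> fst c" "smooth_map A F" "smooth_map A G"
  shows "area_ratio G F p = area_density c G (snd c p) / area_density c F (snd c p)"
proof -
  have p: "chart_at p \<in> A" "p \<in> fst (chart_at p)"
    using chart_at[OF subsetD[OF chart_subset_points[OF assms(1)] assms(2)]] .
  have "det (transition_matrix (chart_at p) c p) > 0" using transition_smooth(2)[OF p(1) assms(1)] p assms by auto
  then show ?thesis
    unfolding area_ratio_def area_density_change[OF p(1) assms(1) p(2) assms(2,3)]
      area_density_change[OF p(1) assms(1) p(2) assms(2,4)] by simp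
qed

lemma area_ratio_continuous:
  fixes F G :: "'l \<Rightarrow> complex ^ 'n"
  assumes "immersion A F" "immersion A G"
  shows "continuous_on (points A) (area_ratio G F)"
proof (rule continuous_on_points)
  fix c assume c: "c \<in> A"
  note sm = immersion_smooth_map[OF assms(1)] immersion_smooth_map[OF assms(2)]
  have "continuous_on (fst c) (\<lambda>p. area_density c G (snd c p) / area_density c F (snd c p))"
    using det_gram_pos(2)[OF assms(1) c] less_imp_neq
    by (intro continuous_on_divide continuous_on_compose2[OF area_density_continuous[OF sm(1) c]]
        continuous_on_compose2[OF area_density_continuous[OF sm(2) c]] chart_continuous(1)[OF c]) fastforce+
  then show "continuous_on (fst c) (area_ratio G F)"
    by (rule continuous_on_eq) (use area_ratio_eq[OF c _ sm] in auto)
qed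

lemma area_ratio_pos:
  fixes F G :: "'l \<Rightarrow> complex ^ 'n"
  assumes "immersion A F" "immersion A G" "p \<in> points A"
  shows "area_ratio G F p > 0"
  unfolding area_ratio_def
  using det_gram_pos(2)[OF assms(1) chart_at(1)[OF assms(3)]] det_gram_pos(2)[OF assms(2) chart_at(1)[OF assms(3)]]
    chart_at(2)[OF assms(3)] by simp

text \<open>This turns volumes of varying immersions into integrals against one fixed measure, so that only the
  integrand depends on time.\<close>

lemma volume_measure_change:
  fixes F G :: "'l \<Rightarrow> complex ^ 'n"
  assumes ne: "A \<noteq> {}" and F: "immersion A F" and G: "immersion A G"
  shows "volume_measure A G = density (volume_measure A F) (\<lambda>p. ennreal (area_ratio G F p))"
proof (rule volume_measure_eq[OF ne])
  let ?\<mu> = "volume_measure A F"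
  note s = sets_volume_measure(1)[OF ne F]
  have rm': "area_ratio G F \<in> borel_measurable space_algebra"
    by (rule borel_measurable_continuous_on_restrict[OF area_ratio_continuous[OF F G]])
  then have [measurable]: "area_ratio G F \<in> borel_measurable ?\<mu>" by (simp add: sets_volume_measure(3)[OF ne F])
  show "is_volume (density ?\<mu> (\<lambda>p. ennreal (area_ratio G F p))) G"
    unfolding is_volume_def
  proof (intro conjI ballI impI)
    show "sets (density ?\<mu> (\<lambda>p. ennreal (area_ratio G F p))) = sets space_algebra" using s by simp
    fix c B assume c: "c \<in> A" and B: "B \<in> sets borel" "B \<subseteq> fst c"
    have B': "B \<in> sets space_algebra" using B chart_subset_points[OF c] by (auto simp: sets_space_algebra)
    then have [measurable]: "B \<in> sets ?\<mu>" using s by simp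
    have "emeasure (density ?\<mu> (\<lambda>p. ennreal (area_ratio G F p))) B = (\<integral>\<^sup>+p. ennreal (area_ratio G F p) * indicator B p \<partial>?\<mu>)"
      by (rule emeasure_density) auto
    also have "\<dots> = (\<integral>\<^sup>+x. ennreal (area_density c F x) * (ennreal (area_ratio G F (chart_inv c x)) * indicator B (chart_inv c x))
        * indicator (chart_image c) x \<partial>lborel)"
      by (rule nn_integral_chart[OF ne F c]) (use rm' B' B in \<open>auto simp: indicator_def\<close>)
    also have "\<dots> = (\<integral>\<^sup>+x\<in>snd c ` B. ennreal (area_density c G x) \<partial>lborel)"
    proof (rule nn_integral_cong)
      fix x
      have im: "x \<in> snd c ` B \<longleftrightarrow> x \<in> chart_image c \<and> chart_inv c x \<in> B"
        using chart_image_eq_vimage[OF c, of B] B(2) by (auto simp: Int_absorb1)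
      have "ennreal (area_density c F x) * ennreal (area_ratio G F (chart_inv c x)) = ennreal (area_density c G x)"
        if x: "x \<in> chart_image c"
        using area_ratio_eq[OF c chart_inv_simps(3)[OF x] immersion_smooth_map[OF F] immersion_smooth_map[OF G]]
          det_gram_pos(2)[OF F c x] det_gram_pos(2)[OF G c x] chart_inv_simps(2)[OF x]
        by (simp flip: ennreal_mult)
      then show "ennreal (area_density c F x) * (ennreal (area_ratio G F (chart_inv c x)) * indicator B (chart_inv c x))
        * indicator (chart_image c) x = ennreal (area_density c G x) * indicator (snd c ` B) x"
        by (auto simp: indicator_def im)
    qed
    finally show "emeasure (density ?\<mu> (\<lambda>p. ennreal (area_ratio G F p))) B
      = (\<integral>\<^sup>+x\<in>snd c ` B. ennreal (area_density c G x) \<partial>lborel)" .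
  qed
qed

lemma chart_ball:
  assumes "c \<in> A" "p \<in> fst c"
  obtains r where "r > 0" "cball (snd c p) r \<subseteq> chart_image c"
  using assms chart_open(2)[OF assms(1)] open_contains_cball[of "chart_image c"] by blast

lemma chart_ball_preimage:
  assumes c: "c \<in> A"
  shows "open (fst c \<inter> snd c -` ball x r)"
    and "cball x r \<subseteq> chart_image c \<Longrightarrow> compact (chart_inv c ` cball x r)"
    and "cball x r \<subseteq> chart_image c \<Longrightarrow> chart_inv c ` cball x r = fst c \<inter> snd c -` cball x r"
    and "cball x r \<subseteq> chart_image c \<Longrightarrow> snd c ` chart_inv c ` cball x r = cball x r"
proof -
  show "open (fst c \<inter> snd c -` ball x r)"
    by (rule continuous_open_preimage[OF chart_continuous(1)[OF c] chart_open(1)[OF c]]) simp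
  assume r: "cball x r \<subseteq> chart_image c"
  show "compact (chart_inv c ` cball x r)"
    by (rule compact_continuous_image[OF continuous_on_subset[OF chart_continuous(2)[OF c] r]]) simp
  show "chart_inv c ` cball x r = fst c \<inter> snd c -` cball x r"
  proof (intro equalityI subsetI)
    fix p assume "p \<in> chart_inv c ` cball x r"
    then obtain y where "p = chart_inv c y" "y \<in> cball x r" by auto
    then show "p \<in> fst c \<inter> snd c -` cball x r" using chart_inv_simps(2,3)[of y c] r by auto
  next
    fix p assume p: "p \<in> fst c \<inter> snd c -` cball x r"
    then show "p \<in> chart_inv c ` cball x r"
      using chart_inv_simps(1)[OF c, of p] by (intro image_eqI[of _ _ "snd c p"]) auto
  qed
  show "snd c ` chart_inv c ` cball x r = cball x r"
    unfolding image_image using r chart_inv_simps(2) by (auto simp: image_iff subset_eq) 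
qed

text \<open>A compact set is covered by finitely many preimages of balls with closure in a chart, on which the
  density is bounded.\<close>

lemma volume_finite_on_compact:
  fixes F :: "'l \<Rightarrow> complex ^ 'n"
  assumes ne: "A \<noteq> {}" and F: "immersion A F" and K: "compact K" "K \<subseteq> points A"
  shows "emeasure (volume_measure A F) K < \<infinity>"
proof -
  let ?\<mu> = "volume_measure A F"
  have vol: "is_volume ?\<mu> F" by (rule is_volume_volume_measure[OF ne F])
  have "\<exists>V. open V \<and> p \<in> V \<and> V \<subseteq> points A \<and> emeasure ?\<mu> V < \<infinity>" if p: "p \<in> K" for p
  proof -
    have c: "chart_at p \<in> A" "p \<in> fst (chart_at p)" using chart_at K p by auto
    let ?c = "chart_at p"
    obtain r where r: "r > 0" "cball (snd ?c p) r \<subseteq> chart_image ?c" using chart_ball[OF c] by blast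
    let ?V = "fst ?c \<inter> snd ?c -` ball (snd ?c p) r" and ?C = "cball (snd ?c p) r"
    let ?W = "chart_inv ?c ` ?C"
    have W: "?W \<in> sets borel" "?W \<subseteq> fst ?c"
      using compact_imp_closed[OF chart_ball_preimage(2)[OF c(1) r(2)]] chart_ball_preimage(3)[OF c(1) r(2)] by auto
    obtain b where b: "\<And>x. x \<in> ?C \<Longrightarrow> area_density ?c F x \<le> b"
    proof -
      have "compact (area_density ?c F ` ?C)"
        by (rule compact_continuous_image[OF continuous_on_subset[OF area_density_continuous[OF immersion_smooth_map[OF F] c(1)] r(2)]]) simp
      then have "bdd_above (area_density ?c F ` ?C)" by (intro bounded_imp_bdd_above compact_imp_bounded)
      then obtain M where "\<forall>y\<in>area_density ?c F ` ?C. y \<le> M" unfolding bdd_above_def by blast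
      then show ?thesis by (intro that[of M]) blast
    qed
    have "emeasure ?\<mu> ?W = (\<integral>\<^sup>+x\<in>?C. ennreal (area_density ?c F x) \<partial>lborel)"
    proof -
      have "emeasure ?\<mu> ?W = (\<integral>\<^sup>+x\<in>snd ?c ` ?W. ennreal (area_density ?c F x) \<partial>lborel)"
        using vol c(1) W unfolding is_volume_def by blast
      then show ?thesis unfolding chart_ball_preimage(4)[OF c(1) r(2)] .
    qed
    also have "\<dots> \<le> (\<integral>\<^sup>+x. ennreal b * indicator ?C x \<partial>lborel)"
    proof (rule nn_integral_mono)
      fix x
      show "ennreal (area_density ?c F x) * indicator ?C x \<le> ennreal b * indicator ?C x"
        using b[of x] by (cases "x \<in> ?C") (auto intro: ennreal_leI)
    qed
    also have "\<dots> = ennreal b * emeasure lborel ?C" by (rule nn_integral_cmult_indicator) simp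
    also have "\<dots> < \<infinity>" using emeasure_bounded_finite[of ?C] by (simp add: ennreal_mult_less_top)
    finally have "emeasure ?\<mu> ?W < \<infinity>" .
    moreover have "emeasure ?\<mu> ?V \<le> emeasure ?\<mu> ?W"
    proof (rule emeasure_mono)
      show "?V \<subseteq> ?W" unfolding chart_ball_preimage(3)[OF c(1) r(2)] by auto
      show "?W \<in> sets ?\<mu>"
        using vol W chart_subset_points[OF c(1)] by (auto simp: is_volume_def sets_space_algebra)
    qed
    ultimately show ?thesis
      using chart_ball_preimage(1)[OF c(1), of "snd ?c p" r] c r(1) chart_subset_points[OF c(1)]
      by (intro exI[of _ ?V]) auto
  qed
  then obtain V where V: "\<And>p. p \<in> K \<Longrightarrow> open (V p) \<and> p \<in> V p \<and> V p \<subseteq> points A \<and> emeasure ?\<mu> (V p) < \<infinity>"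
    by metis
  obtain D where D: "D \<subseteq> K" "finite D" "K \<subseteq> (\<Union>p\<in>D. V p)"
    using compactE_image[OF K(1), of K V] V by (metis UN_iff subsetI)
  have Vs: "V p \<in> sets ?\<mu>" if "p \<in> D" for p
    using V[of p] D(1) that vol by (auto simp: is_volume_def sets_space_algebra)
  have "emeasure ?\<mu> K \<le> emeasure ?\<mu> (\<Union>p\<in>D. V p)"
    by (rule emeasure_mono[OF D(3)]) (use D(2) Vs in auto)
  also have "\<dots> \<le> (\<Sum>p\<in>D. emeasure ?\<mu> (V p))"
    by (rule emeasure_subadditive_finite) (use D(2) Vs in auto)
  also have "\<dots> < \<infinity>" using V D by (auto simp: less_top[symmetric])
  finally show ?thesis .
qed

lemma sets_volume:
  fixes F :: "'l \<Rightarrow> complex ^ 'n"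
  assumes ne: "A \<noteq> {}" and F: "immersion A F" and K: "compact K" "K \<subseteq> points A"
  shows "K \<in> sets (volume_measure A F)"
    "sets (restrict_space (volume_measure A F) K) = sets (restrict_space borel K)"
proof -
  note s = sets_volume_measure(1)[OF ne F]
  show "K \<in> sets (volume_measure A F)"
    unfolding s sets_space_algebra using K compact_imp_closed borel_closed by blast
  show "sets (restrict_space (volume_measure A F) K) = sets (restrict_space borel K)"
    unfolding sets_restrict_space_cong[OF s] sets_restrict_restrict_space using K(2) by (simp add: Int_absorb1)
qed

end

section \<open>Continuously differentiable bump functions on a manifold\<close>

definition C1_on :: "'a::real_normed_vector set \<Rightarrow> ('a \<Rightarrow> real) \<Rightarrow> bool" where
  "C1_on S f \<longleftrightarrow> (\<forall>x\<in>S. f differentiable (at x)) \<and>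
     (\<forall>v. continuous_on S (\<lambda>x. frechet_derivative f (at x) v))"

lemma C1_onI:
  assumes "\<And>x. x \<in> S \<Longrightarrow> (f has_derivative f' x) (at x)" "\<And>v. continuous_on S (\<lambda>x. f' x v)"
  shows "C1_on S f"
proof -
  have "frechet_derivative f (at x) = f' x" if "x \<in> S" for x
    using frechet_derivative_at[OF assms(1)[OF that]] by simp
  then have "continuous_on S (\<lambda>x. frechet_derivative f (at x) v)" for v
    using continuous_on_eq[OF assms(2)[of v]] by simp
  then show ?thesis using assms(1) unfolding C1_on_def differentiable_def by blast
qed

lemma C1_onD:
  assumes "C1_on S f"
  shows "x \<in> S \<Longrightarrow> (f has_derivative frechet_derivative f (at x)) (at x)"
    "continuous_on S (\<lambda>x. frechet_derivative f (at x) v)" "continuous_on S f"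
proof -
  show d: "x \<in> S \<Longrightarrow> (f has_derivative frechet_derivative f (at x)) (at x)" for x
    using assms by (simp add: C1_on_def frechet_derivative_works[symmetric])
  show "continuous_on S (\<lambda>x. frechet_derivative f (at x) v)" using assms by (simp add: C1_on_def)
  show "continuous_on S f"
    by (rule has_derivative_continuous_on[OF has_derivative_at_withinI[OF d]])
qed

lemma C1_on_const: "C1_on S (\<lambda>x. c)"
  by (rule C1_onI[of _ _ "\<lambda>_ _. 0"]) auto

lemma C1_on_diff: "C1_on S f \<Longrightarrow> C1_on S g \<Longrightarrow> C1_on S (\<lambda>x. f x - g x)"
  by (rule C1_onI[of _ _ "\<lambda>x v. frechet_derivative f (at x) v - frechet_derivative g (at x) v"])
     (auto intro!: has_derivative_diff continuous_intros dest: C1_onD)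

lemma C1_on_mult: "C1_on S f \<Longrightarrow> C1_on S g \<Longrightarrow> C1_on S (\<lambda>x. f x * g x)"
  by (rule C1_onI[of _ _ "\<lambda>x v. f x * frechet_derivative g (at x) v + frechet_derivative f (at x) v * g x"])
     (auto intro!: has_derivative_mult continuous_intros dest: C1_onD)

text \<open>Differentiability and the derivative at a point depend only on a neighbourhood, so functions may be
  glued from local pieces.\<close>

lemma C1_on_local:
  assumes "\<And>x. x \<in> S \<Longrightarrow> \<exists>U g. open U \<and> x \<in> U \<and> C1_on U g \<and> (\<forall>y\<in>U. f y = g y)"
  shows "C1_on S f"
proof -
  have *: "f differentiable (at x) \<and> isCont (\<lambda>x. frechet_derivative f (at x) v) x" if x: "x \<in> S" for x v
  proof -
    obtain U g where U: "open U" "x \<in> U" "C1_on U g" "\<And>y. y \<in> U \<Longrightarrow> f y = g y" using assms[OF x] by metis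
    have d: "(f has_derivative frechet_derivative g (at y)) (at y)" if "y \<in> U" for y
      by (rule has_derivative_transform_within_open[OF C1_onD(1)[OF U(3) that] U(1) that]) (simp add: U(4))
    then have eq: "frechet_derivative f (at y) = frechet_derivative g (at y)" if "y \<in> U" for y
      using frechet_derivative_at that by metis
    have "continuous_on U (\<lambda>x. frechet_derivative f (at x) v)"
      by (rule continuous_on_eq[OF C1_onD(2)[OF U(3), of v]]) (simp add: eq)
    then have "isCont (\<lambda>x. frechet_derivative f (at x) v) x"
      using U(1,2) by (simp add: continuous_on_eq_continuous_at)
    then show ?thesis using d[OF U(2)] by (auto simp: differentiable_def)
  qed
  then show ?thesis unfolding C1_on_def by (auto intro: continuous_at_imp_continuous_on)
qed

text \<open>The positive part squared is the simplest continuously differentiable function that vanishes on a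
  half line; bump functions with one continuous derivative suffice for a partition of unity.\<close>

definition ramp_square :: "real \<Rightarrow> real" where
  "ramp_square u = (max 0 u)\<^sup>2"

lemma ramp_square_derivative: "(ramp_square has_real_derivative 2 * max 0 u) (at u)"
proof -
  consider "u > 0" | "u < 0" | "u = 0" by linarith
  then show ?thesis
  proof cases
    case 1
    have "((\<lambda>u. u\<^sup>2) has_real_derivative 2 * max 0 u) (at u)"
      using 1 by (auto intro!: derivative_eq_intros)
    then show ?thesis
      by (rule has_field_derivative_transform_within_open[of _ _ _ "{0<..}"]) (use 1 in \<open>auto simp: ramp_square_def\<close>)
  next
    case 2
    have "((\<lambda>u. 0) has_real_derivative 2 * max 0 u) (at u)" using 2 by simp
    then show ?thesis
      by (rule has_field_derivative_transform_within_open[of _ _ _ "{..<0}"]) (use 2 in \<open>auto simp: ramp_square_def\<close>)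
  next
    case 3
    have "((\<lambda>h. max 0 h) \<longlongrightarrow> max 0 0) (at (0::real))" by (intro tendsto_intros)
    moreover have "\<forall>\<^sub>F h in at (0::real). max 0 h = (ramp_square (0 + h) - ramp_square 0) / h"
      unfolding eventually_at_filter by (rule always_eventually) (auto simp: ramp_square_def power2_eq_square max_def)
    ultimately have "((\<lambda>h. (ramp_square (0 + h) - ramp_square 0) / h) \<longlongrightarrow> max 0 0) (at 0)"
      by (rule Lim_transform_eventually)
    then show ?thesis using 3 by (simp add: DERIV_def)
  qed
qed

text \<open>The inner ramp is \<open>0\<close> up to radius \<open>r / 2\<close>. At radius \<open>r\<close> it is \<open>9 / 16\<close>, so that with the factor \<open>2\<close> the
  argument of the outer ramp is negative from there on.\<close>

definition radial_bump :: "'a::real_inner \<Rightarrow> real \<Rightarrow> 'a \<Rightarrow> real" where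
  "radial_bump a r x = ramp_square (1 - 2 * ramp_square ((inverse r * norm (x - a))\<^sup>2 - 1 / 4))"

lemma radial_bump_inside:
  assumes "r > 0" "x \<in> ball a (r / 2)" shows "radial_bump a r x = 1"
proof -
  have "inverse r * norm (x - a) \<le> 1 / 2" using assms by (simp add: dist_norm norm_minus_commute field_simps)
  then have "(inverse r * norm (x - a))\<^sup>2 \<le> (1 / 2)\<^sup>2" using assms(1) by (intro power_mono) auto
  then have "max 0 ((inverse r * norm (x - a))\<^sup>2 - 1 / 4) = 0" by (simp add: power2_eq_square)
  then show ?thesis by (simp add: radial_bump_def ramp_square_def)
qed

lemma radial_bump_outside:
  assumes "r > 0" "x \<notin> cball a r" shows "radial_bump a r x = 0"
proof -
  have "inverse r * norm (x - a) \<ge> 1" using assms by (simp add: dist_norm norm_minus_commute field_simps)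
  then have "(inverse r * norm (x - a))\<^sup>2 \<ge> 1" by (simp add: one_le_power)
  then have "3 / 4 \<le> max 0 ((inverse r * norm (x - a))\<^sup>2 - 1 / 4)" by (simp only: le_max_iff_disj) simp
  then have "(3 / 4)\<^sup>2 \<le> (max 0 ((inverse r * norm (x - a))\<^sup>2 - 1 / 4))\<^sup>2" by (rule power_mono) simp
  then show ?thesis unfolding radial_bump_def ramp_square_def by (simp add: power2_eq_square)
qed

definition radial_bump_slope :: "'a::real_inner \<Rightarrow> real \<Rightarrow> 'a \<Rightarrow> real" where
  "radial_bump_slope a r x = - 16 * max 0 (1 - 2 * ramp_square ((inverse r * norm (x - a))\<^sup>2 - 1 / 4)) *
     max 0 ((inverse r * norm (x - a))\<^sup>2 - 1 / 4) * (inverse r)\<^sup>2"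

lemma radial_bump_derivative:
  "(radial_bump a r has_derivative (\<lambda>v. radial_bump_slope a r x * ((x - a) \<bullet> v))) (at x)"
proof -
  define s where "s x = (inverse r * norm (x - a))\<^sup>2 - 1 / 4" for x
  define q where "q u = ramp_square (1 - 2 * ramp_square u)" for u
  have s_eq: "s = (\<lambda>x. (inverse r)\<^sup>2 * ((x - a) \<bullet> (x - a)) - 1 / 4)"
    by (auto simp: s_def power_mult_distrib dot_square_norm)
  have "(s has_derivative (\<lambda>v. 2 * ((x - a) \<bullet> v) * (inverse r)\<^sup>2)) (at x)"
    unfolding s_eq by (auto intro!: derivative_eq_intros simp: inner_commute algebra_simps)
  moreover have "(q has_real_derivative 2 * max 0 (1 - 2 * ramp_square u) * (- (2 * (2 * max 0 u)))) (at u)" for u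
  proof -
    have "((\<lambda>u. 1 - 2 * ramp_square u) has_real_derivative - (2 * (2 * max 0 u))) (at u)"
      using ramp_square_derivative by (auto intro!: derivative_eq_intros)
    from DERIV_chain2[OF ramp_square_derivative this] show ?thesis by (simp add: q_def[abs_def])
  qed
  then have "(q has_derivative (*) (2 * max 0 (1 - 2 * ramp_square (s x)) * (- (2 * (2 * max 0 (s x)))))) (at (s x))"
    by (simp add: has_field_derivative_def)
  ultimately have "((\<lambda>x. q (s x)) has_derivative
      (\<lambda>v. 2 * max 0 (1 - 2 * ramp_square (s x)) * (- (2 * (2 * max 0 (s x)))) * (2 * ((x - a) \<bullet> v) * (inverse r)\<^sup>2))) (at x)"
    by (rule has_derivative_compose[where f=s and g=q])
  then show ?thesis
    by (simp add: q_def s_def radial_bump_def[abs_def] radial_bump_slope_def mult_ac)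
qed

lemma radial_bump_slope_continuous: "continuous_on S (radial_bump_slope a r)"
  unfolding radial_bump_slope_def[abs_def] ramp_square_def by (intro continuous_intros)

context oriented_manifold
begin

definition C1_map :: "('l \<Rightarrow> real) \<Rightarrow> bool" where
  "C1_map f \<longleftrightarrow> (\<forall>c\<in>A. C1_on (chart_image c) (local_rep c f))"

lemma C1_map_const: "C1_map (\<lambda>p. k)"
proof -
  have "local_rep c (\<lambda>p. k) = (\<lambda>x. k)" for c :: "('l, 'm) chart" by (auto simp: local_rep_def)
  then show ?thesis by (simp add: C1_map_def C1_on_const)
qed

lemma C1_map_diff: "C1_map f \<Longrightarrow> C1_map g \<Longrightarrow> C1_map (\<lambda>p. f p - g p)"
  using C1_on_diff by (fastforce simp: C1_map_def local_rep_def o_def)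

lemma C1_map_mult: "C1_map f \<Longrightarrow> C1_map g \<Longrightarrow> C1_map (\<lambda>p. f p * g p)"
  using C1_on_mult by (fastforce simp: C1_map_def local_rep_def o_def)

lemma C1_map_continuous:
  assumes "C1_map f" shows "continuous_on (points A) f"
proof (rule continuous_on_points)
  fix c assume c: "c \<in> A"
  have "continuous_on (fst c) (\<lambda>p. local_rep c f (snd c p))"
    by (rule continuous_on_compose2[OF C1_onD(3)]) (use assms c chart_continuous in \<open>auto simp: C1_map_def\<close>)
  then show "continuous_on (fst c) f"
    by (rule continuous_on_eq) (simp add: local_rep_def chart_inv_simps(1)[OF c])
qed

text \<open>Extended by zero outside the chart, a bump remains continuously differentiable in all other charts:
  its support is compact, hence closed in the Hausdorff space of points.\<close>

lemma chart_bump: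
  assumes c: "c \<in> A" and r: "r > 0" "cball a r \<subseteq> chart_image c"
  obtains \<eta> where "C1_map \<eta>" "\<And>p. p \<notin> chart_inv c ` cball a r \<Longrightarrow> \<eta> p = 0"
    "\<And>p. p \<in> fst c \<Longrightarrow> snd c p \<in> ball a (r / 2) \<Longrightarrow> \<eta> p = 1"
proof -
  define \<eta> where "\<eta> p = (if p \<in> fst c then radial_bump a r (snd c p) else 0)" for p
  let ?C = "chart_inv c ` cball a r"
  have out: "\<eta> p = 0" if "p \<notin> ?C" for p
    using that chart_ball_preimage(3)[OF c r(2)] radial_bump_outside[OF r(1)] by (auto simp: \<eta>_def)
  have clC: "closed ?C" by (rule compact_imp_closed[OF chart_ball_preimage(2)[OF c r(2)]])
  have "C1_map \<eta>" unfolding C1_map_def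
  proof (intro ballI C1_on_local)
    fix d x assume d: "d \<in> A" and x: "x \<in> chart_image d"
    let ?\<tau> = "snd c \<circ> chart_inv d"
    let ?U = "snd d ` (fst d \<inter> fst c)" and ?V = "snd d ` (fst d \<inter> - ?C)"
    show "\<exists>U g. open U \<and> x \<in> U \<and> C1_on U g \<and> (\<forall>y\<in>U. local_rep d \<eta> y = g y)"
    proof (cases "x \<in> ?U")
      case True
      have dt: "(?\<tau> has_derivative frechet_derivative ?\<tau> (at y)) (at y)" if "y \<in> ?U" for y
        using smooth_on_differentiable[OF transition_smooth(1)[OF d c] that] by (simp add: frechet_derivative_works[symmetric])
      have ct: "continuous_on ?U ?\<tau>" by (rule smooth_on_continuous[OF transition_smooth(1)[OF d c]])
      have "C1_on ?U (\<lambda>y. radial_bump a r (?\<tau> y))"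
      proof (rule C1_onI)
        show "((\<lambda>y. radial_bump a r (?\<tau> y)) has_derivative
            (\<lambda>v. radial_bump_slope a r (?\<tau> y) * ((?\<tau> y - a) \<bullet> frechet_derivative ?\<tau> (at y) v))) (at y)" if "y \<in> ?U" for y
          by (rule has_derivative_compose[OF dt[OF that] radial_bump_derivative])
        show "continuous_on ?U (\<lambda>y. radial_bump_slope a r (?\<tau> y) * ((?\<tau> y - a) \<bullet> frechet_derivative ?\<tau> (at y) v))" for v
          by (intro continuous_intros ct smooth_on_continuous smooth_on_deriv transition_smooth(1)[OF d c]
              continuous_on_compose2[OF radial_bump_slope_continuous[of UNIV] ct]) auto
      qed
      moreover have "local_rep d \<eta> y = radial_bump a r (?\<tau> y)" if "y \<in> ?U" for y
        using that chart_inv_simps(1)[OF d] by (auto simp: local_rep_def \<eta>_def)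
      ultimately show ?thesis
        using True chart_image_inter_open[OF d chart_open(1)[OF c]] by blast
    next
      case False
      have "?C \<subseteq> fst c" using chart_ball_preimage(3)[OF c r(2)] by auto
      then have "x \<in> ?V" using False x by blast
      moreover have "open ?V" using chart_image_inter_open[OF d, of "- ?C"] clC by (simp add: open_Compl)
      moreover have "local_rep d \<eta> y = 0" if "y \<in> ?V" for y
        using that chart_inv_simps(1)[OF d] out by (auto simp: local_rep_def)
      ultimately show ?thesis using C1_on_const by blast
    qed
  qed
  then show ?thesis
    by (rule that) (use out radial_bump_inside[OF r(1)] in \<open>auto simp: \<eta>_def\<close>)
qed

end

section \<open>The phase of a Lagrangian frame\<close>

lemma has_vector_derivative_norm:
  fixes f :: "real \<Rightarrow> complex"
  assumes "(f has_vector_derivative f') (at t)" "f t \<noteq> 0"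
  shows "((\<lambda>s. of_real (norm (f s)) :: complex) has_vector_derivative of_real (Re (f' / f t) * norm (f t))) (at t)"
proof -
  have "((\<lambda>s. norm (f s)) has_derivative (\<lambda>h. (h *\<^sub>R f') \<bullet> sgn (f t))) (at t)"
    using has_derivative_compose[OF assms(1)[unfolded has_vector_derivative_def] has_derivative_norm[OF assms(2)]] .
  moreover have "f' \<bullet> sgn (f t) = Re (f' / f t) * norm (f t)"
  proof -
    have "f' \<bullet> sgn (f t) = Re (f' * cnj (f t)) / norm (f t)"
      by (simp add: inner_complex_def sgn_div_norm divide_inverse algebra_simps)
    also have "\<dots> = Re (f' / f t) * norm (f t)"
    proof -
      have "f' / f t = f' * cnj (f t) / of_real ((norm (f t))\<^sup>2)"
        by (subst complex_div_cnj) simp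
      then have "Re (f' / f t) = Re (f' * cnj (f t)) / (norm (f t))\<^sup>2"
        by (simp only: Re_divide_of_real)
      then show ?thesis using assms(2) by (simp add: power2_eq_square)
    qed
    finally show ?thesis .
  qed
  ultimately have "((\<lambda>s. norm (f s)) has_vector_derivative (Re (f' / f t) * norm (f t))) (at t)"
    by (simp add: has_vector_derivative_def)
  then show ?thesis by (rule bounded_linear.has_vector_derivative[OF bounded_linear_of_real])
qed

text \<open>In a frame with real Hermitian products the complex coordinates of a vector are obtained from its
  products with the frame by the inverse Gram matrix.\<close>

lemma coefficients_from_gram:
  fixes g ginv :: "real ^ 'n ^ 'n" and c h :: "'n \<Rightarrow> complex"
  assumes "g ** ginv = mat 1" "\<And>l. h l = (\<Sum>k\<in>UNIV. c k * of_real (g $ k $ l))"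
  shows "c j = (\<Sum>l\<in>UNIV. h l * of_real (ginv $ l $ j))"
proof -
  have "(\<Sum>l\<in>UNIV. h l * of_real (ginv $ l $ j)) = (\<Sum>k\<in>UNIV. \<Sum>l\<in>UNIV. c k * of_real (g $ k $ l) * of_real (ginv $ l $ j))"
    unfolding assms(2) sum_distrib_right by (rule sum.swap)
  also have "\<dots> = (\<Sum>k\<in>UNIV. c k * of_real ((g ** ginv) $ k $ j))"
    by (simp add: matrix_matrix_mult_def sum_distrib_left mult.assoc)
  also have "\<dots> = c j"
  proof -
    have "c k * of_real ((g ** ginv) $ k $ j) = (if k = j then c k else 0)" for k
      by (simp add: assms(1) mat_def)
    then show ?thesis by simp
  qed
  finally show ?thesis by simp
qed

context oriented_manifold
begin

lemma local_rep_differentiable: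
  assumes "smooth_map A G" "c \<in> A" "x \<in> chart_image c"
  shows "local_rep c G differentiable (at x)"
  by (rule smooth_on_differentiable[OF smooth_map_local[OF assms(1,2)] assms(3)])

lemma partial_in_tangent_space:
  fixes G :: "'l \<Rightarrow> complex ^ 'n"
  shows "partial i (local_rep c G) (snd c p) \<in> tangent_space c G p"
  unfolding tangent_space_def partial_def by auto

text \<open>The decomposition exists and is unique because the tangent space is a linear subspace.\<close>

lemma normal_part:
  fixes G :: "'l \<Rightarrow> complex ^ 'n"
  assumes "smooth_map A G" "c \<in> A" "p \<in> fst c"
  shows "normal_part c G p v \<in> normal_space c G p" "v - normal_part c G p v \<in> tangent_space c G p"
    and "w \<in> normal_space c G p \<Longrightarrow> v - w \<in> tangent_space c G p \<Longrightarrow> normal_part c G p v = w"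
proof -
  let ?T = "tangent_space c G p"
  have "linear (frechet_derivative (local_rep c G) (at (snd c p)))"
    by (rule linear_frechet_derivative[OF local_rep_differentiable[OF assms(1,2)]]) (use assms(3) in auto)
  then have sub: "subspace ?T" unfolding tangent_space_def by (rule linear_subspace_image) simp
  have uniq: "w = w'" if "w \<in> normal_space c G p" "v - w \<in> ?T" "w' \<in> normal_space c G p" "v - w' \<in> ?T" for w w'
  proof -
    have "w - w' \<in> normal_space c G p"
      using subspace_diff[OF subspace_orthogonal_comp] that unfolding normal_space_def by blast
    moreover have "w - w' \<in> ?T" using subspace_diff[OF sub that(4,2)] by (simp add: algebra_simps)
    ultimately have "(w - w') \<bullet> (w - w') = 0" by (auto simp: normal_space_def orthogonal_comp_def orthogonal_def)
    then show ?thesis by simp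
  qed
  obtain y z where yz: "y \<in> span ?T" "\<And>w. w \<in> span ?T \<Longrightarrow> orthogonal z w" "v = y + z"
    using orthogonal_subspace_decomp_exists[of ?T v] by blast
  have "z \<in> normal_space c G p" "v - z \<in> ?T"
    using yz sub by (auto simp: normal_space_def orthogonal_comp_def orthogonal_commute span_eq_iff[THEN iffD2])
  then have "\<exists>!w. w \<in> normal_space c G p \<and> v - w \<in> ?T" using uniq by blast
  from theI'[OF this] show "normal_part c G p v \<in> normal_space c G p" "v - normal_part c G p v \<in> ?T"
    unfolding normal_part_def by auto
  then show "w \<in> normal_space c G p \<Longrightarrow> v - w \<in> ?T \<Longrightarrow> normal_part c G p v = w"
    using uniq by blast
qed

lemma normal_part_scaleR:
  fixes G :: "'l \<Rightarrow> complex ^ 'n"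
  assumes "smooth_map A G" "c \<in> A" "p \<in> fst c"
  shows "normal_part c G p (r *\<^sub>R v) = r *\<^sub>R normal_part c G p v"
proof (rule normal_part(3)[OF assms])
  show "r *\<^sub>R normal_part c G p v \<in> normal_space c G p"
    using normal_part(1)[OF assms, of v] subspace_scale[OF subspace_orthogonal_comp] unfolding normal_space_def by blast
  have "linear (frechet_derivative (local_rep c G) (at (snd c p)))"
    by (rule linear_frechet_derivative[OF local_rep_differentiable[OF assms(1,2)]]) (use assms(3) in auto)
  then have sub: "subspace (tangent_space c G p)" unfolding tangent_space_def by (rule linear_subspace_image) simp
  show "r *\<^sub>R v - r *\<^sub>R normal_part c G p v \<in> tangent_space c G p"
    using subspace_scale[OF sub normal_part(2)[OF assms, of v], of r] by (simp add: scaleR_diff_right)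
qed

end

locale lagrangian_submanifold = oriented_manifold A
  for A :: "('l::{t2_space, second_countable_topology}, 'm::finite) chart set" +
  fixes F :: "'l \<Rightarrow> complex ^ 'm"
  assumes lagrangian: "lagrangian A F"
begin

lemma immersion_F: "immersion A F" and smooth_F: "smooth_map A F"
  using lagrangian by (auto simp: lagrangian_def immersion_def)

text \<open>The imaginary part of the Hermitian product is the Kaehler form up to sign.\<close>

lemma herm_frame_real:
  assumes c: "c \<in> A" "x \<in> chart_image c"
  shows "Im (herm (frame c F x $ i) (frame c F x $ j)) = 0"
    "herm (frame c F x $ i) (frame c F x $ j) = of_real (gram c F x $ i $ j)"
proof -
  let ?p = "chart_inv c x"
  have p: "?p \<in> fst c" "snd c ?p = x" using chart_inv_simps(2,3)[OF c(2)] by auto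
  have t: "frame c F x $ i \<in> tangent_space c F ?p" for i
    using partial_in_tangent_space[of i c F ?p] p by (simp add: frame_def)
  show 1: "Im (herm (frame c F x $ i) (frame c F x $ j)) = 0"
    using lagrangian c(1) p(1) t unfolding lagrangian_def Im_herm_kaehler by simp
  show "herm (frame c F x $ i) (frame c F x $ j) = of_real (gram c F x $ i $ j)"
    by (rule complex_eqI) (use 1 in \<open>simp_all add: Re_herm gram_eq_real_gram real_gram_def\<close>)
qed

lemma norm_det_frame:
  assumes "c \<in> A" "x \<in> chart_image c"
  shows "norm (det (frame c F x)) = area_density c F x" "det (frame c F x) \<noteq> 0"
proof -
  show 1: "norm (det (frame c F x)) = area_density c F x"
    unfolding area_density_def gram_eq_real_gram
    by (rule norm_det_eq_sqrt_gram) (rule herm_frame_real(1)[OF assms])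
  show "det (frame c F x) \<noteq> 0"
    using 1 det_gram_pos(2)[OF immersion_F assms] by auto
qed

text \<open>Multiplication by \<open>\<i>\<close> maps tangent vectors of a Lagrangian submanifold onto the normal vectors: a
  vector is a complex combination of the frame, and it is orthogonal to the frame iff the real parts of
  its coefficients vanish.\<close>

lemma normal_coordinates:
  assumes c: "c \<in> A" "p \<in> fst c" and \<xi>: "\<xi> \<in> normal_space c F p"
  obtains X :: "'m \<Rightarrow> real" where "\<xi> = (\<Sum>k\<in>UNIV. (\<i> * of_real (X k)) *s (frame c F (snd c p) $ k))"
proof -
  let ?M = "frame c F (snd c p)" and ?g = "gram c F (snd c p)"
  have x: "snd c p \<in> chart_image c" using c by auto
  obtain z where z: "\<xi> = (\<Sum>k\<in>UNIV. z k *s (?M $ k))"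
    using complex_frame_coordinates[OF norm_det_frame(2)[OF c(1) x]] by blast
  have h: "herm \<xi> (?M $ l) = (\<Sum>k\<in>UNIV. z k * of_real (?g $ k $ l))" for l
    unfolding z herm_sum_left by (simp add: herm_simps herm_frame_real(2)[OF c(1) x])
  have Re0: "Re (herm \<xi> (?M $ l)) = 0" for l
  proof -
    have "partial l (local_rep c F) (snd c p) \<bullet> \<xi> = 0"
      using \<xi> partial_in_tangent_space[of l c F p]
      by (simp add: normal_space_def orthogonal_comp_def orthogonal_def)
    then show ?thesis by (simp add: Re_herm frame_def inner_commute)
  qed
  have 0: "of_real 0 = (\<Sum>k\<in>UNIV. (of_real (Re (z k)) :: complex) * of_real (?g $ k $ l))" for l
  proof -
    have "Re (herm \<xi> (?M $ l)) = (\<Sum>k\<in>UNIV. Re (z k) * ?g $ k $ l)" unfolding h by simp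
    then have "0 = (\<Sum>k\<in>UNIV. Re (z k) * ?g $ k $ l)" using Re0 by simp
    then have "of_real 0 = (of_real (\<Sum>k\<in>UNIV. Re (z k) * ?g $ k $ l) :: complex)" by (rule arg_cong)
    then show ?thesis by simp
  qed
  have "?g ** matrix_inv ?g = mat 1"
    by (rule matrix_inv_left_right) (use det_gram_pos(1)[OF immersion_F c(1) x] in simp)
  from coefficients_from_gram[OF this 0] have "(of_real (Re (z k)) :: complex) = 0" for k by simp
  then have zk: "z k = \<i> * of_real (Im (z k))" for k by (simp add: complex_eq_iff)
  have "\<xi> = (\<Sum>k\<in>UNIV. (\<i> * of_real (Im (z k))) *s (?M $ k))"
    unfolding z by (rule sum.cong[OF refl], rule arg_cong[OF zk])
  then show ?thesis by (rule that)
qed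

lemma second_partials_commute:
  assumes "c \<in> A" "x \<in> chart_image c"
  shows "partial i (partial j (local_rep c F)) x = partial j (partial i (local_rep c F)) x"
  unfolding partial_def[abs_def]
  by (rule smooth_on_mixed_derivatives[OF smooth_map_local[OF smooth_F assms(1)] chart_open(2)[OF assms(1)] assms(2)])

lemma partial_directional:
  assumes "c \<in> A" "x \<in> chart_image c"
  shows "((\<lambda>s. frame c F (x + s *\<^sub>R axis i 1) $ j) has_vector_derivative partial i (partial j (local_rep c F)) x) (at 0)"
proof -
  have "smooth_on (chart_image c) (partial j (local_rep c F))"
    unfolding partial_def[abs_def] by (rule smooth_on_deriv[OF smooth_map_local[OF smooth_F assms(1)]])
  from directional_derivative[OF smooth_on_differentiable[OF this assms(2)], of "axis i 1"]
  show ?thesis by (simp add: frame_def partial_def[of i])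
qed

lemma line_in_chart:
  assumes "c \<in> A" "x \<in> chart_image c"
  shows "\<exists>U. open U \<and> (0::real) \<in> U \<and> (\<forall>s\<in>U. x + s *\<^sub>R v \<in> chart_image c)"
proof -
  have "open ((\<lambda>s. x + s *\<^sub>R v) -` chart_image c)"
    by (rule open_vimage[OF chart_open(2)[OF assms(1)]]) (intro continuous_intros)
  then show ?thesis using assms(2) by (intro exI[of _ "(\<lambda>s. x + s *\<^sub>R v) -` chart_image c"]) auto
qed

text \<open>The cubic form \<open>C i j l = <\<partial>\<^sub>i\<partial>\<^sub>j F, \<i> \<partial>\<^sub>l F>\<close> of a Lagrangian submanifold is totally symmetric: in the
  first two indices as second derivatives commute, and in the last two by differentiating the Lagrangian
  condition.\<close>

lemma cubic_form_symmetric: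
  assumes c: "c \<in> A" "x \<in> chart_image c"
  shows "Im (herm (partial i (partial j (local_rep c F)) x) (frame c F x $ l))
       = Im (herm (partial l (partial j (local_rep c F)) x) (frame c F x $ i))"
proof -
  define C where "C i j l = Im (herm (partial i (partial j (local_rep c F)) x) (frame c F x $ l))" for i j l
  have swap: "C i j l = C i l j" for i j l
  proof -
    have "((\<lambda>s. herm (frame c F (x + s *\<^sub>R axis i 1) $ j) (frame c F (x + s *\<^sub>R axis i 1) $ l)) has_vector_derivative
      (herm (frame c F (x + 0 *\<^sub>R axis i 1) $ j) (partial i (partial l (local_rep c F)) x)
        + herm (partial i (partial j (local_rep c F)) x) (frame c F (x + 0 *\<^sub>R axis i 1) $ l))) (at 0)"
      by (rule herm_derivative[OF partial_directional[OF c] partial_directional[OF c]])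
    from bounded_linear.has_vector_derivative[OF bounded_linear_Im this]
    have 1: "((\<lambda>s. Im (herm (frame c F (x + s *\<^sub>R axis i 1) $ j) (frame c F (x + s *\<^sub>R axis i 1) $ l))) has_vector_derivative
      (C i j l - C i l j)) (at 0)"
      by (simp add: C_def Im_herm_swap[of "frame c F x $ j"])
    obtain U where U: "open U" "(0::real) \<in> U" "\<And>s. s \<in> U \<Longrightarrow> x + s *\<^sub>R axis i 1 \<in> chart_image c"
      using line_in_chart[OF c] by metis
    have "((\<lambda>s. Im (herm (frame c F (x + s *\<^sub>R axis i 1) $ j) (frame c F (x + s *\<^sub>R axis i 1) $ l))) has_vector_derivative 0) (at 0)"
      by (rule has_vector_derivative_transform_within_open[of "\<lambda>_. 0" 0 0 U])
         (use U herm_frame_real(1)[OF c(1)] in auto)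
    from vector_derivative_unique_at[OF 1 this] show ?thesis by simp
  qed
  have comm: "C i j l = C j i l" for i j l
    unfolding C_def second_partials_commute[OF c, of i j] ..
  show ?thesis using swap comm unfolding C_def by metis
qed

text \<open>The derivative of the complex determinant is the sum over \<open>j\<close> of the \<open>j\<close>-th coordinate of \<open>\<partial>\<^sub>i\<partial>\<^sub>j F\<close> in
  the frame, which is a trace over two indices of the cubic form in the imaginary part. By symmetry the free
  index \<open>i\<close> can be moved to the last place, and then the trace is that of the second fundamental form.\<close>

lemma log_derivative_det_frame:
  assumes c: "c \<in> A" "p \<in> fst c"
  obtains \<mu> where
    "((\<lambda>s. det (frame c F (snd c p + s *\<^sub>R axis i 1))) has_vector_derivative \<mu> * det (frame c F (snd c p))) (at 0)"
    "Im \<mu> = mean_curvature c F p \<bullet> (\<i> *s (frame c F (snd c p) $ i))"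
proof -
  let ?x = "snd c p"
  have x: "?x \<in> chart_image c" using c by auto
  let ?M = "frame c F ?x" and ?g = "gram c F ?x" and ?H = "\<lambda>i j. partial i (partial j (local_rep c F)) ?x"
  define h where "h = matrix_inv ?g"
  have gh: "?g ** h = mat 1"
    unfolding h_def by (rule matrix_inv_left_right) (use det_gram_pos(1)[OF immersion_F c(1) x] in simp)
  have "\<exists>z. ?H i j = (\<Sum>k\<in>UNIV. z k *s (?M $ k))" for j
    using complex_frame_coordinates[OF norm_det_frame(2)[OF c(1) x]] by metis
  then obtain z where z: "\<And>j. ?H i j = (\<Sum>k\<in>UNIV. z j k *s (?M $ k))" by metis
  define \<mu> where "\<mu> = (\<Sum>j\<in>UNIV. z j j)"
  have "((\<lambda>s. det (frame c F (?x + s *\<^sub>R axis i 1))) has_vector_derivative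
      (\<Sum>j\<in>UNIV. det (replace_row j (?H i j) (frame c F (?x + 0 *\<^sub>R axis i 1))))) (at 0)"
    by (rule has_vector_derivative_det) (rule partial_directional[OF c(1) x])
  moreover have "(\<Sum>j\<in>UNIV. det (replace_row j (?H i j) ?M)) = \<mu> * det ?M"
    by (simp add: det_replace_row_combination[OF z] \<mu>_def sum_distrib_right)
  ultimately have 1: "((\<lambda>s. det (frame c F (?x + s *\<^sub>R axis i 1))) has_vector_derivative \<mu> * det ?M) (at 0)" by simp
  have zh: "z j j = (\<Sum>l\<in>UNIV. herm (?H i j) (?M $ l) * of_real (h $ l $ j))" for j
  proof (rule coefficients_from_gram[OF gh, where c="z j" and h="\<lambda>l. herm (?H i j) (?M $ l)"])
    show "herm (?H i j) (?M $ l) = (\<Sum>k\<in>UNIV. z j k * of_real (?g $ k $ l))" for l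
      unfolding z herm_sum_left by (simp add: herm_simps herm_frame_real(2)[OF c(1) x])
  qed
  have "Im \<mu> = (\<Sum>j\<in>UNIV. \<Sum>l\<in>UNIV. Im (herm (?H i j) (?M $ l)) * h $ l $ j)"
    by (simp add: \<mu>_def zh)
  also have "\<dots> = (\<Sum>j\<in>UNIV. \<Sum>l\<in>UNIV. h $ l $ j * Im (herm (?H l j) (?M $ i)))"
    by (intro sum.cong refl) (simp add: cubic_form_symmetric[OF c(1) x, of i] mult.commute)
  also have "\<dots> = (\<Sum>l\<in>UNIV. \<Sum>j\<in>UNIV. h $ l $ j * (?H l j \<bullet> (\<i> *s (?M $ i))))"
    by (subst sum.swap) (simp add: Im_herm_inner)
  also have "\<dots> = (\<Sum>l\<in>UNIV. \<Sum>j\<in>UNIV. h $ l $ j * (normal_part c F p (?H l j) \<bullet> (\<i> *s (?M $ i))))"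
  proof -
    have "?H l j \<bullet> (\<i> *s (?M $ i)) = normal_part c F p (?H l j) \<bullet> (\<i> *s (?M $ i))" for l j
    proof -
    have "?H l j - normal_part c F p (?H l j) \<in> tangent_space c F p"
      by (rule normal_part(2)[OF smooth_F c])
    moreover have "?M $ i \<in> tangent_space c F p" unfolding frame_def using partial_in_tangent_space by simp
    ultimately have "kaehler_form (?H l j - normal_part c F p (?H l j)) (?M $ i) = 0"
      using lagrangian c unfolding lagrangian_def by blast
    then have "(?H l j - normal_part c F p (?H l j)) \<bullet> (\<i> *s (?M $ i)) = 0"
      unfolding Im_herm_inner[symmetric] Im_herm_kaehler by simp
      then show ?thesis by (simp add: inner_diff_left)
    qed
    then show ?thesis by simp
  qed
  also have "\<dots> = mean_curvature c F p \<bullet> (\<i> *s (?M $ i))"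
    by (simp add: mean_curvature_def h_def inner_sum_left)
  finally show ?thesis using 1 that by blast
qed

text \<open>The complex conjugate of the unit complex number \<open>det / |det|\<close> (the exponential of minus \<open>\<i>\<close> times
  the Lagrangian angle).\<close>

definition conjugate_phase :: "('l, 'm) chart \<Rightarrow> real ^ 'm \<Rightarrow> complex" where
  "conjugate_phase c x = of_real (norm (det (frame c F x))) / det (frame c F x)"

text \<open>For a derivative \<open>\<mu> D\<close> of \<open>D = det\<close> the logarithmic derivative of \<open>|D| / D\<close> is
  \<open>Re \<mu> - \<mu> = - \<i> Im \<mu>\<close>. In the application \<open>H\<close> is the soliton equation.\<close>

lemma conjugate_phase_derivative:
  assumes c: "c \<in> A" "p \<in> fst c"
    and H: "mean_curvature c F p = normal_part c F p N"
  shows "((\<lambda>s. conjugate_phase c (snd c p + s *\<^sub>R axis i 1)) has_vector_derivative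
      \<i> * of_real (Im (herm (frame c F (snd c p) $ i) N)) * conjugate_phase c (snd c p)) (at 0)"
proof -
  let ?x = "snd c p"
  have x: "?x \<in> chart_image c" using c by auto
  define D where "D s = det (frame c F (?x + s *\<^sub>R axis i 1))" for s
  have D0: "D 0 \<noteq> 0" using norm_det_frame(2)[OF c(1) x] by (simp add: D_def)
  obtain \<mu> where D: "(D has_vector_derivative \<mu> * D 0) (at 0)"
    and Im\<mu>: "Im \<mu> = mean_curvature c F p \<bullet> (\<i> *s (frame c F ?x $ i))"
    using log_derivative_det_frame[OF c, of i] unfolding D_def by auto
  have "N - normal_part c F p N \<in> tangent_space c F p" by (rule normal_part(2)[OF smooth_F c])
  moreover have "frame c F ?x $ i \<in> tangent_space c F p" unfolding frame_def using partial_in_tangent_space by simp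
  ultimately have "kaehler_form (N - normal_part c F p N) (frame c F ?x $ i) = 0"
    using lagrangian c unfolding lagrangian_def by blast
  then have "(N - normal_part c F p N) \<bullet> (\<i> *s (frame c F ?x $ i)) = 0"
    unfolding Im_herm_inner[symmetric] Im_herm_kaehler by simp
  then have Im\<mu>': "Im \<mu> = - Im (herm (frame c F ?x $ i) N)"
    using Im\<mu> H unfolding Im_herm_swap[of "frame c F ?x $ i" N] by (simp add: inner_diff_left Im_herm_inner)
  have "((\<lambda>s. of_real (norm (D s)) / D s) has_vector_derivative
     (of_real (Re \<mu> * norm (D 0)) * D 0 - of_real (norm (D 0)) * (\<mu> * D 0)) / (D 0 * D 0)) (at 0)"
  proof -
    have n: "((\<lambda>s. of_real (norm (D s)) :: complex) has_vector_derivative of_real (Re \<mu> * norm (D 0))) (at 0)"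
      using has_vector_derivative_norm[OF D D0] D0 by simp
    have inv: "((\<lambda>s. inverse (D s)) has_vector_derivative \<mu> * D 0 * - (inverse (D 0) * inverse (D 0))) (at 0)"
      using field_vector_diff_chain_at[OF D DERIV_inverse[OF D0]] by (simp add: o_def power2_eq_square numeral_2_eq_2)
    have "of_real (norm (D 0)) * (\<mu> * D 0 * - (inverse (D 0) * inverse (D 0))) + of_real (Re \<mu> * norm (D 0)) * inverse (D 0)
      = (of_real (Re \<mu> * norm (D 0)) * D 0 - of_real (norm (D 0)) * (\<mu> * D 0)) / (D 0 * D 0)"
      using D0 by (simp add: field_simps)
    with has_vector_derivative_mult[OF n inv] show ?thesis by (simp only: divide_inverse)
  qed
  moreover have "(of_real (Re \<mu> * norm (D 0)) * D 0 - of_real (norm (D 0)) * (\<mu> * D 0)) / (D 0 * D 0)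
     = \<i> * of_real (Im (herm (frame c F ?x $ i) N)) * (of_real (norm (D 0)) / D 0)"
  proof -
    have "of_real (Re \<mu>) - \<mu> = \<i> * of_real (Im (herm (frame c F ?x $ i) N))"
      using Im\<mu>' by (simp add: complex_eq_iff)
    moreover have "(of_real (Re \<mu> * norm (D 0)) * D 0 - of_real (norm (D 0)) * (\<mu> * D 0)) / (D 0 * D 0)
      = (of_real (Re \<mu>) - \<mu>) * (of_real (norm (D 0)) / D 0)"
      using D0 by (simp add: field_simps)
    ultimately show ?thesis by simp
  qed
  ultimately show ?thesis by (simp add: D_def conjugate_phase_def[abs_def])
qed

end

section \<open>The divergence theorem in a chart\<close>

lemma open_line_vimage:
  fixes x v :: "'a::real_normed_vector"
  shows "open S \<Longrightarrow> open ((\<lambda>s. x + s *\<^sub>R v) -` S)"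
  by (rule open_vimage) (simp, intro continuous_intros)

lemma directional_derivative_cong:
  fixes f g :: "'a::real_normed_vector \<Rightarrow> 'b::real_normed_vector"
  assumes "((\<lambda>s. f (x + s *\<^sub>R v)) has_vector_derivative d) (at 0)" "open S" "x \<in> S" "\<And>y. y \<in> S \<Longrightarrow> f y = g y"
  shows "((\<lambda>s. g (x + s *\<^sub>R v)) has_vector_derivative d) (at 0)"
proof (rule has_vector_derivative_transform_within_open[OF assms(1) open_line_vimage[OF assms(2), of x v]])
  show "0 \<in> (\<lambda>s. x + s *\<^sub>R v) -` S" using assms(3) by simp
  show "f (x + s *\<^sub>R v) = g (x + s *\<^sub>R v)" if "s \<in> (\<lambda>s. x + s *\<^sub>R v) -` S" for s
    using that by (intro assms(4)) simp
qed

lemma directional_derivative_zero: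
  fixes g :: "'a::real_normed_vector \<Rightarrow> 'b::real_normed_vector"
  assumes "open S" "x \<in> S" "\<And>y. y \<in> S \<Longrightarrow> g y = 0"
  shows "((\<lambda>s. g (x + s *\<^sub>R v)) has_vector_derivative 0) (at 0)"
proof (rule directional_derivative_cong[OF _ assms(1,2)])
  show "((\<lambda>s. (\<lambda>_. 0) (x + s *\<^sub>R v)) has_vector_derivative 0) (at 0)" by simp
qed (simp add: assms(3))

text \<open>Extended by zero, the functions \<open>W i\<close> remain continuously differentiable along the \<open>i\<close>-th axis, since
  \<open>\<Omega>\<close> and the complement of \<open>C\<close> are open sets that cover the space.\<close>

lemma integral_divergence_zero:
  fixes W W' :: "'m::finite \<Rightarrow> real ^ 'm \<Rightarrow> complex"
  assumes \<Omega>: "open \<Omega>" and C: "compact C" "C \<subseteq> \<Omega>"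
    and der: "\<And>i x. x \<in> \<Omega> \<Longrightarrow> ((\<lambda>s. W i (x + s *\<^sub>R axis i 1)) has_vector_derivative W' i x) (at 0)"
    and cont: "\<And>i. continuous_on \<Omega> (W i)" "\<And>i. continuous_on \<Omega> (W' i)"
    and supp: "\<And>i x. x \<in> \<Omega> \<Longrightarrow> x \<notin> C \<Longrightarrow> W i x = 0"
  shows "(LINT x|lborel. indicator \<Omega> x *\<^sub>R (\<Sum>i\<in>UNIV. W' i x)) = 0"
proof -
  have opC: "open (- C)" using C(1) compact_imp_closed by blast
  define H where "H i x = indicator \<Omega> x *\<^sub>R W i x" for i x
  define H' where "H' i x = indicator \<Omega> x *\<^sub>R W' i x" for i x
  have W'0: "W' i x = 0" if "x \<in> \<Omega>" "x \<notin> C" for i x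
  proof -
    have "((\<lambda>s. W i (x + s *\<^sub>R axis i 1)) has_vector_derivative 0) (at 0)"
      by (rule directional_derivative_zero[of "\<Omega> \<inter> - C"]) (use that supp \<Omega> opC in auto)
    from vector_derivative_unique_at[OF der[OF that(1)] this] show ?thesis .
  qed
  have cH: "continuous_on UNIV f"
    if "continuous_on \<Omega> f" "\<And>x. x \<notin> C \<Longrightarrow> f x = 0" for f :: "real ^ 'm \<Rightarrow> complex"
  proof -
    have "continuous_on (- C) f" by (rule continuous_on_eq[of _ "\<lambda>_. 0"]) (use that in auto)
    then have "continuous_on (\<Omega> \<union> - C) f" using that(1) \<Omega> opC by (intro continuous_on_open_Un)
    moreover have "\<Omega> \<union> - C = UNIV" using C(2) by auto
    ultimately show ?thesis by simp
  qed
  have contH: "continuous_on UNIV (H i)" for i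
    by (rule cH, rule continuous_on_eq[OF cont(1)[of i]]) (use supp in \<open>auto simp: H_def indicator_def\<close>)
  have contH': "continuous_on UNIV (H' i)" for i
    by (rule cH, rule continuous_on_eq[OF cont(2)[of i]]) (use W'0 in \<open>auto simp: H'_def indicator_def\<close>)
  have derH: "((\<lambda>s. H i (x + s *\<^sub>R axis i 1)) has_vector_derivative H' i x) (at 0)" for i x
  proof (cases "x \<in> \<Omega>")
    case True
    have "((\<lambda>s. H i (x + s *\<^sub>R axis i 1)) has_vector_derivative W' i x) (at 0)"
      by (rule directional_derivative_cong[OF der[OF True] \<Omega> True]) (simp add: H_def)
    then show ?thesis using True by (simp add: H'_def)
  next
    case False
    then have "x \<in> - C" using C(2) by auto
    have "((\<lambda>s. H i (x + s *\<^sub>R axis i 1)) has_vector_derivative 0) (at 0)"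
      by (rule directional_derivative_zero[OF opC \<open>x \<in> - C\<close>]) (use supp in \<open>auto simp: H_def indicator_def\<close>)
    then show ?thesis using False by (simp add: H'_def)
  qed
  have int0: "integral\<^sup>L lborel (H' i) = 0" for i
    by (rule integral_directional_derivative_zero[OF derH contH contH' C(1)])
       (use supp in \<open>auto simp: H_def indicator_def\<close>)
  have integ: "integrable lborel (H' i)" for i
  proof -
    have "set_integrable lborel C (H' i)"
      using compact_imp_closed[OF C(1)] emeasure_bounded_finite[OF compact_imp_bounded[OF C(1)]]
      by (intro set_integrable_continuous continuous_on_subset[OF contH'] C(1)) (auto simp: sets_restrict_space)
    also have "set_integrable lborel C (H' i) \<longleftrightarrow> integrable lborel (H' i)"
      unfolding set_integrable_def
      by (rule Bochner_Integration.integrable_cong) (use W'0 in \<open>auto simp: indicator_def H'_def\<close>)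
    finally show ?thesis .
  qed
  have "(LINT x|lborel. indicator \<Omega> x *\<^sub>R (\<Sum>i\<in>UNIV. W' i x)) = (LINT x|lborel. (\<Sum>i\<in>UNIV. H' i x))"
    by (simp add: H'_def scaleR_sum_right)
  also have "\<dots> = (\<Sum>i\<in>UNIV. integral\<^sup>L lborel (H' i))"
    by (rule Bochner_Integration.integral_sum) (rule integ)
  finally show ?thesis by (simp add: int0)
qed

text \<open>The terms are antisymmetric in \<open>i\<close> and \<open>j\<close> because exchanging two rows changes the sign.\<close>

lemma det_replace_two_rows_cancel:
  fixes M :: "complex ^ 'n ^ 'n"
  assumes sym: "\<And>i j. a i j = a j i"
  shows "(\<Sum>i\<in>UNIV. \<Sum>j\<in>UNIV. if j = i then 0 else det (replace_row j (a i j) (replace_row i w M))) = 0"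
proof -
  define T where "T i j = (if j = i then 0 else det (replace_row j (a i j) (replace_row i w M)))" for i j
  have anti: "T i j = - T j i" for i j
  proof (cases "i = j")
    case False
    have "replace_row j w (replace_row i (a i j) M) = replace_row i (a i j) (replace_row j w M)"
      using False by (auto simp: replace_row_def vec_eq_iff)
    then show ?thesis
      using False det_replace_row_swap[of j i "a i j" w M] by (simp add: T_def sym[of j i])
  qed (simp add: T_def)
  have "(\<Sum>i\<in>UNIV. \<Sum>j\<in>UNIV. T i j) = (\<Sum>i\<in>UNIV. \<Sum>j\<in>UNIV. T j i)" by (rule sum.swap)
  also have "\<dots> = - (\<Sum>i\<in>UNIV. \<Sum>j\<in>UNIV. T i j)" by (subst anti) (simp add: sum_negf)
  finally show ?thesis by (simp add: T_def)
qed

section \<open>The calibrating integrand of a variation\<close>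

text \<open>The data of a normal variation of a soliton, with \<open>\<kappa>\<close> and \<open>T\<close> as in the introduction and an open
  time interval \<open>I\<close> around \<open>0\<close>.\<close>

locale soliton_variation = lagrangian_submanifold A F
  for A :: "('l::{t2_space, second_countable_topology}, 'm::finite) chart set"
    and F :: "'l \<Rightarrow> complex ^ 'm" +
  fixes \<kappa> :: real and T :: "complex ^ 'm" and \<xi> :: "'l \<Rightarrow> complex ^ 'm"
    and K :: "'l set" and \<Phi> :: "real \<Rightarrow> 'l \<Rightarrow> complex ^ 'm" and I :: "real set"
  assumes nonempty: "A \<noteq> {}"
    and \<kappa>: "\<kappa> \<ge> 0"
    and soliton: "\<And>c p. c \<in> A \<Longrightarrow> p \<in> fst c \<Longrightarrow> mean_curvature c F p = normal_part c F p ((\<kappa> / 2) *\<^sub>R F p - T)"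
    and normal: "\<And>c p. c \<in> A \<Longrightarrow> p \<in> fst c \<Longrightarrow> \<xi> p \<in> normal_space c F p"
    and K: "compact K" "K \<subseteq> points A"
    and I: "open I" "0 \<in> I"
    and smooth_\<Phi>: "\<And>c. c \<in> A \<Longrightarrow> smooth_on (I \<times> chart_image c) (\<lambda>(t, x). local_rep c (\<Phi> t) x)"
    and immersion_\<Phi>: "\<And>t. t \<in> I \<Longrightarrow> immersion A (\<Phi> t)"
    and stationary: "\<And>t p. t \<in> I \<Longrightarrow> p \<in> points A - K \<Longrightarrow> \<Phi> t p = F p"
    and initial: "\<And>p. p \<in> points A \<Longrightarrow> \<Phi> 0 p = F p"
    and initial_velocity: "\<And>p. p \<in> points A \<Longrightarrow> ((\<lambda>t. \<Phi> t p) has_vector_derivative \<xi> p) (at 0)"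
begin

text \<open>Minus half the gradient of the weight function \<open>f\<close> along \<open>F\<close>.\<close>

definition drift :: "'l \<Rightarrow> complex ^ 'm" where
  "drift p = (\<kappa> / 2) *\<^sub>R F p - T"

text \<open>The function \<open>- f / 2\<close>, the logarithm of the weight.\<close>

definition log_weight :: "complex ^ 'm \<Rightarrow> real" where
  "log_weight z = \<kappa> / 4 * (norm z)\<^sup>2 - z \<bullet> T"

text \<open>The first order Taylor polynomial of \<open>log_weight\<close> at \<open>F p\<close>, evaluated at \<open>\<Phi> t p\<close> and with the real
  inner product of the gradient replaced by the Hermitian product. This makes it complex affine in
  \<open>\<Phi> t p\<close>, so that Cramer's rule over the complex numbers applies to its derivatives.\<close>

definition exponent :: "real \<Rightarrow> 'l \<Rightarrow> complex" where
  "exponent t p = of_real (log_weight (F p)) + herm (\<Phi> t p - F p) (drift p)"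

definition velocity :: "real \<Rightarrow> 'l \<Rightarrow> complex ^ 'm" where
  "velocity t p = vector_derivative (\<lambda>s. \<Phi> s p) (at t)"

text \<open>The exponential of \<open>exponent\<close> times the holomorphic volume form on the frame of \<open>\<Phi> t\<close>, relative to
  the value of the volume form on the frame of \<open>F\<close>. The division makes it independent of the chart and
  removes the phase.\<close>

definition calibration :: "real \<Rightarrow> 'l \<Rightarrow> complex" where
  "calibration t p = exp (exponent t p) * det (frame (chart_at p) (\<Phi> t) (snd (chart_at p) p))
     / det (frame (chart_at p) F (snd (chart_at p) p))"

text \<open>The covector \<open>u\<close> contracted with the \<open>(m - 1)\<close>-form obtained by inserting the velocity into the weighted
  holomorphic volume form, relative to the volume form on the frame of \<open>F\<close>.\<close>

definition flux :: "('l, 'm) chart \<Rightarrow> ('m \<Rightarrow> complex) \<Rightarrow> real \<Rightarrow> 'l \<Rightarrow> complex" where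
  "flux c u t p = exp (exponent t p) *
     (\<Sum>i\<in>UNIV. u i * det (replace_row i (velocity t p) (frame c (\<Phi> t) (snd c p)))) / det (frame c F (snd c p))"

text \<open>The part of the time derivative of \<open>calibration\<close> that is not a divergence.\<close>

definition defect :: "real \<Rightarrow> 'l \<Rightarrow> complex" where
  "defect t p = - of_real (\<kappa> / 2) *
     flux (chart_at p) (\<lambda>i. herm (\<Phi> t p - F p) (frame (chart_at p) F (snd (chart_at p) p) $ i)) t p"

text \<open>The boundary term that a cut-off function \<open>\<theta>\<close> produces in the divergence theorem.\<close>

definition gradient_flux :: "('l \<Rightarrow> real) \<Rightarrow> real \<Rightarrow> 'l \<Rightarrow> complex" where
  "gradient_flux \<theta> t p = flux (chart_at p) (\<lambda>i. of_real (partial i (local_rep (chart_at p) \<theta>) (snd (chart_at p) p))) t p"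

lemma smooth_map_\<Phi>: "t \<in> I \<Longrightarrow> smooth_map A (\<Phi> t)"
  by (rule immersion_smooth_map[OF immersion_\<Phi>])

lemma calibration_chart:
  assumes c: "c \<in> A" "p \<in> fst c" and t: "t \<in> I"
  shows "calibration t p = exp (exponent t p) * det (frame c (\<Phi> t) (snd c p)) / det (frame c F (snd c p))"
proof -
  have p: "p \<in> points A" using chart_subset_points c by blast
  let ?J = "transition_matrix (chart_at p) c p"
  have "det ?J > 0" by (rule transition_smooth(2)[OF chart_at(1)[OF p] c(1)]) (use chart_at(2)[OF p] c in auto)
  then show ?thesis
    unfolding calibration_def
      det_change_of_frame[OF frame_change[OF chart_at(1)[OF p] c(1) chart_at(2)[OF p] c(2) smooth_map_\<Phi>[OF t]]]
      det_change_of_frame[OF frame_change[OF chart_at(1)[OF p] c(1) chart_at(2)[OF p] c(2) smooth_F]]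
    by simp
qed

lemma flux_change:
  assumes p: "p \<in> points A" and c: "c \<in> A" "p \<in> fst c" and t: "t \<in> I"
    and u: "\<And>i. u i = (\<Sum>j\<in>UNIV. transition_matrix (chart_at p) c p $ i $ j *\<^sub>R u' j)"
  shows "flux (chart_at p) u t p = flux c u' t p"
proof -
  let ?J = "transition_matrix (chart_at p) c p"
  have "det ?J > 0" by (rule transition_smooth(2)[OF chart_at(1)[OF p] c(1)]) (use chart_at(2)[OF p] c in auto)
  then show ?thesis
    unfolding flux_def
      contraction_change_of_frame[OF frame_change[OF chart_at(1)[OF p] c(1) chart_at(2)[OF p] c(2) smooth_map_\<Phi>[OF t]] u]
      det_change_of_frame[OF frame_change[OF chart_at(1)[OF p] c(1) chart_at(2)[OF p] c(2) smooth_F]]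
    by simp
qed

lemma defect_chart:
  assumes c: "c \<in> A" "p \<in> fst c" and t: "t \<in> I"
  shows "defect t p = - of_real (\<kappa> / 2) * flux c (\<lambda>i. herm (\<Phi> t p - F p) (frame c F (snd c p) $ i)) t p"
proof -
  have p: "p \<in> points A" using chart_subset_points c by blast
  show ?thesis unfolding defect_def
    by (subst flux_change[OF p c t, where u'="\<lambda>i. herm (\<Phi> t p - F p) (frame c F (snd c p) $ i)"])
       (simp_all add: frame_change[OF chart_at(1)[OF p] c(1) chart_at(2)[OF p] c(2) smooth_F] herm_sum_right
          herm_simps(8) scaleR_conv_of_real[where x="_ :: complex"])
qed

lemma gradient_flux_chart:
  assumes c: "c \<in> A" "p \<in> fst c" and t: "t \<in> I" and \<theta>: "C1_map \<theta>"
  shows "gradient_flux \<theta> t p = flux c (\<lambda>i. of_real (partial i (local_rep c \<theta>) (snd c p))) t p"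
proof -
  have p: "p \<in> points A" using chart_subset_points c by blast
  have "local_rep c \<theta> differentiable (at (snd c p))"
    using \<theta> c by (auto simp: C1_map_def C1_on_def)
  then show ?thesis unfolding gradient_flux_def
    by (subst flux_change[OF p c t, where u'="\<lambda>i. of_real (partial i (local_rep c \<theta>) (snd c p))"])
       (auto simp: partial_change[OF chart_at(1)[OF p] c(1) chart_at(2)[OF p] c(2)] scaleR_conv_of_real)
qed

text \<open>Smoothness is assumed jointly in time and space, so derivatives in either variable are taken of this
  function on a product.\<close>

definition joint_rep :: "('l, 'm) chart \<Rightarrow> real \<times> (real ^ 'm) \<Rightarrow> complex ^ 'm" where
  "joint_rep c = (\<lambda>(t, x). local_rep c (\<Phi> t) x)"

lemma smooth_joint_rep: "c \<in> A \<Longrightarrow> smooth_on (I \<times> chart_image c) (joint_rep c)"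
  unfolding joint_rep_def by (rule smooth_\<Phi>)

text \<open>Spatial frames and velocities of the variation are partial derivatives of one smooth function; this gives
  access to their joint regularity and to the symmetry of mixed derivatives.\<close>

lemma joint_rep_derivatives:
  assumes c: "c \<in> A" and t: "t \<in> I" and x: "x \<in> chart_image c"
  shows "velocity t (chart_inv c x) = frechet_derivative (joint_rep c) (at (t, x)) (1, 0)"
    and "partial i (local_rep c (\<Phi> t)) x = frechet_derivative (joint_rep c) (at (t, x)) (0, axis i 1)"
    and "((\<lambda>s. \<Phi> s (chart_inv c x)) has_vector_derivative velocity t (chart_inv c x)) (at t)"
proof -
  have d: "joint_rep c differentiable (at (t, x))"
    by (rule smooth_on_differentiable[OF smooth_joint_rep[OF c]]) (use t x in auto)
  have "((\<lambda>s. \<Phi> s (chart_inv c x)) has_vector_derivative frechet_derivative (joint_rep c) (at (t, x)) (1, 0)) (at t)"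
    using directional_derivative[OF d, of "(1, 0)"] 
    unfolding has_vector_derivative_quotient by (simp add: joint_rep_def local_rep_def)
  then show "velocity t (chart_inv c x) = frechet_derivative (joint_rep c) (at (t, x)) (1, 0)"
    and "((\<lambda>s. \<Phi> s (chart_inv c x)) has_vector_derivative velocity t (chart_inv c x)) (at t)"
    unfolding velocity_def by (auto simp: vector_derivative_at)
  have "((\<lambda>s. local_rep c (\<Phi> t) (x + s *\<^sub>R axis i 1)) has_vector_derivative frechet_derivative (joint_rep c) (at (t, x)) (0, axis i 1)) (at 0)"
    using directional_derivative[OF d, of "(0, axis i 1)"] by (simp add: joint_rep_def)
  moreover have "((\<lambda>s. local_rep c (\<Phi> t) (x + s *\<^sub>R axis i 1)) has_vector_derivative partial i (local_rep c (\<Phi> t)) x) (at 0)"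
    unfolding partial_def by (rule directional_derivative[OF local_rep_differentiable[OF smooth_map_\<Phi>[OF t] c x]])
  ultimately show "partial i (local_rep c (\<Phi> t)) x = frechet_derivative (joint_rep c) (at (t, x)) (0, axis i 1)"
    using vector_derivative_unique_at by blast
qed

lemma velocity_initial: "p \<in> points A \<Longrightarrow> velocity 0 p = \<xi> p"
  unfolding velocity_def by (rule vector_derivative_at[OF initial_velocity])

text \<open>Chart formulas are smooth functions of time and coordinates, which suffices for regularity in time over
  the chart domain.\<close>

lemma time_Ck_pullback:
  assumes c: "c \<in> A" and f: "smooth_on (I \<times> chart_image c) f"
    and eq: "\<And>t p. t \<in> I \<Longrightarrow> p \<in> fst c \<Longrightarrow> g t p = f (t, snd c p)"
  shows "time_Ck k I (fst c) g"
proof -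
  have "time_Ck k I (fst c) (\<lambda>t p. f (t, snd c p))"
    by (rule time_Ck_compose[OF chart_continuous(1)[OF c] _ time_Ck_smooth[OF f]]) simp
  then show ?thesis
    by (rule time_Ck_cong[OF I(1), THEN iffD1, rotated]) (rule eq[symmetric])
qed

lemma time_Ck_\<Phi>: "c \<in> A \<Longrightarrow> time_Ck k I (fst c) \<Phi>"
  by (rule time_Ck_pullback[OF _ smooth_joint_rep]) (auto simp: joint_rep_def local_rep_def chart_inv_simps)

lemma time_Ck_velocity: "c \<in> A \<Longrightarrow> time_Ck k I (fst c) velocity"
proof (rule time_Ck_pullback[OF _ smooth_on_deriv[OF smooth_joint_rep, of c "(1, 0)"]])
  fix t p assume c: "c \<in> A" and "t \<in> I" "p \<in> fst c"
  then show "velocity t p = frechet_derivative (joint_rep c) (at (t, snd c p)) (1, 0)"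
    using joint_rep_derivatives(1)[OF c, of t "snd c p"] chart_inv_simps(1)[OF c, of p] by simp
qed

lemma time_Ck_frame: "c \<in> A \<Longrightarrow> time_Ck k I (fst c) (\<lambda>t p. frame c (\<Phi> t) (snd c p) $ i)"
proof (rule time_Ck_pullback[OF _ smooth_on_deriv[OF smooth_joint_rep, of c "(0, axis i 1)"]])
  fix t p assume c: "c \<in> A" and "t \<in> I" "p \<in> fst c"
  then show "frame c (\<Phi> t) (snd c p) $ i = frechet_derivative (joint_rep c) (at (t, snd c p)) (0, axis i 1)"
    using joint_rep_derivatives(2)[OF c, of t "snd c p" i] by (simp add: frame_def)
qed

lemma continuous_F: "continuous_on (points A) F"
  by (rule smooth_map_continuous[OF smooth_F])

lemma continuous_frame_F: "c \<in> A \<Longrightarrow> continuous_on (fst c) (\<lambda>p. frame c F (snd c p) $ i)"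
  unfolding frame_def vec_lambda_beta
  by (intro continuous_on_compose2[OF partial_continuous[OF smooth_F] chart_continuous(1)]) auto

lemma time_Ck_points:
  assumes "\<And>c. c \<in> A \<Longrightarrow> time_Ck k I (fst c) f" shows "time_Ck k I (points A) f"
proof -
  have "points A = \<Union>(fst ` A)" by (simp add: points_def)
  moreover have "time_Ck k I (\<Union>(fst ` A)) f"
    by (rule time_Ck_local[OF I(1)]) (use chart_open assms in auto)
  ultimately show ?thesis by simp
qed

lemma time_Ck_component: "time_Ck k I X f \<Longrightarrow> time_Ck k I X (\<lambda>t x. f t x $ j)"
  by (rule time_Ck_linear[OF bounded_linear_vec_nth])

lemma continuous_drift: "c \<in> A \<Longrightarrow> continuous_on (fst c) drift"
  unfolding drift_def by (intro continuous_intros continuous_on_subset[OF continuous_F chart_subset_points])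

lemma time_Ck_exponent: 
  assumes c: "c \<in> A" shows "time_Ck k I (fst c) exponent"
proof -
  have F: "continuous_on (fst c) F" by (rule continuous_on_subset[OF continuous_F chart_subset_points[OF c]])
  have "time_Ck k I (fst c) (\<lambda>t p. of_real (log_weight (F p)) + herm (\<Phi> t p - F p) (drift p))"
    by (intro time_Ck_add time_Ck_bilinear[OF bounded_bilinear_herm] time_Ck_diff time_Ck_\<Phi>[OF c] time_Ck_const F continuous_drift[OF c])
       (auto simp: log_weight_def intro!: continuous_intros F)
  then show ?thesis by (simp add: exponent_def[abs_def])
qed

lemma det_frame_F_nonzero: "c \<in> A \<Longrightarrow> p \<in> fst c \<Longrightarrow> det (frame c F (snd c p)) \<noteq> 0"
  by (rule norm_det_frame(2)) auto

lemma time_Ck_inverse_det: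
  assumes c: "c \<in> A" shows "time_Ck k I (fst c) (\<lambda>t p. inverse (det (frame c F (snd c p))))"
proof -
  have "time_Ck k I (fst c) (\<lambda>t p. det (frame c F (snd c p)))"
    by (rule time_Ck_det[OF time_Ck_component[OF time_Ck_const[OF continuous_frame_F[OF c]]]])
  then show ?thesis by (rule time_Ck_inverse) (rule det_frame_F_nonzero[OF c])
qed

lemma time_Ck_calibration: "time_Ck k I (points A) calibration"
proof (rule time_Ck_points)
  fix c assume c: "c \<in> A"
  have "time_Ck k I (fst c) (\<lambda>t p. exp (exponent t p) * det (frame c (\<Phi> t) (snd c p)) * inverse (det (frame c F (snd c p))))"
    by (rule time_Ck_mult[OF time_Ck_mult[OF time_Ck_exp[OF time_Ck_exponent[OF c]]
          time_Ck_det[OF time_Ck_component[OF time_Ck_frame[OF c]]]] time_Ck_inverse_det[OF c]])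
  then show "time_Ck k I (fst c) calibration"
    by (rule time_Ck_cong[OF I(1), THEN iffD1, rotated]) (simp add: calibration_chart[OF c] divide_inverse)
qed

lemma time_Ck_replace_row:
  assumes c: "c \<in> A"
  shows "time_Ck k I (fst c) (\<lambda>t p. exp (exponent t p) * det (replace_row i (velocity t p) (frame c (\<Phi> t) (snd c p)))
    * inverse (det (frame c F (snd c p))))"
proof -
  have "time_Ck k I (fst c) (\<lambda>t p. replace_row i (velocity t p) (frame c (\<Phi> t) (snd c p)) $ a $ b)" for a b
    by (cases "a = i") (simp_all add: replace_row_nth time_Ck_component[OF time_Ck_velocity[OF c]] time_Ck_component[OF time_Ck_frame[OF c]])
  then show ?thesis
    by (intro time_Ck_mult time_Ck_exp time_Ck_exponent[OF c] time_Ck_inverse_det[OF c] time_Ck_det)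
qed

lemma flux_eq_sum: "flux c u t p = (\<Sum>i\<in>UNIV. u i * (exp (exponent t p) *
      det (replace_row i (velocity t p) (frame c (\<Phi> t) (snd c p))) * inverse (det (frame c F (snd c p)))))"
  by (simp add: flux_def divide_inverse sum_distrib_left sum_distrib_right mult_ac)

lemma time_Ck_defect: "time_Ck k I (points A) defect"
proof (rule time_Ck_points)
  fix c assume c: "c \<in> A"
  have F: "continuous_on (fst c) F" by (rule continuous_on_subset[OF continuous_F chart_subset_points[OF c]])
  have "time_Ck k I (fst c) (\<lambda>t p. herm (\<Phi> t p - F p) (frame c F (snd c p) $ i) * (exp (exponent t p) *
      det (replace_row i (velocity t p) (frame c (\<Phi> t) (snd c p))) * inverse (det (frame c F (snd c p)))))" for i
    by (rule time_Ck_mult[OF time_Ck_bilinear[OF bounded_bilinear_herm time_Ck_diff[OF time_Ck_\<Phi>[OF c] time_Ck_const[OF F]]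
          time_Ck_const[OF continuous_frame_F[OF c]]] time_Ck_replace_row[OF c]])
  from time_Ck_sum[OF finite this, where A=UNIV]
  have "time_Ck k I (fst c) (\<lambda>t p. flux c (\<lambda>i. herm (\<Phi> t p - F p) (frame c F (snd c p) $ i)) t p)"
    unfolding flux_eq_sum .
  from time_Ck_mult[OF time_Ck_const[OF continuous_on_const] this]
  have "time_Ck k I (fst c) (\<lambda>t p. - of_real (\<kappa> / 2) * flux c (\<lambda>i. herm (\<Phi> t p - F p) (frame c F (snd c p) $ i)) t p)" .
  then show "time_Ck k I (fst c) defect"
    by (rule time_Ck_cong[OF I(1), THEN iffD1, rotated]) (simp only: defect_chart[OF c])
qed

lemma gradient_flux_continuous:
  assumes \<theta>: "C1_map \<theta>" and t: "t \<in> I"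
  shows "continuous_on (points A) (gradient_flux \<theta> t)"
proof (rule continuous_on_points)
  fix c assume c: "c \<in> A"
  have r: "continuous_on (fst c) (\<lambda>p. exp (exponent t p) * det (replace_row i (velocity t p) (frame c (\<Phi> t) (snd c p)))
    * inverse (det (frame c F (snd c p))))" for i
  proof -
    have "continuous_on (fst c) (\<lambda>p. (\<lambda>(t, p). exp (exponent t p) * det (replace_row i (velocity t p) (frame c (\<Phi> t) (snd c p)))
      * inverse (det (frame c F (snd c p)))) (t, p))"
      by (rule continuous_on_compose2[OF time_Ck_continuous[OF time_Ck_replace_row[OF c]]])
         (use t in \<open>auto intro!: continuous_intros\<close>)
    then show ?thesis by simp
  qed
  have th: "continuous_on (fst c) (\<lambda>p. partial i (local_rep c \<theta>) (snd c p))" for i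
    unfolding partial_def
    by (rule continuous_on_compose2[OF C1_onD(2) chart_continuous(1)[OF c]]) (use \<theta> c in \<open>auto simp: C1_map_def\<close>)
  have "continuous_on (fst c) (\<lambda>p. flux c (\<lambda>i. of_real (partial i (local_rep c \<theta>) (snd c p))) t p)"
    unfolding flux_eq_sum by (intro continuous_intros r th)
  then show "continuous_on (fst c) (gradient_flux \<theta> t)"
    by (rule continuous_on_eq) (use gradient_flux_chart[OF c _ t \<theta>] in simp)
qed

end

section \<open>Its time derivative is a divergence up to a remainder\<close>

lemma continuous_on_det:
  fixes M :: "'a::topological_space \<Rightarrow> ('b::real_normed_field) ^ 'n ^ 'n"
  assumes "\<And>i. continuous_on S (\<lambda>x. M x $ i)"
  shows "continuous_on S (\<lambda>x. det (M x))"
  unfolding det_def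
  by (intro continuous_on_sum continuous_on_mult continuous_on_prod continuous_on_const
      bounded_linear.continuous_on[OF bounded_linear_vec_nth] assms)

context oriented_manifold
begin

lemma partial_zero_of_locally_constant:
  fixes \<theta> :: "'l \<Rightarrow> 'b::real_normed_vector"
  assumes c: "c \<in> A" "p \<in> fst c" and V: "open V" "p \<in> V" "\<And>q. q \<in> V \<Longrightarrow> \<theta> q = k"
  shows "partial i (local_rep c \<theta>) (snd c p) = 0"
proof -
  have "frechet_derivative (\<lambda>_. k) (at (snd c p)) = frechet_derivative (local_rep c \<theta>) (at (snd c p))"
  proof (rule frechet_derivative_transform_within_open)
    show "open (snd c ` (fst c \<inter> V))" by (rule chart_image_inter_open[OF c(1) V(1)])
    show "snd c p \<in> snd c ` (fst c \<inter> V)" using c V by auto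
    show "k = local_rep c \<theta> y" if "y \<in> snd c ` (fst c \<inter> V)" for y
      using that V(3) chart_inv_simps(1)[OF c(1)] by (auto simp: local_rep_def)
  qed simp
  then have "frechet_derivative (local_rep c \<theta>) (at (snd c p)) = (\<lambda>_. 0)" by simp
  then show ?thesis by (simp add: partial_def)
qed

lemma frame_local:
  assumes c: "c \<in> A" "p \<in> fst c" and F: "smooth_map A F"
    and V: "open V" "p \<in> V" "\<And>q. q \<in> V \<Longrightarrow> G q = F q"
  shows "frame c G (snd c p) = frame c F (snd c p)"
proof -
  have "frechet_derivative (local_rep c F) (at (snd c p)) = frechet_derivative (local_rep c G) (at (snd c p))"
  proof (rule frechet_derivative_transform_within_open)
    show "local_rep c F differentiable at (snd c p)"
      by (rule local_rep_differentiable[OF F c(1)]) (use c in auto)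
    show "open (snd c ` (fst c \<inter> V))" by (rule chart_image_inter_open[OF c(1) V(1)])
    show "snd c p \<in> snd c ` (fst c \<inter> V)" using c V by auto
    show "local_rep c F y = local_rep c G y" if "y \<in> snd c ` (fst c \<inter> V)" for y
      using that V(3) chart_inv_simps(1)[OF c(1)] by (auto simp: local_rep_def)
  qed
  then show ?thesis by (simp add: frame_def partial_def)
qed

lemma partial_add:
  assumes "C1_map f" "C1_map g" "c \<in> A" "x \<in> chart_image c"
  shows "partial i (local_rep c (\<lambda>p. f p + g p)) x = partial i (local_rep c f) x + partial i (local_rep c g) x"
proof -
  have "((\<lambda>x. local_rep c f x + local_rep c g x) has_derivative
      (\<lambda>v. frechet_derivative (local_rep c f) (at x) v + frechet_derivative (local_rep c g) (at x) v)) (at x)"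
    using assms by (intro has_derivative_add C1_onD(1)) (auto simp: C1_map_def)
  from fun_cong[OF frechet_derivative_at[OF this], of "axis i 1"]
  show ?thesis by (simp add: partial_def local_rep_def o_def)
qed

end

context soliton_variation
begin

definition calibration_rate :: "real \<Rightarrow> 'l \<Rightarrow> complex" where
  "calibration_rate t p = vector_derivative (\<lambda>s. calibration s p) (at t)"

lemma calibration_has_rate:
  assumes "t \<in> I" "p \<in> points A"
  shows "((\<lambda>s. calibration s p) has_vector_derivative calibration_rate t p) (at t)"
proof -
  have "time_Ck (Suc 0) I (points A) calibration" by (rule time_Ck_calibration)
  then obtain d where "((\<lambda>s. calibration s p) has_vector_derivative d) (at t)" using assms by auto
  then show ?thesis unfolding calibration_rate_def by (simp add: vector_derivative_at)
qed

lemma calibration_rate_continuous: "continuous_on (I \<times> points A) (\<lambda>(t, p). calibration_rate t p)"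
proof -
  have "time_Ck (Suc 0) I (points A) calibration" by (rule time_Ck_calibration)
  then obtain d where d: "\<And>t p. t \<in> I \<Longrightarrow> p \<in> points A \<Longrightarrow> ((\<lambda>s. calibration s p) has_vector_derivative d t p) (at t)"
    "continuous_on (I \<times> points A) (\<lambda>(t, p). d t p)" by auto
  show ?thesis
    by (rule continuous_on_eq[OF d(2)]) (auto simp: calibration_rate_def vector_derivative_at[OF d(1)])
qed

lemma flux_zero_velocity: "velocity t p = 0 \<Longrightarrow> flux c u t p = 0"
proof -
  assume "velocity t p = 0"
  moreover have "det (replace_row i 0 M) = 0" for i and M :: "complex ^ 'm ^ 'm"
    using det_replace_row_scale[of i 0 0 M] by simp
  ultimately show ?thesis by (simp add: flux_def)
qed

lemma velocity_off_support:
  assumes "t \<in> I" "p \<in> points A - K" shows "velocity t p = 0"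
proof -
  have "((\<lambda>s. \<Phi> s p) has_vector_derivative 0) (at t)"
    by (rule has_vector_derivative_transform_within_open[of "\<lambda>_. F p" 0 t I]) (use I assms stationary in auto)
  then show ?thesis by (simp add: velocity_def vector_derivative_at)
qed

lemma open_off_support: "open (points A - K)"
  using points_open compact_imp_closed[OF K(1)] by (rule open_Diff)

text \<open>Frames are local, and the complement of \<open>K\<close> in the manifold is open.\<close>

lemma calibration_rate_off_support:
  assumes t: "t \<in> I" and p: "p \<in> points A - K" shows "calibration_rate t p = 0"
proof -
  have "calibration s p = calibration t p" if s: "s \<in> I" for s
  proof -
    have c: "chart_at p \<in> A" "p \<in> fst (chart_at p)" using chart_at p by auto
    have "frame (chart_at p) (\<Phi> s) (snd (chart_at p) p) = frame (chart_at p) F (snd (chart_at p) p)" if "s \<in> I" for s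
      by (rule frame_local[OF c smooth_F open_off_support p]) (rule stationary[OF that])
    then show ?thesis using s t stationary[OF s p] stationary[OF t p] by (simp add: calibration_def exponent_def)
  qed
  then have "((\<lambda>s. calibration s p) has_vector_derivative 0) (at t)"
    by (intro has_vector_derivative_transform_within_open[OF has_vector_derivative_const I(1) t, of "calibration t p"]) (rule sym)
  then show ?thesis by (simp add: calibration_rate_def vector_derivative_at)
qed

lemma exponent_derivative:
  assumes "c \<in> A" "p \<in> fst c" "t \<in> I"
  shows "((\<lambda>s. exponent s p) has_vector_derivative herm (velocity t p) (drift p)) (at t)"
proof -
  have "((\<lambda>s. \<Phi> s p) has_vector_derivative velocity t p) (at t)"
    using joint_rep_derivatives(3)[OF assms(1,3), of "snd c p"] assms chart_inv_simps(1) by simp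
  then have "((\<lambda>s. \<Phi> s p - F p) has_vector_derivative velocity t p) (at t)"
    using has_vector_derivative_diff[OF _ has_vector_derivative_const] by fastforce
  from bounded_linear.has_vector_derivative[OF bounded_bilinear.bounded_linear_left[OF bounded_bilinear_herm, of "drift p"] this]
  show ?thesis unfolding exponent_def using has_vector_derivative_add[OF has_vector_derivative_const] by fastforce
qed

lemma exp_vector_derivative:
  fixes f :: "real \<Rightarrow> complex"
  assumes "(f has_vector_derivative f') (at t)"
  shows "((\<lambda>s. exp (f s)) has_vector_derivative f' * exp (f t)) (at t)"
  using field_vector_diff_chain_at[OF assms DERIV_exp] by (simp add: o_def)

text \<open>The time derivative of the \<open>i\<close>-th frame vector.\<close>

definition mixed_second :: "('l, 'm) chart \<Rightarrow> 'm \<Rightarrow> real \<Rightarrow> real ^ 'm \<Rightarrow> complex ^ 'm" where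
  "mixed_second c i t x = frechet_derivative (\<lambda>y. frechet_derivative (joint_rep c) (at y) (0, axis i 1)) (at (t, x)) (1, 0)"

text \<open>The product rule. The derivative of the determinant is a sum over the rows.\<close>

lemma calibration_rate_chart:
  assumes c: "c \<in> A" and x: "x \<in> chart_image c" and t: "t \<in> I" and p: "p = chart_inv c x"
  shows "calibration_rate t p = exp (exponent t p) * (herm (velocity t p) (drift p) * det (frame c (\<Phi> t) x)
      + (\<Sum>i\<in>UNIV. det (replace_row i (mixed_second c i t x) (frame c (\<Phi> t) x)))) / det (frame c F x)"
proof -
  have pc: "p \<in> fst c" "snd c p = x" "p \<in> points A"
    using chart_inv_simps(2,3)[OF x] chart_subset_points[OF c] p by auto
  have row: "((\<lambda>s. frame c (\<Phi> s) x $ i) has_vector_derivative mixed_second c i t x) (at t)" for i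
  proof -
    have "(\<lambda>y. frechet_derivative (joint_rep c) (at y) (0, axis i 1)) differentiable (at (t, x))"
      by (rule smooth_on_differentiable[OF smooth_on_deriv[OF smooth_joint_rep[OF c]]]) (use t x in auto)
    from directional_derivative[OF this, of "(1, 0)"]
    have "((\<lambda>s. frechet_derivative (joint_rep c) (at (s, x)) (0, axis i 1)) has_vector_derivative mixed_second c i t x) (at t)"
      unfolding has_vector_derivative_quotient by (simp add: mixed_second_def)
    then show ?thesis
      by (rule has_vector_derivative_transform_within_open[OF _ I(1) t])
         (simp add: frame_def joint_rep_derivatives(2)[OF c _ x])
  qed
  have "((\<lambda>s. exp (exponent s p) * det (frame c (\<Phi> s) x) / det (frame c F x)) has_vector_derivative
     (exp (exponent t p) * (\<Sum>i\<in>UNIV. det (replace_row i (mixed_second c i t x) (frame c (\<Phi> t) x)))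
      + herm (velocity t p) (drift p) * exp (exponent t p) * det (frame c (\<Phi> t) x)) / det (frame c F x)) (at t)"
    by (intro has_vector_derivative_divide has_vector_derivative_mult exp_vector_derivative
        exponent_derivative[OF c pc(1) t] has_vector_derivative_det row)
  then have "((\<lambda>s. calibration s p) has_vector_derivative
     (exp (exponent t p) * (\<Sum>i\<in>UNIV. det (replace_row i (mixed_second c i t x) (frame c (\<Phi> t) x)))
      + herm (velocity t p) (drift p) * exp (exponent t p) * det (frame c (\<Phi> t) x)) / det (frame c F x)) (at t)"
    by (rule has_vector_derivative_transform_within_open[OF _ I(1) t])
       (simp add: calibration_chart[OF c pc(1)] pc(2))
  then show ?thesis
    unfolding calibration_rate_def by (subst vector_derivative_at) (auto simp: algebra_simps)
qed

text \<open>The \<open>i\<close>-th derivative of the \<open>j\<close>-th frame vector.\<close>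

definition spatial_second :: "('l, 'm) chart \<Rightarrow> 'm \<Rightarrow> 'm \<Rightarrow> real \<Rightarrow> real ^ 'm \<Rightarrow> complex ^ 'm" where
  "spatial_second c i j t x = frechet_derivative (\<lambda>y. frechet_derivative (joint_rep c) (at y) (0, axis j 1)) (at (t, x)) (0, axis i 1)"

text \<open>The scalar factor of the vector field whose divergence occurs below. The volume form is multiplied
  by the conjugate phase of \<open>F\<close>, which equals the area density of \<open>F\<close> divided by its determinant.\<close>

definition amplitude :: "('l, 'm) chart \<Rightarrow> real \<Rightarrow> real ^ 'm \<Rightarrow> complex" where
  "amplitude c t x = exp (exponent t (chart_inv c x)) * conjugate_phase c x"

text \<open>The logarithmic derivative of \<open>amplitude\<close> along the \<open>i\<close>-th axis.\<close>

definition log_slope :: "('l, 'm) chart \<Rightarrow> 'm \<Rightarrow> real \<Rightarrow> real ^ 'm \<Rightarrow> complex" where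
  "log_slope c i t x = herm (frame c (\<Phi> t) x $ i) (drift (chart_inv c x)) +
     of_real (\<kappa> / 2) * herm (\<Phi> t (chart_inv c x) - F (chart_inv c x)) (frame c F x $ i)"

definition velocity_minor :: "('l, 'm) chart \<Rightarrow> 'm \<Rightarrow> real \<Rightarrow> real ^ 'm \<Rightarrow> complex" where
  "velocity_minor c i t x = det (replace_row i (velocity t (chart_inv c x)) (frame c (\<Phi> t) x))"

text \<open>The derivative of \<open>velocity_minor\<close> along the \<open>i\<close>-th axis. It is split into the term in which the row of
  the velocity is differentiated and the terms with another row, which cancel in the sum over \<open>i\<close>.\<close>

definition minor_rate :: "('l, 'm) chart \<Rightarrow> 'm \<Rightarrow> real \<Rightarrow> real ^ 'm \<Rightarrow> complex" where
  "minor_rate c i t x = det (replace_row i (mixed_second c i t x) (frame c (\<Phi> t) x)) +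
     (\<Sum>j\<in>UNIV. if j = i then 0 else det (replace_row j (spatial_second c i j t x)
        (replace_row i (velocity t (chart_inv c x)) (frame c (\<Phi> t) x))))"

text \<open>This is where the soliton equation enters. Differentiating \<open>exponent\<close> produces only the real part of
  the Hermitian product of \<open>\<partial>\<^sub>i F\<close> with the drift; the phase of \<open>F\<close> contributes its imaginary part. The
  sum is complex linear in \<open>\<partial>\<^sub>i (\<Phi> t)\<close>, apart from the term with \<open>\<kappa>\<close> coming from the derivative of the
  drift.\<close>

lemma amplitude_derivative:
  assumes c: "c \<in> A" and x: "x \<in> chart_image c" and t: "t \<in> I"
  shows "((\<lambda>s. amplitude c t (x + s *\<^sub>R axis i 1)) has_vector_derivative log_slope c i t x * amplitude c t x) (at 0)"
proof -
  let ?p = "\<lambda>s. chart_inv c (x + s *\<^sub>R axis i (1 :: real))"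
  let ?q = "chart_inv c x" and ?f = "frame c F x $ i" and ?g = "frame c (\<Phi> t) x $ i"
  have p: "?q \<in> fst c" "snd c ?q = x" using chart_inv_simps(2,3)[OF x] by auto
  have dF: "((\<lambda>s. F (?p s)) has_vector_derivative ?f) (at 0)"
    using directional_derivative[OF local_rep_differentiable[OF smooth_F c x], of "axis i 1"]
    by (simp add: local_rep_def frame_def partial_def)
  have d\<Phi>: "((\<lambda>s. \<Phi> t (?p s)) has_vector_derivative ?g) (at 0)"
    using directional_derivative[OF local_rep_differentiable[OF smooth_map_\<Phi>[OF t] c x], of "axis i 1"]
    by (simp add: local_rep_def frame_def partial_def)
  have ddrift: "((\<lambda>s. drift (?p s)) has_vector_derivative (\<kappa> / 2) *\<^sub>R ?f) (at 0)"
    unfolding drift_def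
    using has_vector_derivative_diff[OF has_vector_derivative_scaleR[OF DERIV_const dF] has_vector_derivative_const] by fastforce
  have dlog: "((\<lambda>s. log_weight (F (?p s))) has_vector_derivative ?f \<bullet> drift ?q) (at 0)"
  proof -
    have "((\<lambda>s. \<kappa> / 4 * (F (?p s) \<bullet> F (?p s)) - F (?p s) \<bullet> T) has_vector_derivative
        \<kappa> / 4 * (F (?p 0) \<bullet> ?f + ?f \<bullet> F (?p 0)) - ?f \<bullet> T) (at 0)"
      by (intro has_vector_derivative_diff has_vector_derivative_mult_right
          bounded_bilinear.has_vector_derivative[OF bounded_bilinear_inner] dF
          bounded_linear.has_vector_derivative[OF bounded_linear_inner_left dF])
    then show ?thesis
      by (simp add: log_weight_def drift_def dot_square_norm inner_diff_right inner_commute algebra_simps)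
  qed
  have dexponent: "((\<lambda>s. exponent t (?p s)) has_vector_derivative of_real (?f \<bullet> drift ?q) +
      (herm (\<Phi> t (?p 0) - F (?p 0)) ((\<kappa> / 2) *\<^sub>R ?f) + herm (?g - ?f) (drift (?p 0)))) (at 0)"
    unfolding exponent_def
    by (intro has_vector_derivative_add bounded_linear.has_vector_derivative[OF bounded_linear_of_real dlog]
        herm_derivative has_vector_derivative_diff d\<Phi> dF ddrift)
  have "mean_curvature c F ?q = normal_part c F ?q (drift ?q)"
    unfolding drift_def by (rule soliton[OF c p(1)])
  from conjugate_phase_derivative[OF c p(1) this, of i]
  have dphase: "((\<lambda>s. conjugate_phase c (x + s *\<^sub>R axis i 1)) has_vector_derivative
      \<i> * of_real (Im (herm ?f (drift ?q))) * conjugate_phase c x) (at 0)"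
    by (simp add: p(2))
  have "of_real (?f \<bullet> drift ?q) + \<i> * of_real (Im (herm ?f (drift ?q))) = herm ?f (drift ?q)"
    by (simp add: complex_eq_iff Re_herm)
  then have slope: "log_slope c i t x = of_real (?f \<bullet> drift ?q) + (herm (\<Phi> t ?q - F ?q) ((\<kappa> / 2) *\<^sub>R ?f)
      + herm (?g - ?f) (drift ?q)) + \<i> * of_real (Im (herm ?f (drift ?q)))"
    by (simp add: log_slope_def herm_simps algebra_simps)
  show ?thesis
    using has_vector_derivative_mult[OF exp_vector_derivative[OF dexponent] dphase]
    unfolding amplitude_def slope by (simp add: algebra_simps)
qed

lemma velocity_minor_derivative:
  assumes c: "c \<in> A" and x: "x \<in> chart_image c" and t: "t \<in> I"
  shows "((\<lambda>s. velocity_minor c i t (x + s *\<^sub>R axis i 1)) has_vector_derivative minor_rate c i t x) (at 0)"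
proof -
  let ?y = "\<lambda>s. x + s *\<^sub>R axis i (1 :: real)"
  let ?V = "\<lambda>x. velocity t (chart_inv c x)" and ?M = "frame c (\<Phi> t)"
  note sj = smooth_joint_rep[OF c]
  have slice: "((\<lambda>s. g (?y s)) has_vector_derivative frechet_derivative f (at (t, x)) (0, axis i 1)) (at 0)"
    if "smooth_on (I \<times> chart_image c) f" "\<And>y. y \<in> chart_image c \<Longrightarrow> f (t, y) = g y"
    for f and g :: "real ^ 'm \<Rightarrow> complex ^ 'm"
  proof (rule directional_derivative_cong[of "\<lambda>y. f (t, y)", OF _ chart_open(2)[OF c] x])
    show "((\<lambda>s. f (t, ?y s)) has_vector_derivative frechet_derivative f (at (t, x)) (0, axis i 1)) (at 0)"
      using directional_derivative[OF smooth_on_differentiable[OF that(1)], of "(t, x)" "(0, axis i 1)"] x t by simp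
  qed (rule that(2))
  have "frechet_derivative (\<lambda>y. frechet_derivative (joint_rep c) (at y) (1, 0)) (at (t, x)) (0, axis i 1) = mixed_second c i t x"
    unfolding mixed_second_def
    by (rule smooth_on_mixed_derivatives[OF sj]) (use I chart_open(2)[OF c] t x in \<open>auto intro: open_Times\<close>)
  with slice[OF smooth_on_deriv[OF sj, of "(1, 0)"] joint_rep_derivatives(1)[OF c t, symmetric]]
  have dV: "((\<lambda>s. ?V (?y s)) has_vector_derivative mixed_second c i t x) (at 0)" by simp
  have dM: "((\<lambda>s. ?M (?y s) $ j) has_vector_derivative spatial_second c i j t x) (at 0)" for j
    unfolding spatial_second_def
    by (rule slice[OF smooth_on_deriv[OF sj]]) (simp add: frame_def joint_rep_derivatives(2)[OF c t])
  let ?row = "\<lambda>j. if j = i then mixed_second c i t x else spatial_second c i j t x"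
  have "((\<lambda>s. det (replace_row i (?V (?y s)) (?M (?y s)))) has_vector_derivative
      (\<Sum>j\<in>UNIV. det (replace_row j (?row j) (replace_row i (?V (?y 0)) (?M (?y 0)))))) (at 0)"
  proof (rule has_vector_derivative_det)
    fix j
    show "((\<lambda>s. replace_row i (?V (?y s)) (?M (?y s)) $ j) has_vector_derivative ?row j) (at 0)"
      using dV dM by (cases "j = i") (simp_all add: replace_row_nth)
  qed
  moreover have "det (replace_row j (?row j) (replace_row i (?V x) (?M x)))
      = (if j = i then det (replace_row i (mixed_second c i t x) (?M x)) else 0)
        + (if j = i then 0 else det (replace_row j (spatial_second c i j t x) (replace_row i (?V x) (?M x))))" for j
  proof -
    have "replace_row i w (replace_row i v M) = replace_row i w M" for v w and M :: "complex ^ 'm ^ 'm"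
      by (simp add: replace_row_def vec_eq_iff)
    then show ?thesis by simp
  qed
  then have "(\<Sum>j\<in>UNIV. det (replace_row j (?row j) (replace_row i (?V x) (?M x)))) = minor_rate c i t x"
    unfolding minor_rate_def by (simp add: sum.distrib)
  ultimately show ?thesis by (simp add: velocity_minor_def)
qed

lemma sum_minor_rate:
  assumes c: "c \<in> A" and x: "x \<in> chart_image c" and t: "t \<in> I"
  shows "(\<Sum>i\<in>UNIV. minor_rate c i t x) = (\<Sum>i\<in>UNIV. det (replace_row i (mixed_second c i t x) (frame c (\<Phi> t) x)))"
proof -
  have "spatial_second c i j t x = spatial_second c j i t x" for i j
    unfolding spatial_second_def
    by (rule smooth_on_mixed_derivatives[OF smooth_joint_rep[OF c]])
       (use I chart_open(2)[OF c] t x in \<open>auto intro: open_Times\<close>)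
  then have "(\<Sum>i\<in>UNIV. \<Sum>j\<in>UNIV. if j = i then 0 else det (replace_row j (spatial_second c i j t x)
      (replace_row i (velocity t (chart_inv c x)) (frame c (\<Phi> t) x)))) = 0"
    by (rule det_replace_two_rows_cancel)
  then show ?thesis by (simp add: minor_rate_def sum.distrib)
qed

lemma continuous_amplitude_minor:
  assumes c: "c \<in> A" and t: "t \<in> I"
  shows "continuous_on (chart_image c) (amplitude c t)" "continuous_on (chart_image c) (log_slope c i t)"
    "continuous_on (chart_image c) (velocity_minor c i t)" "continuous_on (chart_image c) (minor_rate c i t)"
proof -
  let ?\<Omega> = "chart_image c" and ?P = "chart_inv c"
  note sj = smooth_joint_rep[OF c]
  have slice: "continuous_on ?\<Omega> (\<lambda>x. f (t, x))" if "smooth_on (I \<times> ?\<Omega>) f" for f :: "real \<times> (real ^ 'm) \<Rightarrow> complex ^ 'm"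
    by (rule continuous_on_compose2[OF smooth_on_continuous[OF that]]) (use t in \<open>auto intro!: continuous_intros\<close>)
  have V: "continuous_on ?\<Omega> (\<lambda>x. velocity t (?P x))"
    by (rule continuous_on_eq[OF slice[OF smooth_on_deriv[OF sj, of "(1, 0)"]]]) (simp add: joint_rep_derivatives(1)[OF c t])
  have second: "continuous_on ?\<Omega> (mixed_second c i t)" "continuous_on ?\<Omega> (spatial_second c i j t)" for j
    unfolding mixed_second_def[abs_def] spatial_second_def[abs_def]
    by (rule slice[OF smooth_on_deriv[OF smooth_on_deriv[OF sj]]])+
  have M: "continuous_on ?\<Omega> (\<lambda>x. frame c G x $ j)" if "smooth_map A G" for j and G :: "'l \<Rightarrow> complex ^ 'm"
    unfolding frame_def vec_lambda_beta by (rule partial_continuous[OF that c])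
  note M = M[OF smooth_F] M[OF smooth_map_\<Phi>[OF t]]
  have P: "continuous_on ?\<Omega> (\<lambda>x. f (?P x))" if "continuous_on (fst c) f" for f :: "'l \<Rightarrow> complex ^ 'm"
    by (rule continuous_on_compose2[OF that chart_continuous(2)[OF c]]) (use chart_inv_simps in auto)
  note P = P[OF continuous_on_subset[OF continuous_F chart_subset_points[OF c]]] P[OF continuous_drift[OF c]]
    P[OF continuous_on_subset[OF smooth_map_continuous[OF smooth_map_\<Phi>[OF t]] chart_subset_points[OF c]]]
  note herm = bounded_bilinear.continuous_on[OF bounded_bilinear_herm]
  show "continuous_on ?\<Omega> (amplitude c t)"
    unfolding amplitude_def[abs_def] exponent_def log_weight_def conjugate_phase_def using norm_det_frame(2)[OF c]
    by (intro continuous_intros herm P continuous_on_det M) auto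
  show "continuous_on ?\<Omega> (log_slope c i t)"
    unfolding log_slope_def[abs_def] by (intro continuous_intros herm P M)
  have row: "continuous_on ?\<Omega> (\<lambda>x. replace_row i (v x) (N x) $ j)"
    if "continuous_on ?\<Omega> v" "\<And>j. continuous_on ?\<Omega> (\<lambda>x. N x $ j)" for i j v and N :: "real ^ 'm \<Rightarrow> complex ^ 'm ^ 'm"
    using that by (cases "j = i") (simp_all add: replace_row_nth)
  show "continuous_on ?\<Omega> (velocity_minor c i t)"
    unfolding velocity_minor_def[abs_def] by (intro continuous_on_det row V M)
  have "continuous_on ?\<Omega> (\<lambda>x. if j = i then 0 else det (replace_row j (spatial_second c i j t x)
      (replace_row i (velocity t (?P x)) (frame c (\<Phi> t) x))))" for j
    by (cases "j = i") (simp_all, intro continuous_on_det row V M second)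
  then show "continuous_on ?\<Omega> (minor_rate c i t)"
    unfolding minor_rate_def[abs_def] by (intro continuous_on_add continuous_on_sum continuous_on_det row second M)
qed

text \<open>The product rule for the divergence of the cut-off vector field \<open>W\<close>. The complex linear part of
  \<open>log_slope\<close> contracts by Cramer's rule to the derivative of \<open>exponent\<close> in time, the rates of the minors
  to the derivative of the determinant in time, and the part of \<open>log_slope\<close> with \<open>\<kappa>\<close> to \<open>defect\<close>.\<close>

lemma divergence_identity:
  assumes c: "c \<in> A" and t: "t \<in> I" and \<theta>: "C1_map \<theta>"
  defines "W \<equiv> \<lambda>i x. of_real (\<theta> (chart_inv c x)) * (amplitude c t x * velocity_minor c i t x)"
  obtains W' where
    "\<And>i x. x \<in> chart_image c \<Longrightarrow> ((\<lambda>s. W i (x + s *\<^sub>R axis i 1)) has_vector_derivative W' i x) (at 0)"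
    "\<And>i. continuous_on (chart_image c) (W i)" "\<And>i. continuous_on (chart_image c) (W' i)"
    "\<And>x. x \<in> chart_image c \<Longrightarrow> (\<Sum>i\<in>UNIV. W' i x) = area_density c F x *\<^sub>R
      (of_real (\<theta> (chart_inv c x)) * (calibration_rate t (chart_inv c x) - defect t (chart_inv c x))
        + gradient_flux \<theta> t (chart_inv c x))"
proof -
  let ?\<Omega> = "chart_image c" and ?P = "chart_inv c"
  define \<theta>' where "\<theta>' i x = partial i (local_rep c \<theta>) x" for i x
  define W' where "W' i x = of_real (\<theta> (?P x)) * (amplitude c t x *
      (log_slope c i t x * velocity_minor c i t x + minor_rate c i t x))
    + of_real (\<theta>' i x) * (amplitude c t x * velocity_minor c i t x)" for i x
  have "C1_on ?\<Omega> (local_rep c \<theta>)" using \<theta> c by (simp add: C1_map_def)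
  note C1 = C1_onD[OF this]
  have cont: "continuous_on ?\<Omega> (\<lambda>x. \<theta> (?P x))" "continuous_on ?\<Omega> (\<theta>' i)" for i
    using C1(2,3) by (auto simp: \<theta>'_def[abs_def] partial_def local_rep_def o_def)
  have der: "((\<lambda>s. W i (x + s *\<^sub>R axis i 1)) has_vector_derivative W' i x) (at 0)" if x: "x \<in> ?\<Omega>" for i x
  proof -
    have "((\<lambda>s. \<theta> (?P (x + s *\<^sub>R axis i 1))) has_vector_derivative \<theta>' i x) (at 0)"
      using directional_derivative[OF differentiableI[OF C1(1)[OF x]], of "axis i 1"]
      by (simp add: local_rep_def \<theta>'_def partial_def)
    from has_vector_derivative_mult[OF bounded_linear.has_vector_derivative[OF bounded_linear_of_real this]
        has_vector_derivative_mult[OF amplitude_derivative[OF c x t] velocity_minor_derivative[OF c x t]]]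
    show ?thesis unfolding W_def W'_def by (simp add: algebra_simps)
  qed
  have cont_W: "continuous_on ?\<Omega> (W i)" and cont_W': "continuous_on ?\<Omega> (W' i)" for i
    unfolding W_def W'_def[abs_def] by (intro continuous_intros cont continuous_amplitude_minor[OF c t])+
  have sum: "(\<Sum>i\<in>UNIV. W' i x) = area_density c F x *\<^sub>R
      (of_real (\<theta> (?P x)) * (calibration_rate t (?P x) - defect t (?P x)) + gradient_flux \<theta> t (?P x))"
    if x: "x \<in> ?\<Omega>" for x
  proof -
    have P: "?P x \<in> fst c" "snd c (?P x) = x" using chart_inv_simps(2,3)[OF x] by auto
    let ?D0 = "det (frame c F x)" and ?m = "\<lambda>i. velocity_minor c i t x"
    have D0: "?D0 \<noteq> 0" by (rule norm_det_frame(2)[OF c x])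
    define e where "e = exp (exponent t (?P x))"
    define \<tau> where "\<tau> = herm (velocity t (?P x)) (drift (?P x)) * det (frame c (\<Phi> t) x)"
    define \<alpha> where "\<alpha> = (\<Sum>i\<in>UNIV. det (replace_row i (mixed_second c i t x) (frame c (\<Phi> t) x)))"
    define \<sigma> where "\<sigma> = (\<Sum>i\<in>UNIV. herm (\<Phi> t (?P x) - F (?P x)) (frame c F x $ i) * ?m i)"
    define \<beta> where "\<beta> = (\<Sum>i\<in>UNIV. of_real (\<theta>' i x) * ?m i)"
    have q: "amplitude c t x = of_real (area_density c F x) * e / ?D0"
      by (simp add: amplitude_def e_def conjugate_phase_def norm_det_frame(1)[OF c x])
    have "(\<Sum>i\<in>UNIV. herm (frame c (\<Phi> t) x $ i) (drift (?P x)) * ?m i) = \<tau>"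
      using cramer_contraction[of "frame c (\<Phi> t) x" "\<chi> k. cnj (drift (?P x) $ k)" "velocity t (?P x)"]
      by (simp add: herm_def velocity_minor_def \<tau>_def)
    then have "(\<Sum>i\<in>UNIV. log_slope c i t x * ?m i) = \<tau> + of_real (\<kappa> / 2) * \<sigma>"
      by (simp add: log_slope_def \<sigma>_def distrib_right sum.distrib sum_distrib_left mult.assoc)
    then have S: "(\<Sum>i\<in>UNIV. log_slope c i t x * ?m i + minor_rate c i t x) = \<tau> + of_real (\<kappa> / 2) * \<sigma> + \<alpha>"
      by (simp add: sum.distrib sum_minor_rate[OF c x t] \<alpha>_def)
    have sum_W': "(\<Sum>i\<in>UNIV. W' i x) = of_real (\<theta> (?P x)) * (amplitude c t x *
        (\<Sum>i\<in>UNIV. log_slope c i t x * ?m i + minor_rate c i t x)) + amplitude c t x * \<beta>"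
    proof -
      define Z where "Z i = log_slope c i t x * ?m i + minor_rate c i t x" for i
      show ?thesis unfolding W'_def \<beta>_def Z_def[symmetric] by (simp add: sum.distrib sum_distrib_left sum_distrib_right mult_ac)
    qed
    have rate: "calibration_rate t (?P x) = e * (\<tau> + \<alpha>) / ?D0"
      using calibration_rate_chart[OF c x t refl] by (simp add: e_def \<alpha>_def \<tau>_def)
    have defect: "defect t (?P x) = - of_real (\<kappa> / 2) * (e * \<sigma> / ?D0)"
      unfolding defect_chart[OF c P(1) t] flux_def P(2) by (simp add: e_def \<sigma>_def velocity_minor_def)
    have flux: "gradient_flux \<theta> t (?P x) = e * \<beta> / ?D0"
      unfolding gradient_flux_chart[OF c P(1) t \<theta>] flux_def P(2) by (simp add: e_def \<beta>_def \<theta>'_def velocity_minor_def)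
    show ?thesis
      unfolding sum_W' S rate defect flux q scaleR_conv_of_real[where x="_ :: complex"] using D0 by (simp add: field_simps)
  qed
  show ?thesis by (rule that[OF der cont_W cont_W' sum])
qed

abbreviation \<mu> :: "'l measure" where "\<mu> \<equiv> volume_measure A F"

lemmas space_\<mu> = sets_volume_measure(2)[OF nonempty immersion_F]

lemmas K_sets = sets_volume[OF nonempty immersion_F K]

section \<open>Integration over the manifold\<close>

lemma K_finite: "emeasure \<mu> K < \<infinity>"
  by (rule volume_finite_on_compact[OF nonempty immersion_F K])

lemma integrable_on_K:
  fixes g :: "'l \<Rightarrow> 'b::{banach, second_countable_topology}"
  shows "continuous_on (points A) g \<Longrightarrow> set_integrable \<mu> K g"
  by (rule set_integrable_continuous[OF K_sets K(1) K_finite continuous_on_subset[OF _ K(2)]])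

lemma slice_continuous:
  fixes f :: "real \<Rightarrow> 'l \<Rightarrow> 'b::topological_space"
  assumes "continuous_on (I \<times> points A) (\<lambda>(t, p). f t p)" "t \<in> I"
  shows "continuous_on (points A) (f t)"
proof -
  have "continuous_on (points A) (\<lambda>p. (\<lambda>(t, p). f t p) (t, p))"
    by (rule continuous_on_compose2[OF assms(1)]) (use assms(2) in \<open>auto intro!: continuous_intros\<close>)
  then show ?thesis by simp
qed

text \<open>The integrand of the divergence theorem with a cut-off function. It is additive in \<open>\<theta>\<close>, it integrates
  to zero for \<open>\<theta>\<close> supported in a chart, and for \<open>\<theta> = 1\<close> it is the difference of \<open>calibration_rate\<close> and
  \<open>defect\<close>.\<close>

definition balance :: "('l \<Rightarrow> real) \<Rightarrow> real \<Rightarrow> 'l \<Rightarrow> complex" where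
  "balance \<theta> t p = of_real (\<theta> p) * (calibration_rate t p - defect t p) + gradient_flux \<theta> t p"

lemma balance_continuous:
  assumes "C1_map \<theta>" "t \<in> I"
  shows "continuous_on (points A) (balance \<theta> t)"
  unfolding balance_def[abs_def]
  by (intro continuous_intros C1_map_continuous gradient_flux_continuous assms
      slice_continuous[OF calibration_rate_continuous] slice_continuous[OF time_Ck_continuous[OF time_Ck_defect]])

lemma gradient_flux_zero:
  assumes "p \<in> points A" "open V" "p \<in> V" "\<And>q. q \<in> V \<Longrightarrow> \<theta> q = k"
  shows "gradient_flux \<theta> t p = 0"
proof -
  have "partial i (local_rep (chart_at p) \<theta>) (snd (chart_at p) p) = 0" for i
    by (rule partial_zero_of_locally_constant[OF chart_at[OF assms(1)] assms(2,3)]) (rule assms(4))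
  then show ?thesis by (simp add: gradient_flux_def flux_def)
qed

text \<open>In the chart this is the integral of a divergence with compact support. The integrand vanishes outside
  \<open>K\<close>, since the variation is stationary there, so the integral may be taken over the whole manifold.\<close>

lemma balance_chart_zero:
  assumes c: "c \<in> A" and t: "t \<in> I" and \<theta>: "C1_map \<theta>"
    and C: "compact C" "C \<subseteq> fst c" "\<And>p. p \<notin> C \<Longrightarrow> \<theta> p = 0"
  shows "(LINT p:K|\<mu>. balance \<theta> t p) = 0"
proof -
  have offK: "balance \<theta> t p = 0" if "p \<in> points A - K" for p
    unfolding balance_def gradient_flux_def defect_def
    using flux_zero_velocity[OF velocity_off_support[OF t that]] calibration_rate_off_support[OF t that] by simp
  have offC: "balance \<theta> t p = 0" if "p \<in> points A" "p \<notin> C" for p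
  proof -
    have "open (- C)" using compact_imp_closed[OF C(1)] by blast
    then have "gradient_flux \<theta> t p = 0" by (rule gradient_flux_zero[OF that(1)]) (use that(2) C(3) in auto)
    then show ?thesis using C(3)[OF that(2)] by (simp add: balance_def)
  qed
  define W where "W i x = of_real (\<theta> (chart_inv c x)) * (amplitude c t x * velocity_minor c i t x)" for i x
  obtain W' where W': "\<And>i x. x \<in> chart_image c \<Longrightarrow> ((\<lambda>s. W i (x + s *\<^sub>R axis i 1)) has_vector_derivative W' i x) (at 0)"
    "\<And>i. continuous_on (chart_image c) (W i)" "\<And>i. continuous_on (chart_image c) (W' i)"
    "\<And>x. x \<in> chart_image c \<Longrightarrow> (\<Sum>i\<in>UNIV. W' i x) = area_density c F x *\<^sub>R balance \<theta> t (chart_inv c x)"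
    using divergence_identity[OF c t \<theta>] unfolding W_def balance_def by blast
  have "(LINT p:K|\<mu>. balance \<theta> t p) = (LINT p|\<mu>. balance \<theta> t p)"
    unfolding set_lebesgue_integral_def
    by (rule Bochner_Integration.integral_cong) (use offK space_\<mu> in \<open>auto simp: indicator_def\<close>)
  also have "\<dots> = (LINT x|lborel. indicator (chart_image c) x *\<^sub>R (area_density c F x *\<^sub>R balance \<theta> t (chart_inv c x)))"
    by (rule integral_chart[OF nonempty immersion_F c borel_measurable_continuous_on_restrict[OF balance_continuous[OF \<theta> t]]])
       (use offC C(2) in auto)
  also have "\<dots> = (LINT x|lborel. indicator (chart_image c) x *\<^sub>R (\<Sum>i\<in>UNIV. W' i x))"
    by (rule Bochner_Integration.integral_cong) (use W'(4) in \<open>auto simp: indicator_def\<close>)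
  also have "\<dots> = 0"
  proof (rule integral_divergence_zero[OF chart_open(2)[OF c], of "snd c ` C" W])
    show "compact (snd c ` C)"
      by (rule compact_continuous_image[OF continuous_on_subset[OF chart_continuous(1)[OF c] C(2)] C(1)])
    show "snd c ` C \<subseteq> chart_image c" using C(2) by auto
    show "W i x = 0" if "x \<in> chart_image c" "x \<notin> snd c ` C" for i x
    proof -
      have "chart_inv c x \<notin> C" using that chart_inv_simps(2)[OF that(1)] by (metis imageI)
      then show ?thesis using C(3) by (simp add: W_def)
    qed
  qed (use W' in auto)
  finally show ?thesis .
qed

lemma balance_add:
  assumes "C1_map f" "C1_map g" "p \<in> points A"
  shows "balance (\<lambda>p. f p + g p) t p = balance f t p + balance g t p"
proof -
  have "snd (chart_at p) p \<in> chart_image (chart_at p)" using chart_at(2)[OF assms(3)] by auto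
  note partial_add[OF assms(1,2) chart_at(1)[OF assms(3)] this, simp]
  show ?thesis
    unfolding balance_def gradient_flux_def flux_eq_sum by (simp add: algebra_simps sum.distrib)
qed

definition chart_supported :: "('l \<Rightarrow> real) \<Rightarrow> bool" where
  "chart_supported \<eta> \<longleftrightarrow> C1_map \<eta> \<and> (\<exists>c\<in>A. \<exists>C. compact C \<and> C \<subseteq> fst c \<and> (\<forall>p. p \<notin> C \<longrightarrow> \<eta> p = 0))"

lemma C1_map_prod: "finite N \<Longrightarrow> (\<And>\<eta>. \<eta> \<in> N \<Longrightarrow> C1_map \<eta>) \<Longrightarrow> C1_map (\<lambda>p. \<Prod>\<eta>\<in>N. 1 - \<eta> p)"
proof (induction N rule: finite_induct)
  case empty show ?case by (simp add: C1_map_const)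
next
  case (insert \<eta> N)
  have "C1_map (\<lambda>p. (1 - \<eta> p) * (\<Prod>\<eta>\<in>N. 1 - \<eta> p))"
    by (rule C1_map_mult[OF C1_map_diff[OF C1_map_const] insert(3)]) (use insert(4) in auto)
  then show ?case using insert(1,2) by simp
qed

text \<open>The sum of a partition of unity is taken in the form \<open>1 - \<Prod>(1 - \<eta>)\<close>, which avoids dividing by the sum
  of the bumps: one more factor changes it by \<open>\<eta>\<close> times a function, which is supported in a chart.\<close>

lemma balance_partition_zero:
  assumes t: "t \<in> I"
  shows "finite N \<Longrightarrow> (\<And>\<eta>. \<eta> \<in> N \<Longrightarrow> chart_supported \<eta>) \<Longrightarrow>
    (LINT p:K|\<mu>. balance (\<lambda>p. 1 - (\<Prod>\<eta>\<in>N. 1 - \<eta> p)) t p) = 0"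
proof (induction N rule: finite_induct)
  case empty
  obtain c where c: "c \<in> A" using nonempty by auto
  show ?case by (rule balance_chart_zero[OF c t, of _ "{}"]) (auto simp: C1_map_const)
next
  case (insert \<eta> N)
  define Q where "Q p = (\<Prod>\<eta>\<in>N. 1 - \<eta> p)" for p
  have Q: "C1_map Q" unfolding Q_def[abs_def]
    by (rule C1_map_prod[OF insert(1)]) (use insert(4) in \<open>auto simp: chart_supported_def\<close>)
  obtain c C where \<eta>: "C1_map \<eta>" "c \<in> A" "compact C" "C \<subseteq> fst c" "\<And>p. p \<notin> C \<Longrightarrow> \<eta> p = 0"
    using insert(4)[of \<eta>] by (auto simp: chart_supported_def)
  have \<eta>Q: "C1_map (\<lambda>p. \<eta> p * Q p)" by (rule C1_map_mult[OF \<eta>(1) Q])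
  have Q1: "C1_map (\<lambda>p. 1 - Q p)" by (rule C1_map_diff[OF C1_map_const Q])
  have eq: "(\<lambda>p. 1 - (\<Prod>\<eta>\<in>insert \<eta> N. 1 - \<eta> p)) = (\<lambda>p. \<eta> p * Q p + (1 - Q p))"
    using insert(1,2) by (auto simp: Q_def algebra_simps)
  have "(LINT p:K|\<mu>. balance (\<lambda>p. \<eta> p * Q p + (1 - Q p)) t p)
      = (LINT p:K|\<mu>. balance (\<lambda>p. \<eta> p * Q p) t p + balance (\<lambda>p. 1 - Q p) t p)"
    by (rule set_lebesgue_integral_cong[OF K_sets(1)]) (use K(2) balance_add[OF \<eta>Q Q1] in auto)
  also have "\<dots> = (LINT p:K|\<mu>. balance (\<lambda>p. \<eta> p * Q p) t p) + (LINT p:K|\<mu>. balance (\<lambda>p. 1 - Q p) t p)"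
    by (rule set_integral_add(2)) (intro integrable_on_K balance_continuous \<eta>Q Q1 t)+
  also have "(LINT p:K|\<mu>. balance (\<lambda>p. \<eta> p * Q p) t p) = 0"
    by (rule balance_chart_zero[OF \<eta>(2) t \<eta>Q \<eta>(3,4)]) (simp add: \<eta>(5))
  also have "(LINT p:K|\<mu>. balance (\<lambda>p. 1 - Q p) t p) = 0"
    using insert(3,4) by (simp add: Q_def)
  finally show ?case unfolding eq by simp
qed

text \<open>Bumps that equal \<open>1\<close> near the points of \<open>K\<close> give a cut-off function that is constant \<open>1\<close> near \<open>K\<close>, so
  its gradient contributes nothing.\<close>

lemma integral_calibration_rate:
  assumes t: "t \<in> I"
  shows "(LINT p:K|\<mu>. calibration_rate t p) = (LINT p:K|\<mu>. defect t p)"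
proof -
  have "\<exists>\<eta> V. chart_supported \<eta> \<and> open V \<and> p \<in> V \<and> (\<forall>q\<in>V. \<eta> q = 1)" if p: "p \<in> K" for p
  proof -
    have c: "chart_at p \<in> A" "p \<in> fst (chart_at p)" using chart_at p K(2) by auto
    let ?c = "chart_at p"
    obtain r where r: "r > 0" "cball (snd ?c p) r \<subseteq> chart_image ?c" using chart_ball[OF c] by blast
    obtain \<eta> where \<eta>: "C1_map \<eta>" "\<And>q. q \<notin> chart_inv ?c ` cball (snd ?c p) r \<Longrightarrow> \<eta> q = 0"
      "\<And>q. q \<in> fst ?c \<Longrightarrow> snd ?c q \<in> ball (snd ?c p) (r / 2) \<Longrightarrow> \<eta> q = 1"
      using chart_bump[OF c(1) r] by blast
    have "chart_supported \<eta>" unfolding chart_supported_def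
      using \<eta>(1,2) c(1) chart_ball_preimage(2,3)[OF c(1) r(2)] by (metis Int_lower1)
    moreover have "open (fst ?c \<inter> snd ?c -` ball (snd ?c p) (r / 2))" by (rule chart_ball_preimage(1)[OF c(1)])
    ultimately show ?thesis using \<eta>(3) c(2) r(1)
      by (intro exI[of _ \<eta>] exI[of _ "fst ?c \<inter> snd ?c -` ball (snd ?c p) (r / 2)"]) auto
  qed
  then obtain \<eta> V where \<eta>: "\<And>p. p \<in> K \<Longrightarrow> chart_supported (\<eta> p) \<and> open (V p) \<and> p \<in> V p \<and> (\<forall>q\<in>V p. \<eta> p q = 1)"
    by metis
  obtain D where D: "D \<subseteq> K" "finite D" "K \<subseteq> (\<Union>p\<in>D. V p)"
    using compactE_image[OF K(1), of K V] \<eta> by (metis UN_iff subsetI)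
  define \<theta> where "\<theta> q = 1 - (\<Prod>h\<in>\<eta> ` D. 1 - h q)" for q
  have \<theta>1: "\<theta> q = 1" if "p \<in> D" "q \<in> V p" for p q
  proof -
    have "1 - \<eta> p q = 0" using that D(1) \<eta>[of p] by auto
    then have "(\<Prod>h\<in>\<eta> ` D. 1 - h q) = 0" using that(1) D(2) by (auto simp: prod_zero_iff)
    then show ?thesis by (simp add: \<theta>_def)
  qed
  have bal: "balance \<theta> t q = calibration_rate t q - defect t q" if q: "q \<in> K" for q
  proof -
    obtain p where p: "p \<in> D" "q \<in> V p" using D(3) q by auto
    have "gradient_flux \<theta> t q = 0"
      by (rule gradient_flux_zero[of q "V p" _ 1]) (use p D(1) \<eta>[of p] \<theta>1[OF p(1)] q K(2) in auto)
    then show ?thesis using \<theta>1[OF p] by (simp add: balance_def)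
  qed
  have "(LINT q:K|\<mu>. calibration_rate t q - defect t q) = (LINT q:K|\<mu>. balance \<theta> t q)"
    by (rule set_lebesgue_integral_cong[OF K_sets(1)]) (use bal in auto)
  also have "\<dots> = 0" unfolding \<theta>_def[abs_def]
    by (rule balance_partition_zero[OF t]) (use D \<eta> in auto)
  finally show ?thesis
    using set_integral_diff(2)[OF integrable_on_K[OF slice_continuous[OF calibration_rate_continuous t]]
        integrable_on_K[OF slice_continuous[OF time_Ck_continuous[OF time_Ck_defect] t]]]
    by simp
qed

section \<open>The second variation\<close>

definition weighted_area :: "real \<Rightarrow> 'l \<Rightarrow> real" where
  "weighted_area t p = exp (log_weight (\<Phi> t p)) * area_ratio (\<Phi> t) F p"

lemma frame_initial: 
  assumes "c \<in> A" "p \<in> fst c" shows "frame c (\<Phi> 0) (snd c p) = frame c F (snd c p)"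
  by (rule frame_local[OF assms smooth_F points_open]) (use assms chart_subset_points initial in blast)+

text \<open>The exponents differ by \<open>\<kappa> / 4 * |\<Phi> t p - F p|^2\<close>, which is where \<open>\<kappa> \<ge> 0\<close> is needed, and the complex
  determinant is at most the area.\<close>

lemma Re_calibration_le:
  assumes t: "t \<in> I" and p: "p \<in> points A"
  shows "Re (calibration t p) \<le> weighted_area t p"
proof -
  note c = chart_at[OF p]
  let ?c = "chart_at p"
  have x: "snd ?c p \<in> chart_image ?c" using c(2) by auto
  have "log_weight (\<Phi> t p) - Re (exponent t p) = \<kappa> / 4 * (norm (\<Phi> t p - F p))\<^sup>2"
    by (simp add: log_weight_def exponent_def Re_herm drift_def power2_norm_eq_inner inner_diff_left inner_diff_right
        inner_commute algebra_simps)
  also have "\<dots> \<ge> 0" using \<kappa> by simp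
  finally have e: "Re (exponent t p) \<le> log_weight (\<Phi> t p)" by simp
  have d: "norm (det (frame ?c (\<Phi> t) (snd ?c p))) \<le> area_density ?c (\<Phi> t) (snd ?c p)"
    unfolding area_density_def gram_eq_real_gram
    by (rule norm_det_le_sqrt_gram) (rule frame_independent[OF immersion_\<Phi>[OF t] c(1) x])
  have "Re (calibration t p) \<le> norm (calibration t p)" by (rule complex_Re_le_cmod)
  also have "\<dots> = exp (Re (exponent t p)) * norm (det (frame ?c (\<Phi> t) (snd ?c p))) / area_density ?c F (snd ?c p)"
    by (simp add: calibration_def norm_mult norm_divide norm_det_frame(1)[OF c(1) x])
  also have "\<dots> \<le> exp (log_weight (\<Phi> t p)) * area_density ?c (\<Phi> t) (snd ?c p) / area_density ?c F (snd ?c p)"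
    using e d det_gram_pos(2)[OF immersion_F c(1) x] by (intro divide_right_mono mult_mono) auto
  finally show ?thesis by (simp add: weighted_area_def area_ratio_def)
qed

text \<open>At time \<open>0\<close> both determinants agree, and so do both exponents.\<close>

lemma calibration_initial:
  assumes p: "p \<in> points A" shows "calibration 0 p = of_real (weighted_area 0 p)"
proof -
  note c = chart_at[OF p]
  have x: "snd (chart_at p) p \<in> chart_image (chart_at p)" using c(2) by auto
  have "calibration 0 p = exp (of_real (log_weight (F p)))"
    using norm_det_frame(2)[OF c(1) x]
    by (simp add: calibration_def frame_initial[OF c] exponent_def initial[OF p] herm_simps)
  moreover have "area_ratio (\<Phi> 0) F p = 1"
    using det_gram_pos(2)[OF immersion_F c(1) x]
    by (simp add: area_ratio_def area_density_def gram_eq_real_gram frame_initial[OF c])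
  ultimately show ?thesis by (simp add: weighted_area_def initial[OF p] exp_of_real)
qed

lemma time_Ck_weighted_area: "time_Ck k I (points A) weighted_area"
proof (rule time_Ck_points)
  fix c assume c: "c \<in> A"
  have ip: "snd c p \<in> chart_image c" if "p \<in> fst c" for p using that by auto
  have "time_Ck k I (fst c) (\<lambda>t p. gram c (\<Phi> t) (snd c p) $ i $ j)" for i j
    unfolding gram_eq_real_gram real_gram_def vec_lambda_beta
    by (rule time_Ck_inner[OF time_Ck_frame[OF c] time_Ck_frame[OF c]])
  from time_Ck_sqrt[OF time_Ck_det[OF this]]
  have a: "time_Ck k I (fst c) (\<lambda>t p. area_density c (\<Phi> t) (snd c p))"
    unfolding area_density_def using det_gram_pos(1)[OF immersion_\<Phi> c ip] by blast
  have "continuous_on (fst c) (\<lambda>p. inverse (area_density c F (snd c p)))"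
    using det_gram_pos(2)[OF immersion_F c ip]
    by (intro continuous_on_inverse continuous_on_compose2[OF area_density_continuous[OF smooth_F c] chart_continuous(1)[OF c]])
       (auto simp: less_imp_neq[symmetric])
  note i = time_Ck_const[OF this]
  have "time_Ck k I (fst c) (\<lambda>t p. \<kappa> / 4 * (\<Phi> t p \<bullet> \<Phi> t p) - \<Phi> t p \<bullet> T)"
    by (rule time_Ck_diff[OF time_Ck_mult[OF time_Ck_const[OF continuous_on_const] time_Ck_inner[OF time_Ck_\<Phi>[OF c] time_Ck_\<Phi>[OF c]]]
          time_Ck_inner[OF time_Ck_\<Phi>[OF c] time_Ck_const[OF continuous_on_const]]])
  then have "time_Ck k I (fst c) (\<lambda>t p. log_weight (\<Phi> t p))" by (simp add: log_weight_def dot_square_norm)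
  from time_Ck_mult[OF time_Ck_exp[OF this] time_Ck_mult[OF a i]]
  show "time_Ck k I (fst c) weighted_area"
    by (rule time_Ck_cong[OF I(1), THEN iffD1, rotated])
       (simp add: weighted_area_def area_ratio_eq[OF c _ smooth_F smooth_map_\<Phi>] divide_inverse)
qed

lemma f_volume_eq:
  assumes t: "t \<in> I" and f: "\<And>z. exp (- (1 / 2) * f z) = exp (log_weight z)"
  shows "f_volume A f (\<Phi> t) K = (LINT p:K|\<mu>. weighted_area t p)"
proof -
  have "continuous_on (points A) (\<lambda>p. exp (log_weight (\<Phi> t p)))"
    unfolding log_weight_def by (intro continuous_intros smooth_map_continuous[OF smooth_map_\<Phi>[OF t]])
  note m = borel_measurable_continuous_on_restrict[OF this]
    borel_measurable_continuous_on_restrict[OF area_ratio_continuous[OF immersion_F immersion_\<Phi>[OF t]]]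
  note [measurable] = m[THEN sets_volume_measure(3)[OF nonempty immersion_F, THEN iffD2]]
  have [measurable]: "K \<in> sets \<mu>" by (rule K_sets(1))
  have "f_volume A f (\<Phi> t) K
      = (LINT p|density \<mu> (\<lambda>p. ennreal (area_ratio (\<Phi> t) F p)). indicator K p *\<^sub>R exp (log_weight (\<Phi> t p)))"
    unfolding f_volume_def f set_lebesgue_integral_def
      volume_measure_change[OF nonempty immersion_F immersion_\<Phi>[OF t]] ..
  also have "\<dots> = (LINT p|\<mu>. area_ratio (\<Phi> t) F p *\<^sub>R (indicator K p *\<^sub>R exp (log_weight (\<Phi> t p))))"
  proof (rule integral_density)
    show "AE p in \<mu>. 0 \<le> area_ratio (\<Phi> t) F p"
      by (rule AE_I2) (use area_ratio_pos[OF immersion_F immersion_\<Phi>[OF t]] space_\<mu> in \<open>auto simp: less_imp_le\<close>)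
  qed measurable
  finally show ?thesis by (simp add: set_lebesgue_integral_def weighted_area_def mult_ac)
qed

lemma set_integral_derivative:
  fixes f :: "real \<Rightarrow> 'l \<Rightarrow> 'b::{banach, second_countable_topology}"
  assumes f: "\<And>t. t \<in> I \<Longrightarrow> continuous_on (points A) (f t)"
    and f': "continuous_on (I \<times> points A) (\<lambda>(t, p). f' t p)"
    and der: "\<And>t p. t \<in> I \<Longrightarrow> p \<in> points A \<Longrightarrow> ((\<lambda>s. f s p) has_vector_derivative f' t p) (at t)"
    and t: "t \<in> I"
  shows "((\<lambda>s. LINT p:K|\<mu>. f s p) has_vector_derivative (LINT p:K|\<mu>. f' t p)) (at t)"
  by (rule has_vector_derivative_set_integral[OF K_sets K(1) K_finite I(1) t])
     (use K(2) f der in \<open>auto intro: continuous_on_subset[OF f] continuous_on_subset[OF f']\<close>)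

text \<open>At \<open>t = 0\<close> only the factor \<open>\<Phi> t - F\<close> needs to be differentiated. Writing \<open>\<xi> = \<i> Y\<close> with \<open>Y\<close> tangent, one
  factor \<open>\<i>\<close> comes from the Hermitian product and one from the determinant, which makes the derivative
  \<open>\<kappa> / 2 * exp (log_weight F) * |Y|^2\<close>.\<close>

lemma Re_defect_derivative_nonneg:
  assumes p: "p \<in> points A" and d: "((\<lambda>s. defect s p) has_vector_derivative d) (at 0)"
  shows "Re d \<ge> 0"
proof -
  note c = chart_at[OF p]
  let ?c = "chart_at p"
  let ?M = "frame ?c F (snd ?c p)"
  have x: "snd ?c p \<in> chart_image ?c" using c(2) by auto
  define w where "w i s = exp (exponent s p) * det (replace_row i (velocity s p) (frame ?c (\<Phi> s) (snd ?c p))) * inverse (det ?M)" for i s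
  have "\<exists>w'. (w i has_vector_derivative w') (at 0)" for i
  proof -
    have "time_Ck (Suc 0) I (fst ?c) (\<lambda>s p. exp (exponent s p) * det (replace_row i (velocity s p) (frame ?c (\<Phi> s) (snd ?c p)))
      * inverse (det (frame ?c F (snd ?c p))))"
      by (rule time_Ck_replace_row[OF c(1)])
    then show ?thesis unfolding w_def using I(2) c(2) by auto
  qed
  then obtain w' where w': "\<And>i. (w i has_vector_derivative w' i) (at 0)" by metis
  have "((\<lambda>s. \<Phi> s p - F p) has_vector_derivative \<xi> p) (at 0)"
    using has_vector_derivative_diff[OF initial_velocity[OF p] has_vector_derivative_const, of "F p"] by simp
  from bounded_linear.has_vector_derivative[OF bounded_bilinear.bounded_linear_left[OF bounded_bilinear_herm] this]
  have h: "((\<lambda>s. herm (\<Phi> s p - F p) (?M $ i)) has_vector_derivative herm (\<xi> p) (?M $ i)) (at 0)" for i .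
  have "((\<lambda>s. - of_real (\<kappa> / 2) * (\<Sum>i\<in>UNIV. herm (\<Phi> s p - F p) (?M $ i) * w i s)) has_vector_derivative
      - of_real (\<kappa> / 2) * (\<Sum>i\<in>UNIV. herm (\<Phi> 0 p - F p) (?M $ i) * w' i + herm (\<xi> p) (?M $ i) * w i 0)) (at 0)"
    by (intro has_vector_derivative_mult_right has_vector_derivative_sum has_vector_derivative_mult h w')
  moreover have "(\<lambda>s. defect s p) = (\<lambda>s. - of_real (\<kappa> / 2) * (\<Sum>i\<in>UNIV. herm (\<Phi> s p - F p) (?M $ i) * w i s))"
    unfolding defect_def flux_eq_sum w_def ..
  ultimately have d_eq: "d = - of_real (\<kappa> / 2) * (\<Sum>i\<in>UNIV. herm (\<xi> p) (?M $ i) * w i 0)"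
    using vector_derivative_unique_at[OF d] initial[OF p] by (simp add: herm_simps)
  obtain X where X: "\<xi> p = (\<Sum>k\<in>UNIV. (\<i> * of_real (X k)) *s (?M $ k))"
    using normal_coordinates[OF c normal[OF c]] by blast
  define Y where "Y = (\<Sum>k\<in>UNIV. X k *\<^sub>R ?M $ k)"
  have hX: "herm (\<xi> p) (?M $ i) = \<i> * of_real (Y \<bullet> ?M $ i)" for i
  proof -
    have "herm (\<xi> p) (?M $ i) = (\<Sum>k\<in>UNIV. \<i> * of_real (X k) * of_real (gram ?c F (snd ?c p) $ k $ i))"
      unfolding X herm_sum_left herm_simps herm_frame_real(2)[OF c(1) x] ..
    also have "\<dots> = \<i> * of_real (\<Sum>k\<in>UNIV. X k * gram ?c F (snd ?c p) $ k $ i)"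
      by (simp add: sum_distrib_left mult.assoc)
    finally show ?thesis by (simp add: Y_def inner_sum_left gram_eq_real_gram real_gram_def)
  qed
  have w0: "w i 0 = exp (of_real (log_weight (F p))) * (\<i> * of_real (X i))" for i
  proof -
    have "det (replace_row i (\<xi> p) ?M) = \<i> * of_real (X i) * det ?M"
      by (rule det_replace_row_combination[OF X])
    then show ?thesis
      using norm_det_frame(2)[OF c(1) x]
      by (simp add: w_def velocity_initial[OF p] frame_initial[OF c] exponent_def initial[OF p] herm_simps)
  qed
  have "(\<Sum>i\<in>UNIV. herm (\<xi> p) (?M $ i) * w i 0) = - of_real (exp (log_weight (F p)) * (\<Sum>i\<in>UNIV. X i * (Y \<bullet> ?M $ i)))"
    unfolding hX w0 by (simp add: exp_of_real[symmetric] sum_distrib_left sum_negf[symmetric] mult_ac)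
  also have "(\<Sum>i\<in>UNIV. X i * (Y \<bullet> ?M $ i)) = Y \<bullet> Y"
    by (subst (3) Y_def) (simp add: inner_sum_right)
  finally have "d = of_real (\<kappa> / 2 * (exp (log_weight (F p)) * (Y \<bullet> Y)))"
    unfolding d_eq by simp
  then have "Re d = \<kappa> / 2 * (exp (log_weight (F p)) * (Y \<bullet> Y))" by (simp only: Re_complex_of_real)
  moreover have "0 \<le> \<kappa> / 2 * (exp (log_weight (F p)) * (Y \<bullet> Y))" using \<kappa> by simp
  ultimately show ?thesis by simp
qed

text \<open>\<open>V\<close> is the weighted volume, \<open>J\<close> the integral of \<open>calibration\<close>. The difference of \<open>V\<close> and \<open>Re J\<close> has a
  minimum at \<open>0\<close>, so \<open>V'' \<ge> Re J''\<close> there; and \<open>J'\<close> is the integral of \<open>defect\<close>.\<close>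

theorem second_variation_nonneg:
  assumes f: "\<And>z. exp (- (1 / 2) * f z) = exp (log_weight z)"
  shows "0 \<le> second_variation A f K \<Phi>"
proof -
  have "time_Ck (Suc (Suc 0)) I (points A) weighted_area" by (rule time_Ck_weighted_area)
  then obtain v' v'' where v: 
    "continuous_on (I \<times> points A) (\<lambda>(t, p). weighted_area t p)" "continuous_on (I \<times> points A) (\<lambda>(t, p). v' t p)"
    "continuous_on (I \<times> points A) (\<lambda>(t, p). v'' t p)"
    "\<And>t p. t \<in> I \<Longrightarrow> p \<in> points A \<Longrightarrow> ((\<lambda>s. weighted_area s p) has_vector_derivative v' t p) (at t)"
    "\<And>t p. t \<in> I \<Longrightarrow> p \<in> points A \<Longrightarrow> ((\<lambda>s. v' s p) has_vector_derivative v'' t p) (at t)"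
    by auto
  have "time_Ck (Suc 0) I (points A) defect" by (rule time_Ck_defect)
  then obtain r' where r: "continuous_on (I \<times> points A) (\<lambda>(t, p). defect t p)" "continuous_on (I \<times> points A) (\<lambda>(t, p). r' t p)"
    "\<And>t p. t \<in> I \<Longrightarrow> p \<in> points A \<Longrightarrow> ((\<lambda>s. defect s p) has_vector_derivative r' t p) (at t)"
    by auto
  define V V' V'' where "V t = (LINT p:K|\<mu>. weighted_area t p)" and "V' t = (LINT p:K|\<mu>. v' t p)"
    and "V'' t = (LINT p:K|\<mu>. v'' t p)" for t
  define J J' J'' where "J t = (LINT p:K|\<mu>. calibration t p)" and "J' t = (LINT p:K|\<mu>. defect t p)"
    and "J'' t = (LINT p:K|\<mu>. r' t p)" for t
  have dV: "(V has_real_derivative V' t) (at t)" if "t \<in> I" for t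
    unfolding has_real_derivative_iff_has_vector_derivative V_def[abs_def] V'_def
    by (rule set_integral_derivative[OF slice_continuous[OF v(1)] v(2) v(4) that])
  have dV': "(V' has_real_derivative V'' t) (at t)" if "t \<in> I" for t
    unfolding has_real_derivative_iff_has_vector_derivative V'_def[abs_def] V''_def
    by (rule set_integral_derivative[OF slice_continuous[OF v(2)] v(3) v(5) that])
  have dJ: "(J has_vector_derivative J' t) (at t)" if "t \<in> I" for t
    unfolding J_def[abs_def] J'_def integral_calibration_rate[OF that, symmetric]
    by (rule set_integral_derivative[OF slice_continuous[OF time_Ck_continuous[OF time_Ck_calibration]]
          calibration_rate_continuous calibration_has_rate that])
  have dJ': "(J' has_vector_derivative J'' t) (at t)" if "t \<in> I" for t
    unfolding J'_def[abs_def] J''_def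
    by (rule set_integral_derivative[OF slice_continuous[OF r(1)] r(2) r(3) that])
  have dRe: "((\<lambda>s. Re (g s)) has_real_derivative Re g') (at t)" if "(g has_vector_derivative g') (at t)" for g g' t
    unfolding has_real_derivative_iff_has_vector_derivative
    by (rule bounded_linear.has_vector_derivative[OF bounded_linear_Re that])
  have ReJ: "Re (J t) = (LINT p:K|\<mu>. Re (calibration t p))" if "t \<in> I" for t
  proof -
    have "set_integrable \<mu> K (calibration t)"
      by (rule integrable_on_K[OF slice_continuous[OF time_Ck_continuous[OF time_Ck_calibration] that]])
    then show ?thesis unfolding J_def set_lebesgue_integral_def set_integrable_def
      using integral_bounded_linear[OF bounded_linear_Re, of \<mu> "\<lambda>p. indicator K p *\<^sub>R calibration t p"] by simp
  qed
  have J''_nonneg: "Re (J'' 0) \<ge> 0"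
  proof -
    have "set_integrable \<mu> K (r' 0)" by (rule integrable_on_K[OF slice_continuous[OF r(2) I(2)]])
    then have "Re (J'' 0) = (LINT p:K|\<mu>. Re (r' 0 p))" unfolding J''_def set_lebesgue_integral_def set_integrable_def
      using integral_bounded_linear[OF bounded_linear_Re, of \<mu> "\<lambda>p. indicator K p *\<^sub>R r' 0 p"] by simp
    also have "\<dots> \<ge> 0" unfolding set_lebesgue_integral_def
      by (rule Bochner_Integration.integral_nonneg) (use Re_defect_derivative_nonneg[OF _ r(3)[OF I(2)]] K(2) in \<open>auto simp: indicator_def\<close>)
    finally show ?thesis .
  qed
  have le: "V 0 - Re (J 0) \<le> V s - Re (J s)" if s: "s \<in> I" for s
  proof -
    have "V 0 = Re (J 0)" unfolding ReJ[OF I(2)] V_def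
      by (rule set_lebesgue_integral_cong[OF K_sets(1)]) (use calibration_initial K(2) in auto)
    moreover have "Re (J s) \<le> V s" unfolding ReJ[OF s] V_def
    proof (rule set_integral_mono)
      show "set_integrable \<mu> K (\<lambda>p. Re (calibration s p))"
        by (intro integrable_on_K continuous_on_Re slice_continuous[OF time_Ck_continuous[OF time_Ck_calibration] s])
      show "set_integrable \<mu> K (weighted_area s)" by (rule integrable_on_K[OF slice_continuous[OF v(1) s]])
    qed (use Re_calibration_le[OF s] K(2) in auto)
    ultimately show ?thesis by simp
  qed
  have "0 \<le> V'' 0 - Re (J'' 0)"
    by (rule second_derivative_nonneg_at_min[OF I, of "\<lambda>s. V s - Re (J s)" "\<lambda>s. V' s - Re (J' s)"])
       (use le in \<open>auto intro!: DERIV_diff dV dV' dRe dJ dJ' I(2)\<close>)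
  then have "0 \<le> V'' 0" using J''_nonneg by simp
  moreover have "second_variation A f K \<Phi> = V'' 0"
  proof -
    have "((\<lambda>t. f_volume A f (\<Phi> t) K) has_real_derivative V' t) (at t)" if "t \<in> I" for t
      by (rule has_field_derivative_transform_within_open[OF dV[OF that] I(1) that])
         (simp add: V_def f_volume_eq[OF _ f])
    then have d1: "deriv (\<lambda>t. f_volume A f (\<Phi> t) K) t = V' t" if "t \<in> I" for t
      using that by (blast intro: DERIV_imp_deriv)
    have "(deriv (\<lambda>t. f_volume A f (\<Phi> t) K) has_real_derivative V'' 0) (at 0)"
      by (rule has_field_derivative_transform_within_open[OF dV'[OF I(2)] I]) (simp add: d1)
    then show ?thesis unfolding second_variation_def by (rule DERIV_imp_deriv)
  qed
  ultimately show ?thesis by simp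
qed

end

lemma gradient_eqI:
  assumes "GDERIV f z :> D" shows "gradient f z = D"
  unfolding gradient_def
proof (rule the_equality[where P="\<lambda>D. GDERIV f z :> D", OF assms])
  fix D' assume "GDERIV f z :> D'"
  then have "(\<lambda>h. h \<bullet> D') = (\<lambda>h. h \<bullet> D)"
    using assms unfolding gderiv_def by (rule has_derivative_unique)
  then show "D' = D" by (metis vector_eq_ldot)
qed

text \<open>The common form of both cases. For the empty atlas the weighted volume is constantly zero.\<close>

lemma (in lagrangian_submanifold) soliton_stable:
  assumes \<kappa>: "\<kappa> \<ge> 0"
    and soliton: "\<And>c p. c \<in> A \<Longrightarrow> p \<in> fst c \<Longrightarrow> mean_curvature c F p = normal_part c F p ((\<kappa> / 2) *\<^sub>R F p - T)"
    and f: "\<And>z. - (1 / 2) * f z = \<kappa> / 4 * (norm z)\<^sup>2 - z \<bullet> T"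
    and grad: "\<And>z. gradient f z = (- 2) *\<^sub>R ((\<kappa> / 2) *\<^sub>R z - T)"
  shows "f_stable A f F"
  unfolding f_stable_def
proof (intro conjI ballI allI impI)
  have "(1 / 2) *\<^sub>R normal_part c F p (gradient f (F p)) = - normal_part c F p ((\<kappa> / 2) *\<^sub>R F p - T)"
    if "c \<in> A" "p \<in> fst c" for c p
    unfolding grad normal_part_scaleR[OF smooth_F that] by simp
  then show "f_minimal_lagrangian A f F"
    unfolding f_minimal_lagrangian_def using lagrangian soliton by simp
  fix \<xi> K \<Phi> assume \<xi>: "\<xi> \<in> normal_sections A F" and var: "compact_variation A F \<xi> K \<Phi>"
  show "0 \<le> second_variation A f K \<Phi>"
  proof (cases "A = {}")
    case True
    then have "K = {}" using var by (auto simp: compact_variation_def points_def)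
    then show ?thesis by (simp add: second_variation_def f_volume_def set_lebesgue_integral_def)
  next
    case False
    obtain \<epsilon> where "\<epsilon> > 0"
      "\<forall>c\<in>A. smooth_on ({-\<epsilon><..<\<epsilon>} \<times> chart_image c) (\<lambda>(t, x). local_rep c (\<Phi> t) x)"
      "\<forall>t\<in>{-\<epsilon><..<\<epsilon>}. immersion A (\<Phi> t)"
      "\<forall>t\<in>{-\<epsilon><..<\<epsilon>}. \<forall>p\<in>points A - K. \<Phi> t p = F p"
      using var unfolding compact_variation_def by blast
    note \<epsilon> = this(1) bspec[OF this(2)] bspec[OF this(3)] bspec[OF bspec[OF this(4)]]
    interpret soliton_variation A F \<kappa> T \<xi> K \<Phi> "{-\<epsilon><..<\<epsilon>}"
      using False \<kappa> soliton \<xi> var \<epsilon>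
      by unfold_locales (auto simp: normal_sections_def compact_variation_def)
    show ?thesis by (rule second_variation_nonneg) (simp only: f log_weight_def)
  qed
qed

theorem corollary1p2:
  fixes A :: "('l::{t2_space, second_countable_topology}, 'm::finite) chart set"
    and F :: "'l \<Rightarrow> complex ^ 'm"
  assumes "lagrangian A F"
  shows "((\<forall>c\<in>A. \<forall>p\<in>fst c.
             mean_curvature c F p - (1 / 2) *\<^sub>R normal_part c F p (F p) = 0)
           \<longrightarrow> f_stable A (\<lambda>z. - ((norm z)\<^sup>2 / 2)) F)
       \<and> (\<forall>T :: complex ^ 'm.
           (\<forall>c\<in>A. \<forall>p\<in>fst c. mean_curvature c F p + normal_part c F p T = 0)
           \<longrightarrow> f_stable A (\<lambda>z. 2 * (z \<bullet> T)) F)"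
proof -
  interpret lagrangian_submanifold A F
    by unfold_locales (use assms in \<open>auto simp: lagrangian_def\<close>)
  show ?thesis
  proof (intro conjI impI allI)
    assume H: "\<forall>c\<in>A. \<forall>p\<in>fst c. mean_curvature c F p - (1 / 2) *\<^sub>R normal_part c F p (F p) = 0"
    show "f_stable A (\<lambda>z. - ((norm z)\<^sup>2 / 2)) F"
    proof (rule soliton_stable[where \<kappa>=1 and T=0])
      show "mean_curvature c F p = normal_part c F p ((1 / 2) *\<^sub>R F p - 0)" if "c \<in> A" "p \<in> fst c" for c p
        using H that by (simp add: normal_part_scaleR[OF smooth_F that])
      show "gradient (\<lambda>z. - ((norm z)\<^sup>2 / 2)) z = (- 2) *\<^sub>R ((1 / 2) *\<^sub>R z - 0)" for z :: "complex ^ 'm"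
        by (rule gradient_eqI)
           (auto simp: gderiv_def power2_norm_eq_inner inner_commute intro!: derivative_eq_intros)
    qed auto
  next
    fix T :: "complex ^ 'm"
    assume H: "\<forall>c\<in>A. \<forall>p\<in>fst c. mean_curvature c F p + normal_part c F p T = 0"
    show "f_stable A (\<lambda>z. 2 * (z \<bullet> T)) F"
    proof (rule soliton_stable[where \<kappa>=0 and T=T])
      show "mean_curvature c F p = normal_part c F p ((0 / 2) *\<^sub>R F p - T)" if "c \<in> A" "p \<in> fst c" for c p
        using H that normal_part_scaleR[OF smooth_F that, of "-1" T] by (simp add: add_eq_0_iff)
      show "gradient (\<lambda>z. 2 * (z \<bullet> T)) z = (- 2) *\<^sub>R ((0 / 2) *\<^sub>R z - T)" for z :: "complex ^ 'm"
        by (rule gradient_eqI) (auto simp: gderiv_def intro!: derivative_eq_intros)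
    qed auto
  qed
qed

end
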